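(* Let $\alpha,\beta>0$ with $\alpha\beta=1$ and let $N$ be an even positive integer. Consider the two-periodic Aztec diamond of size $2N$, i.e. the model defined in the context. Then it is a determinantal point process on the levels $4m$, $0<m<N$: for every $n\ge N$ and all distinct points $(4m_k,2\xi_k+r_k)$, $k=1,\dots,\ell$, with $0<m_k<N$, $-N\le\xi_k\le-1$, $r_k\in\{0,1\}$, $$\mathbb P_n\big(\text{points at }(4m_k,\,2n+2\xi_k+r_k),\ k=1,\dots,\ell\big)=\det\Big(K(4m_k,2\xi_k+r_k;4m_l,2\xi_l+r_l)\Big)_{k,l=1}^{\ell},$$ where, for $-N\le\xi,\xi'\le-1$ and $0<m,m'<N$ (row index $i$, column index $j$), $$\left[K(4m,2\xi+j;4m',2\xi'+i)\right]_{i,j=0}^{1}=-\frac{\chi_{m>m'}}{2\pi\mathrm i}\int_{\gamma_{0,1}}\Phi(z)^{m-m'}z^{\xi'-\xi}\frac{dz}{z}+\frac{1}{(2\pi\mathrm i)^2}\int_{\gamma_1}\int_{\gamma_{0,1}}\frac{w^{\xi'}}{z^{\xi+1}}\,\frac{\rho_1(w)^{\frac N2-m'}}{z-w}\,\frac{(1-z^{-1})^N}{(1-w^{-1})^N}\;E(w)\begin{pmatrix}1&0\\0&0\end{pmatrix}E(w)^{-1}\,\Phi(z)^{m-\frac N2}\,dz\,dw .$$ Here $$\Phi(z)=\frac{1}{(1-z^{-1})^2}\begin{pmatrix}1&\alpha^2z^{-1}\\ \beta^2&1\end{pmatrix}^2\begin{pmatrix}1&z^{-1}\\1&1\end{pmatrix}^2,$$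 $\rho_1(z),\rho_2(z)$ are the eigenvalues of $\Phi(z)$, with $$\rho_1(z)=\frac{(z+1)^2+2z(\alpha^2+\beta^2)+2(\alpha+\beta)\sqrt{z(z^2+(\alpha^2+\beta^2)z+1)}}{(z-1)^2},$$ $\rho_2$ the same expression with a minus sign in front of the term with the square root, the square root being analytic on $\mathbb C\setminus(-\infty,0]$ and positive for $z>0$; $\Phi(z)=E(z)\,\mathrm{diag}(\rho_1(z),\rho_2(z))\,E(z)^{-1}$ is an eigenvalue decomposition; $\gamma_1$ (the $w$-contour) is a positively oriented simple closed contour in $\mathbb C\setminus(-\infty,0]$ around $1$; and $\gamma_{0,1}$ (the $z$-contour) is a positively oriented simple closed contour around $0$ and $\gamma_1$.
   Context: The model. For $k=0,1,\dots,N-1$ let $$\phi_{4k+1}(z)=\begin{pmatrix}1&\alpha^2z^{-1}\\\beta^2&1\end{pmatrix},\quad \phi_{4k+2}(z)=\frac1{1-z^{-1}}\begin{pmatrix}1&\alpha^2z^{-1}\\\beta^2&1\end{pmatrix},\quad \phi_{4k+3}(z)=\begin{pmatrix}1&z^{-1}\\1&1\end{pmatrix},\quad \phi_{4k+4}(z)=\frac1{1-z^{-1}}\begin{pmatrix}1&z^{-1}\\1&1\end{pmatrix}.$$ Expand each $\phi_m$ in powers of $z^{-1}$ (convergent for $|z|>1$), $\phi_m(z)=\sum_k\hat\phi_m(k)z^k$, and let $T_{\phi_m}(2x+r,2y+s)=(\hat\phi_m(y-x))_{r+1,s+1}$, $r,s\in\{0,1\}$, $x,y\in\mathbb Z$,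 be the associated $2\times2$-block Toeplitz matrix. For $n\ge N$, $\mathbb P_n$ is the probability measure on point configurations $\{(m,u_m^j)\}_{1\le m\le 4N-1,\,1\le j\le 2n}$ in $\{1,\dots,4N-1\}\times\mathbb Z$ proportional to $$\prod_{m=1}^{4N}\det\left(T_{\phi_m}(u_{m-1}^j,u_m^k)\right)_{j,k=1}^{2n},\qquad u_0^j=j-1,\quad u_{4N}^j=-2N+j-1 .$$ This describes $2n$ non-intersecting paths. The part of the configuration with heights $u$ satisfying $2n-2N\le u\le 2n-1$ encodes a random domino tiling of the $2N\times2N$ Aztec diamond with two-periodic weights (after shifting heights by $-2n$, i.e. $u=2n+2\xi+r$ with $-N\le\xi\le-1$); its law does not depend on $n\ge N$. $\chi_{m>m'}=1$ if $m>m'$ and $0$ otherwise. *)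

theory Defs
  imports
    "HOL-Complex_Analysis.Complex_Analysis"
    "Jordan_Normal_Form.Gauss_Jordan_Elimination"
    "Jordan_Normal_Form.Determinant"
begin

section \<open>The model\<close>

definition aztec_block :: "real \<Rightarrow> real \<Rightarrow> complex \<Rightarrow> complex mat" where
  "aztec_block a b z = mat_of_rows_list 2
     [[1, of_real a * inverse z],
      [of_real b, 1]]"

text \<open>The symbols \<open>\<phi>\<^sub>m\<close>, \<open>m \<ge> 1\<close>; they depend on \<open>m\<close> modulo \<open>4\<close> only.\<close>

definition aztec_symbol :: "real \<Rightarrow> real \<Rightarrow> nat \<Rightarrow> complex \<Rightarrow> complex mat" where
  "aztec_symbol \<alpha> \<beta> m z =
     (if m mod 4 = 1 then aztec_block (\<alpha>\<^sup>2) (\<beta>\<^sup>2) z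
      else if m mod 4 = 2 then (1 / (1 - inverse z)) \<cdot>\<^sub>m aztec_block (\<alpha>\<^sup>2) (\<beta>\<^sup>2) z
      else if m mod 4 = 3 then aztec_block 1 1 z
      else (1 / (1 - inverse z)) \<cdot>\<^sub>m aztec_block 1 1 z)"

text \<open>
  The coefficients of the expansion \<open>f z = (\<Sum>k. c k * z powi k)\<close> in powers of \<open>z\<^sup>-\<^sup>1\<close>, convergent
  for \<open>|z| > 1\<close>. All symbols of the model have real coefficients; the uniqueness of such a
  family is \<open>laurent_coeff_eqI\<close> below.
\<close>

definition laurent_coeff :: "(complex \<Rightarrow> complex) \<Rightarrow> int \<Rightarrow> real" where
  "laurent_coeff f = (THE c. (\<forall>k>0. c k = 0) \<and>
     (\<forall>z. norm z > 1 \<longrightarrow> (\<lambda>k. complex_of_real (c (- int k)) * inverse z ^ k) sums f z))"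

lemma powser_eq_0_imp:
  fixes e :: "nat \<Rightarrow> complex"
  assumes "\<And>x. x \<noteq> 0 \<Longrightarrow> norm x < 1 \<Longrightarrow> (\<lambda>k. e k * x ^ k) sums 0"
  shows "e k = 0"
  using assms
proof (induction k arbitrary: e)
  case 0
  then have "((\<lambda>x::complex. 0) \<longlongrightarrow> e 0) (at 0)"
    by (intro powser_limit_0_strong[of 1]) auto
  then show ?case
    by (metis LIM_unique tendsto_const)
next
  case (Suc k)
  have e0: "e 0 = 0"
  proof -
    have "((\<lambda>x::complex. 0) \<longlongrightarrow> e 0) (at 0)"
      by (rule powser_limit_0_strong[of 1]) (use Suc.prems in auto)
    then show ?thesis
      by (metis LIM_unique tendsto_const)
  qed
  have "(\<lambda>k. e (Suc k) * x ^ k) sums 0" if x: "x \<noteq> 0" "norm x < 1" for x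
  proof -
    have "(\<lambda>k. e (Suc k) * x ^ Suc k) sums 0"
      using Suc.prems[OF x] e0 by (subst sums_Suc_iff) simp
    from sums_mult[OF this, of "inverse x"] show ?thesis
      using x by (simp add: field_simps)
  qed
  then show ?case
    by (rule Suc.IH[of "\<lambda>k. e (Suc k)"])
qed

lemma laurent_coeff_eqI:
  assumes c0: "\<And>k. k > 0 \<Longrightarrow> c k = 0"
    and c: "\<And>z. norm z > 1 \<Longrightarrow> (\<lambda>k. complex_of_real (c (- int k)) * inverse z ^ k) sums f z"
  shows "laurent_coeff f = c"
  unfolding laurent_coeff_def
proof (rule the_equality)
  show "(\<forall>k>0. c k = 0) \<and>
     (\<forall>z. norm z > 1 \<longrightarrow> (\<lambda>k. complex_of_real (c (- int k)) * inverse z ^ k) sums f z)"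
    using assms by blast
next
  fix d assume d: "(\<forall>k>0. d k = 0) \<and>
     (\<forall>z. norm z > 1 \<longrightarrow> (\<lambda>k. complex_of_real (d (- int k)) * inverse z ^ k) sums f z)"
  define e where "e k = complex_of_real (d (- int k)) - complex_of_real (c (- int k))" for k
  have "(\<lambda>k. e k * x ^ k) sums 0" if "x \<noteq> 0" "norm x < 1" for x
  proof -
    have *: "norm (inverse x) > 1"
      using that by (simp add: norm_inverse one_less_inverse)
    have "(\<lambda>k. complex_of_real (d (- int k)) * inverse (inverse x) ^ k) sums f (inverse x)"
      using d * by blast
    from sums_diff[OF this c[OF *]] show ?thesis
      by (simp add: e_def left_diff_distrib)
  qed
  then have "e k = 0" for k
    by (rule powser_eq_0_imp)
  then have *: "d (- int k) = c (- int k)" for k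
    by (simp add: e_def)
  show "d = c"
  proof
    fix k show "d k = c k"
      using c0[of k] d *[of "nat (- k)"] by (cases "k > 0") auto
  qed
qed

text \<open>
  Heights are written \<open>u = 2 * x + r\<close> with \<open>r \<in> {0, 1}\<close>; on \<open>int\<close>, \<open>div\<close> rounds down and \<open>mod 2\<close>
  is nonnegative. Matrix rows and columns are numbered from \<open>0\<close>.
\<close>

definition block_toeplitz :: "(complex \<Rightarrow> complex mat) \<Rightarrow> int \<Rightarrow> int \<Rightarrow> real" where
  "block_toeplitz \<phi> u v =
     laurent_coeff (\<lambda>z. \<phi> z $$ (nat (u mod 2), nat (v mod 2))) (v div 2 - u div 2)"

text \<open>
  Point configurations with \<open>2n\<close> points on each of the levels \<open>1, \<dots>, 4N - 1\<close>. Coinciding heights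
  on one level are not needed, since they make a determinant in the weight vanish.
\<close>

definition aztec_configs :: "nat \<Rightarrow> nat \<Rightarrow> (nat \<times> int) set set" where
  "aztec_configs N n = {C. C \<subseteq> {1..4 * N - 1} \<times> UNIV \<and>
     (\<forall>m\<in>{1..4 * N - 1}. finite {u. (m, u) \<in> C} \<and> card {u. (m, u) \<in> C} = 2 * n)}"

text \<open>
  \<open>aztec_height N C m j\<close> is \<open>u\<^sub>m\<close> with upper index \<open>j + 1\<close>. The points of a level are numbered in
  increasing order; the weight does not depend on this choice, because every level
  \<open>0 < m < 4N\<close> enters two of the determinants.
\<close>

definition aztec_height :: "nat \<Rightarrow> (nat \<times> int) set \<Rightarrow> nat \<Rightarrow> nat \<Rightarrow> int" where
  "aztec_height N C m j =
     (if m = 0 then int j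
      else if m = 4 * N then - 2 * int N + int j
      else sorted_list_of_set {u. (m, u) \<in> C} ! j)"

definition aztec_weight :: "real \<Rightarrow> real \<Rightarrow> nat \<Rightarrow> nat \<Rightarrow> (nat \<times> int) set \<Rightarrow> real" where
  "aztec_weight \<alpha> \<beta> N n C = (\<Prod>m = 1..4 * N. Determinant.det (mat (2 * n) (2 * n)
     (\<lambda>(j, k). block_toeplitz (aztec_symbol \<alpha> \<beta> m)
        (aztec_height N C (m - 1) j) (aztec_height N C m k))))"

text \<open>Only finitely many configurations have nonzero weight.\<close>

definition aztec_measure :: "real \<Rightarrow> real \<Rightarrow> nat \<Rightarrow> nat \<Rightarrow> (nat \<times> int) set measure" where
  "aztec_measure \<alpha> \<beta> N n = point_measure (aztec_configs N n)
     (\<lambda>C. ennreal (aztec_weight \<alpha> \<beta> N n C / (\<Sum>\<^sub>\<infinity>D\<in>aztec_configs N n. aztec_weight \<alpha> \<beta> N n D)))"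


section \<open>The kernel\<close>

definition aztec_Phi :: "real \<Rightarrow> real \<Rightarrow> complex \<Rightarrow> complex mat" where
  "aztec_Phi \<alpha> \<beta> z = (1 / (1 - inverse z)\<^sup>2) \<cdot>\<^sub>m
     (aztec_block (\<alpha>\<^sup>2) (\<beta>\<^sup>2) z ^\<^sub>m 2 * aztec_block 1 1 z ^\<^sub>m 2)"

definition mat_inv :: "'a :: field mat \<Rightarrow> 'a mat" where
  "mat_inv A = the (mat_inverse A)"

definition mat_powi :: "'a :: field mat \<Rightarrow> int \<Rightarrow> 'a mat" where
  "mat_powi A k = (if k \<ge> 0 then A ^\<^sub>m nat k else mat_inv A ^\<^sub>m nat (- k))"

text \<open>
  The branch of the square root of \<open>z (z\<^sup>2 + (\<alpha>\<^sup>2 + \<beta>\<^sup>2) z + 1)\<close> that is analytic off the nonpositive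
  real axis and positive on the positive one. For \<open>\<alpha>\<beta> = 1\<close> the radicand has no zeros off
  \<open>\<real>\<^sub>\<le>\<^sub>0\<close>, so the branch exists and is unique there; it need not be \<open>csqrt\<close> of the radicand.
\<close>

definition aztec_sqrt_branch :: "real \<Rightarrow> real \<Rightarrow> (complex \<Rightarrow> complex) \<Rightarrow> bool" where
  "aztec_sqrt_branch \<alpha> \<beta> S \<longleftrightarrow>
     S analytic_on (- \<real>\<^sub>\<le>\<^sub>0) \<and>
     (\<forall>z. z \<notin> \<real>\<^sub>\<le>\<^sub>0 \<longrightarrow> (S z)\<^sup>2 = z * (z\<^sup>2 + of_real (\<alpha>\<^sup>2 + \<beta>\<^sup>2) * z + 1)) \<and>
     (\<forall>x::real. x > 0 \<longrightarrow> S (of_real x) \<in> \<real> \<and> Re (S (of_real x)) > 0)"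

definition aztec_rho1 :: "real \<Rightarrow> real \<Rightarrow> (complex \<Rightarrow> complex) \<Rightarrow> complex \<Rightarrow> complex" where
  "aztec_rho1 \<alpha> \<beta> S z =
     ((z + 1)\<^sup>2 + 2 * z * of_real (\<alpha>\<^sup>2 + \<beta>\<^sup>2) + 2 * of_real (\<alpha> + \<beta>) * S z) / (z - 1)\<^sup>2"

definition aztec_rho2 :: "real \<Rightarrow> real \<Rightarrow> (complex \<Rightarrow> complex) \<Rightarrow> complex \<Rightarrow> complex" where
  "aztec_rho2 \<alpha> \<beta> S z =
     ((z + 1)\<^sup>2 + 2 * z * of_real (\<alpha>\<^sup>2 + \<beta>\<^sup>2) - 2 * of_real (\<alpha> + \<beta>) * S z) / (z - 1)\<^sup>2"

text \<open>A positively oriented (piecewise \<open>C\<^sup>1\<close>) simple closed contour around all points of \<open>A\<close>.\<close>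

definition pos_contour_around :: "(real \<Rightarrow> complex) \<Rightarrow> complex set \<Rightarrow> bool" where
  "pos_contour_around \<gamma> A \<longleftrightarrow>
     valid_path \<gamma> \<and> simple_path \<gamma> \<and> pathfinish \<gamma> = pathstart \<gamma> \<and>
     (\<forall>z\<in>inside (path_image \<gamma>). winding_number \<gamma> z = 1) \<and>
     A \<subseteq> inside (path_image \<gamma>)"

text \<open>
  \<open>aztec_kernel \<dots> m \<xi> j m' \<xi>' i\<close> is \<open>K(4m, 2\<xi> + j; 4m', 2\<xi>' + i)\<close>: the second argument \<open>i\<close> is the
  row index and the first argument \<open>j\<close> the column index of the matrices in the integrands.
\<close>

definition aztec_kernel ::
  "real \<Rightarrow> real \<Rightarrow> nat \<Rightarrow> (complex \<Rightarrow> complex) \<Rightarrow> (complex \<Rightarrow> complex mat) \<Rightarrow>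
   (real \<Rightarrow> complex) \<Rightarrow> (real \<Rightarrow> complex) \<Rightarrow>
   nat \<Rightarrow> int \<Rightarrow> nat \<Rightarrow> nat \<Rightarrow> int \<Rightarrow> nat \<Rightarrow> complex" where
  "aztec_kernel \<alpha> \<beta> N S E \<gamma>1 \<gamma>01 m \<xi> j m' \<xi>' i =
     - (if m > m' then 1 else 0) / (2 * of_real pi * \<i>) *
         contour_integral \<gamma>01 (\<lambda>z.
           mat_powi (aztec_Phi \<alpha> \<beta> z) (int m - int m') $$ (i, j) * z powi (\<xi>' - \<xi>) / z)
     + 1 / (2 * of_real pi * \<i>)\<^sup>2 *
         contour_integral \<gamma>1 (\<lambda>w. contour_integral \<gamma>01 (\<lambda>z.
           w powi \<xi>' / z powi (\<xi> + 1)
           * (aztec_rho1 \<alpha> \<beta> S w powi (int (N div 2) - int m') / (z - w))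
           * ((1 - inverse z) ^ N / (1 - inverse w) ^ N)
           * (E w * mat_of_rows_list 2 [[1, 0], [0, 0]] * mat_inv (E w)
              * mat_powi (aztec_Phi \<alpha> \<beta> z) (int m - int (N div 2))) $$ (i, j)))"

end

(*
  All minors of the weights are nonnegative, and by the Eynard-Mehta theorem the kernel is
    -[m > m'] T(m', m) + b G^-1 a,
  where G is the 2n x 2n matrix of path weights from the starting to the end points and a, b are those
  from the starting points to (m, .) and from (m', .) to the end points. Only the row
  vectors q = b G^-1 are needed, that is, solutions of q G = b.

  With x = 1/z all symbols are power series in x, the truncated block Toeplitz matrices compose
  exactly, and the four steps of a period compose to Phi = (1 - x)^-2 A^2 B^2, where A and B are
  the two blocks and A^2 B^2 is a polynomial in x of degree 2. As det Phi = 1, both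
  V = (1 - x)^N Phi^(-N/2) and Y = (1 - x)^N Phi^(N/2) = (A^2 B^2)^(N/2) are polynomials of degree
  at most N. Let C = sum_k c_k x^k be the generating function of the moments c_k, around w = 1, of
    w^xi' (1 - 1/w)^-N rho_1(w)^(N/2 - m') F(w),
  where F is the spectral projection for rho_1. The factor rho_1^(-m') F is analytic at 1, so the
  coefficients of C V vanish from index N on; and rho_2^(N - m') (1 - F) is analytic at 1, so from
  index N on C V Phi^N = C Y has the coefficients of z^xi' Phi^(N - m'), up to an index shift.
  Hence the coefficients of C V solve q G = b for every n >= N, and C V Phi^m is the double
  contour integral of the statement.
*)
theory Submission
  imports Defs
begin

section \<open>Determinants and the Cauchy--Binet formula\<close>

text \<open>The start blocks are \<open>0, ..., n - 1\<close>, the end blocks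
  \<open>-N, ..., n - N - 1\<close>. With the start blocks counted down from \<open>n - 1\<close>,
  the entries of \<open>q\<close> are coefficients of a series below index \<open>n\<close>, and
  those of \<open>q G\<close> are coefficients of its product with \<open>Phi^N\<close> at indices
  \<open>N, ..., N + n - 1\<close>. This displacement by exactly \<open>N\<close> blocks is what
  polynomials of degree at most \<open>N\<close> can serve: the first series has to stop before
  \<open>n\<close>, and the second is prescribed only from \<open>N\<close> on. The matrices
  \<open>E\<close> are prescribed pointwise without any regularity. Only the projection formed from
  them occurs, and it equals the quotient \<open>(Phi - rho_2) / (rho_1 - rho_2)\<close>, which
  extends analytically over 1. The contours are known only through their winding numbers, so
  integrals over them are read off at infinity, on large circles where the series in
  \<open>1/z\<close> converge. The measure sends negative weights to 0 and normalises by an infinite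
  sum; hence nonnegativity of the minors and a finite window of heights are needed before
  determinants express probabilities.\<close>

abbreviation fmat :: "nat \<Rightarrow> (nat \<Rightarrow> nat \<Rightarrow> 'a) \<Rightarrow> 'a mat" where
  "fmat k f \<equiv> Matrix.mat k k (\<lambda>(i, j). f i j)"

text \<open>Entries are given by a function, so rewriting under the determinant needs only
  congruence on indices below \<open>k\<close>, with no carrier or dimension conditions.\<close>

definition fdet :: "nat \<Rightarrow> (nat \<Rightarrow> nat \<Rightarrow> 'a) \<Rightarrow> 'a :: comm_ring_1" where
  "fdet k f = Determinant.det (fmat k f)"

lemma fdet_leibniz:
  "fdet k f = (\<Sum>p | p permutes {0..<k}. signof p * (\<Prod>i = 0..<k. f i (p i)))"
proof -
  have "fdet k f = (\<Sum>p | p permutes {0..<k}. signof p * (\<Prod>i = 0..<k. fmat k f $$ (i, p i)))"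
    unfolding fdet_def by (rule det_def') auto
  also have "\<dots> = (\<Sum>p | p permutes {0..<k}. signof p * (\<Prod>i = 0..<k. f i (p i)))"
    by (intro sum.cong refl arg_cong2[where f = times] prod.cong) (auto dest: permutes_in_image)
  finally show ?thesis .
qed

lemma fdet_cong:
  assumes "\<And>i j. i < k \<Longrightarrow> j < k \<Longrightarrow> f i j = g i j"
  shows "fdet k f = fdet k g"
  unfolding fdet_def by (rule arg_cong[of _ _ Determinant.det], rule eq_matI) (auto simp: assms)

lemma fdet_transpose: "fdet k (\<lambda>i j. f j i) = fdet k f"
proof -
  have "Matrix.mat k k (\<lambda>(i, j). f j i) = transpose_mat (fmat k f)"
    by (rule eq_matI) auto
  then show ?thesis
    unfolding fdet_def using det_transpose[of "fmat k f" k] by simp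
qed

lemma fdet_mult:
  "fdet k (\<lambda>i j. \<Sum>l = 0..<k. f i l * g l j) = fdet k f * fdet k g"
proof -
  have "Matrix.mat k k (\<lambda>(i, j). \<Sum>l = 0..<k. f i l * g l j)
      = fmat k f * fmat k g"
    by (rule eq_matI) (auto simp: scalar_prod_def)
  then show ?thesis unfolding fdet_def by (simp add: det_mult[of _ k])
qed

lemma fdet_identical_rows:
  assumes "i < k" "i' < k" "i \<noteq> i'" "\<And>j. j < k \<Longrightarrow> f i j = f i' j"
  shows "fdet k f = 0" unfolding fdet_def
  by (rule det_identical_rows[of _ k i i']) (use assms in \<open>auto intro!: eq_vecI\<close>)

text \<open>Every permutation picks each row factor and each column factor exactly once, so both
  products leave the Leibniz sum.\<close>

lemma fdet_scale:
  "fdet k (\<lambda>i j. a i * f i j * b j) = (\<Prod>i = 0..<k. a i) * fdet k f * (\<Prod>j = 0..<k. b j)"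
proof -
  have "(\<Prod>i = 0..<k. a i * f i (p i) * b (p i))
      = (\<Prod>i = 0..<k. a i) * (\<Prod>i = 0..<k. f i (p i)) * (\<Prod>j = 0..<k. b j)"
    if "p permutes {0..<k}" for p using prod.permute[OF that, of b] by (simp add: prod.distrib o_def)
  then show ?thesis by (simp add: fdet_leibniz sum_distrib_left sum_distrib_right mult_ac)
qed

lemma fdet_permute_rows:
  assumes "p permutes {0..<k}"
  shows "fdet k (\<lambda>i j. f (p i) j) = signof p * fdet k f"
proof -
  have "Matrix.mat k k (\<lambda>(i, j). f (p i) j) = Matrix.mat k k (\<lambda>(i, j). fmat k f $$ (p i, j))"
    by (rule eq_matI) (use assms in \<open>auto dest: permutes_in_image\<close>)
  then show ?thesis
    unfolding fdet_def using det_permute_rows[OF _ assms, of "fmat k f"] by simp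
qed

text \<open>Triangularity without an order on the rows: it is enough that each permutation other
  than the identity meets a zero entry. This covers steps between heights as well as matrices graded
  by levels.\<close>

lemma fdet_diagonal_term:
  assumes "\<And>p. p permutes {0..<k} \<Longrightarrow> p \<noteq> id \<Longrightarrow> \<exists>i<k. f i (p i) = 0"
  shows "fdet k f = (\<Prod>i = 0..<k. f i i)"
proof -
  have "fdet k f = (\<Sum>p\<in>{id}. signof p * (\<Prod>i = 0..<k. f i (p i)))" unfolding fdet_leibniz
  proof (rule sum.mono_neutral_right)
    show "\<forall>p\<in>{p. p permutes {0..<k}} - {id}. signof p * (\<Prod>i = 0..<k. f i (p i)) = 0"
    proof
      fix p assume "p \<in> {p. p permutes {0..<k}} - {id}"
      with assms[of p] obtain i where "i < k" "f i (p i) = 0" by auto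
      then have "(\<Prod>i = 0..<k. f i (p i)) = 0" by (intro prod_zero) auto
      then show "signof p * (\<Prod>i = 0..<k. f i (p i)) = 0" by simp
    qed
  qed (auto simp: finite_permutations permutes_id)
  then show ?thesis by simp
qed

text \<open>Among the moved indices choose one where \<open>g\<close> is maximal. Its image is moved
  as well, by injectivity, and has a larger \<open>g\<close>, which is absurd.\<close>

lemma permutes_monotone_imp_id:
  fixes g :: "nat \<Rightarrow> 'a :: linorder"
  assumes p: "p permutes {0..<k}" and strict: "\<And>i. i < k \<Longrightarrow> p i \<noteq> i \<Longrightarrow> g i < g (p i)"
  shows "p = id"
proof (rule ccontr)
  assume "p \<noteq> id"
  then obtain a where a: "p a \<noteq> a" by (auto simp: fun_eq_iff)
  define S where "S = {i\<in>{0..<k}. p i \<noteq> i}"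
  have "a \<in> S" using a p by (auto simp: S_def permutes_def)
  have S: "finite S" "S \<noteq> {}" using \<open>a \<in> S\<close> by (auto simp: S_def)
  define M where "M = Max (g ` S)"
  have "M \<in> g ` S" unfolding M_def using S by (intro Max_in) auto
  then obtain i where i: "i \<in> S" "g i = M" by auto
  have "p i \<in> S"
    using i p permutes_inj[OF p] permutes_in_image[OF p, of i] by (auto simp: S_def dest: injD)
  then have "g (p i) \<le> M" unfolding M_def using S by auto
  moreover have "g i < g (p i)" using i strict by (auto simp: S_def)
  ultimately show False using i by simp
qed

text \<open>\<open>P\<close> has identity diagonal blocks and off-diagonal blocks \<open>-x\<close>
  and \<open>y\<close>. For the unit lower triangular \<open>L\<close>, both \<open>L * P\<close>
  and \<open>P * L\<close> are block upper triangular, and their determinants are the two sides. The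
  identity serves to pass from determinants indexed by the \<open>k\<close> paths to ones indexed by
  the \<open>l\<close> marked points.\<close>

lemma fdet_sylvester:
  fixes X :: "nat \<Rightarrow> nat \<Rightarrow> 'a :: idom"
  shows "fdet k (\<lambda>i j. (if i = j then 1 else 0) + (\<Sum>a = 0..<l. X i a * Y a j))
       = fdet l (\<lambda>a b. (if a = b then 1 else 0) + (\<Sum>i = 0..<k. Y a i * X i b))"
proof -
  define x where "x = Matrix.mat k l (\<lambda>(i, a). X i a)"
  define y where "y = Matrix.mat l k (\<lambda>(a, i). Y a i)"
  have [simp]: "x \<in> carrier_mat k l" "y \<in> carrier_mat l k"
      "dim_row x = k" "dim_col x = l" "dim_row y = l" "dim_col y = k" by (auto simp: x_def y_def)
  have 1: "Matrix.mat k k (\<lambda>(i, j). (if i = j then 1 else 0) + (\<Sum>a = 0..<l. X i a * Y a j)) = 1\<^sub>m k + x * y"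
    by (rule eq_matI) (auto simp: x_def y_def scalar_prod_def)
  have 2: "Matrix.mat l l (\<lambda>(a, b). (if a = b then 1 else 0) + (\<Sum>i = 0..<k. Y a i * X i b)) = 1\<^sub>m l + y * x"
    by (rule eq_matI) (auto simp: x_def y_def scalar_prod_def)
  have xy: "1\<^sub>m k + x * y \<in> carrier_mat k k" and yx: "1\<^sub>m l + y * x \<in> carrier_mat l l"
    by (auto intro!: add_carrier_mat mult_carrier_mat)
  define P where "P = four_block_mat (1\<^sub>m k) (- x) y (1\<^sub>m l)"
  have P: "P \<in> carrier_mat (k + l) (k + l)" unfolding P_def by (intro four_block_carrier_mat) auto
  define L where "L = four_block_mat (1\<^sub>m k) (0\<^sub>m k l) (- y) (1\<^sub>m l)"
  have L: "L \<in> carrier_mat (k + l) (k + l)" unfolding L_def by (intro four_block_carrier_mat) auto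
  have detL: "Determinant.det L = 1"
    unfolding L_def by (subst det_four_block_mat_upper_right_zero[where n = k and m = l]) auto
  have "L * P = four_block_mat (1\<^sub>m k * 1\<^sub>m k + 0\<^sub>m k l * y) (1\<^sub>m k * (- x) + 0\<^sub>m k l * 1\<^sub>m l)
      (- y * 1\<^sub>m k + 1\<^sub>m l * y) (- y * (- x) + 1\<^sub>m l * 1\<^sub>m l)"
    unfolding L_def P_def by (rule mult_four_block_mat) auto
  also have "\<dots> = four_block_mat (1\<^sub>m k) (- x) (0\<^sub>m l k) (1\<^sub>m l + y * x)"
    by (rule arg_cong4[where f = four_block_mat])
      (auto intro!: eq_matI simp: scalar_prod_def sum_negf add.commute)
  finally have "Determinant.det (L * P) = Determinant.det (1\<^sub>m l + y * x)"
    using det_four_block_mat_lower_left_zero[of _ k "- x" l "0\<^sub>m l k"] xy yx by simp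
  then have p1: "Determinant.det P = Determinant.det (1\<^sub>m l + y * x)"
    using det_mult[OF L P] detL by simp
  have "P * L = four_block_mat (1\<^sub>m k * 1\<^sub>m k + (- x) * (- y)) (1\<^sub>m k * 0\<^sub>m k l + (- x) * 1\<^sub>m l)
      (y * 1\<^sub>m k + 1\<^sub>m l * (- y)) (y * 0\<^sub>m k l + 1\<^sub>m l * 1\<^sub>m l)"
    unfolding L_def P_def by (rule mult_four_block_mat) auto
  also have "\<dots> = four_block_mat (1\<^sub>m k + x * y) (- x) (0\<^sub>m l k) (1\<^sub>m l)"
    by (rule arg_cong4[where f = four_block_mat])
      (auto intro!: eq_matI simp: scalar_prod_def sum_negf add.commute)
  finally have "Determinant.det (P * L) = Determinant.det (1\<^sub>m k + x * y)"
    using det_four_block_mat_lower_left_zero[of _ k "- x" l "0\<^sub>m l k"] xy yx by simp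
  then have p2: "Determinant.det P = Determinant.det (1\<^sub>m k + x * y)"
    using det_mult[OF P L] detL by simp
  show ?thesis unfolding fdet_def 1 2 using p1 p2 by simp
qed

section \<open>Cauchy-Binet over the subsets of a finite index set\<close>

text \<open>An injection with image \<open>Y\<close> is the increasing enumeration of
  \<open>Y\<close> after a permutation. Sorting the rows of \<open>B\<close> produces the sign of
  this permutation, which completes the remaining product to the Leibniz expansion for
  \<open>A\<close>.\<close>

lemma prod_sum_enum_permutes:
  fixes A :: "nat \<Rightarrow> 'b :: linorder \<Rightarrow> 'a :: comm_ring_1"
  assumes Y: "finite Y" "card Y = k"
  shows "(\<Sum>f | f \<in> {0..<k} \<rightarrow>\<^sub>E Y \<and> inj_on f {0..<k} . (\<Prod>i = 0..<k. A i (f i)) * fdet k (\<lambda>i j. B (f i) j))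
    = fdet k (\<lambda>i j. A i (sorted_list_of_set Y ! j)) * fdet k (\<lambda>i j. B (sorted_list_of_set Y ! i) j)"
proof -
  define e where "e = (\<lambda>i. sorted_list_of_set Y ! i)"
  have bij: "bij_betw e {0..<k} Y"
    unfolding e_def using Y bij_betw_nth[of "sorted_list_of_set Y" "{0..<k}" Y]
    by (simp add: atLeast0LessThan)
  have "(\<Sum>f | f \<in> {0..<k} \<rightarrow>\<^sub>E Y \<and> inj_on f {0..<k} . (\<Prod>i = 0..<k. A i (f i)) * fdet k (\<lambda>i j. B (f i) j))
    = (\<Sum>p | p permutes {0..<k}. (\<Prod>i = 0..<k. A i (e (p i))) * fdet k (\<lambda>i j. B (e (p i)) j))"
  proof (rule sum.reindex_bij_witness[where i = "\<lambda>p. restrict (e \<circ> p) {0..<k}"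
      and j = "\<lambda>f x. if x < k then the_inv_into {0..<k} e (f x) else x"])
    fix f assume "f \<in> {f. f \<in> {0..<k} \<rightarrow>\<^sub>E Y \<and> inj_on f {0..<k}}"
    then have f: "f \<in> {0..<k} \<rightarrow>\<^sub>E Y" "inj_on f {0..<k}" by auto
    let ?p = "\<lambda>x. if x < k then the_inv_into {0..<k} e (f x) else x"
    have *: "e (?p x) = f x" if "x < k" for x
      using that f(1) bij by (auto simp: bij_betw_def PiE_def Pi_def intro!: f_the_inv_into_f)
    have **: "?p x < k" if "x < k" for x
      using that f(1) bij the_inv_into_into[of e "{0..<k}" "f x" "{0..<k}"]
      by (auto simp: bij_betw_def PiE_def Pi_def)
    show "restrict (e \<circ> ?p) {0..<k} = f"
      by (rule ext, use * f in \<open>auto simp: restrict_def PiE_def extensional_def\<close>)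
    have inj: "inj_on ?p {0..<k}"
      by (rule inj_onI) (use * f(2) in \<open>metis atLeastLessThan_iff inj_onD\<close>)
    have "?p ` {0..<k} = {0..<k}"
      by (rule endo_inj_surj[OF _ _ inj]) (use ** in \<open>simp_all add: image_subset_iff\<close>)
    with inj have "bij_betw ?p {0..<k} {0..<k}" unfolding bij_betw_def by (rule conjI)
    then show "?p \<in> {p. p permutes {0..<k}}" by (auto intro!: bij_imp_permutes)
    show "(\<Prod>i = 0..<k. A i (e (?p i))) * fdet k (\<lambda>i j. B (e (?p i)) j) =
        (\<Prod>i = 0..<k. A i (f i)) * fdet k (\<lambda>i j. B (f i) j)"
      by (intro arg_cong2[where f = times] prod.cong fdet_cong refl) (use * in \<open>simp_all\<close>)
  next
    fix p assume "p \<in> {p. p permutes {0..<k}}"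
    then have p: "p permutes {0..<k}" by simp
    let ?f = "restrict (e \<circ> p) {0..<k}"
    have "inj_on (e \<circ> p) {0..<k}"
      using bij p by (intro comp_inj_on) (auto simp: bij_betw_def permutes_inj_on permutes_image)
    then have "inj_on ?f {0..<k}" by (simp add: inj_on_def)
    moreover have pk: "p x < k" if "x < k" for x using permutes_in_image[OF p, of x] that by simp
    then have "?f \<in> {0..<k} \<rightarrow>\<^sub>E Y"
      using bij by (intro PiE_I) (auto simp: bij_betw_def)
    ultimately show "?f \<in> {f. f \<in> {0..<k} \<rightarrow>\<^sub>E Y \<and> inj_on f {0..<k}}"
      by blast
    show "(\<lambda>x. if x < k then the_inv_into {0..<k} e (?f x) else x) = p"
    proof
      fix x
      show "(if x < k then the_inv_into {0..<k} e (?f x) else x) = p x"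
      proof (cases "x < k")
        case True
        have "inj_on e {0..<k}" using bij by (simp add: bij_betw_def)
        then show ?thesis using True pk[OF True] by (simp add: the_inv_into_f_f)
      next
        case False
        then show ?thesis using permutes_not_in[OF p, of x] by simp
      qed
    qed
  qed
  also have "\<dots> = (\<Sum>p | p permutes {0..<k}. signof p * (\<Prod>i = 0..<k. A i (e (p i)))) * fdet k (\<lambda>i j. B (e i) j)"
    unfolding sum_distrib_right
  proof (rule sum.cong[OF refl], goal_cases)
    case (1 p)
    then show ?case using fdet_permute_rows[of p k "\<lambda>i. B (e i)"] by (simp add: mult_ac)
  qed
  also have "\<dots> = fdet k (\<lambda>i j. A i (e j)) * fdet k (\<lambda>i j. B (e i) j)"
    by (simp only: fdet_leibniz[of k "\<lambda>i j. A i (e j)"])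
  finally show ?thesis by (simp only: e_def)
qed

text \<open>Expanding the row products gives a sum over functions from rows to \<open>X\<close>. A
  noninjective function yields two equal rows of \<open>B\<close> and drops out; the injective ones
  are grouped by their image.\<close>

lemma cauchy_binet:
  fixes A :: "nat \<Rightarrow> 'b :: linorder \<Rightarrow> 'a :: comm_ring_1"
  assumes X: "finite X"
  shows "fdet k (\<lambda>i j. \<Sum>x\<in>X. A i x * B x j)
    = (\<Sum>Y | Y \<subseteq> X \<and> card Y = k. fdet k (\<lambda>i j. A i (sorted_list_of_set Y ! j))
          * fdet k (\<lambda>i j. B (sorted_list_of_set Y ! i) j))"
proof -
  define P where "P = {0..<k} \<rightarrow>\<^sub>E X"
  have finP: "finite P" unfolding P_def using X by (intro finite_PiE) auto
  let ?t = "\<lambda>f. (\<Prod>i = 0..<k. A i (f i)) * fdet k (\<lambda>i j. B (f i) j)"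
  have "fdet k (\<lambda>i j. \<Sum>x\<in>X. A i x * B x j)
    = (\<Sum>p | p permutes {0..<k}. signof p * (\<Sum>f\<in>P. \<Prod>i = 0..<k. A i (f i) * B (f i) (p i)))"
    unfolding fdet_leibniz P_def by (simp add: prod_sum_PiE X)
  also have "\<dots> = (\<Sum>f\<in>P. ?t f)" unfolding fdet_leibniz sum_distrib_left
    by (subst sum.swap) (simp add: prod.distrib mult_ac)
  also have "\<dots> = (\<Sum>f | f \<in> P \<and> inj_on f {0..<k}. ?t f)"
  proof (rule sum.mono_neutral_right[OF finP]; (intro ballI)?)
    fix f assume "f \<in> P - {f. f \<in> P \<and> inj_on f {0..<k}}"
    then obtain i i' where "i < k" "i' < k" "i \<noteq> i'" "f i = f i'" by (auto simp: inj_on_def)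
    then have "fdet k (\<lambda>i j. B (f i) j) = 0" by (intro fdet_identical_rows[of i k i']) auto
    then show "?t f = 0" by simp
  qed auto
  also have "\<dots> = (\<Sum>Y | Y \<subseteq> X \<and> card Y = k. \<Sum>f | f \<in> {f \<in> P. inj_on f {0..<k}} \<and> f ` {0..<k} = Y. ?t f)"
    by (rule sum.group[symmetric])
      (use finP X in \<open>auto simp: P_def card_image intro: finite_subset[of _ "Pow X"]\<close>)
  also have "\<dots> = (\<Sum>Y | Y \<subseteq> X \<and> card Y = k. fdet k (\<lambda>i j. A i (sorted_list_of_set Y ! j))
          * fdet k (\<lambda>i j. B (sorted_list_of_set Y ! i) j))"
  proof (rule sum.cong[OF refl], safe)
    fix Y assume Y: "Y \<subseteq> X" "k = card Y"
    then have finY: "finite Y" using X finite_subset by blast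
    have "{f. f \<in> {f \<in> P. inj_on f {0..<card Y}} \<and> f ` {0..<card Y} = Y}
       = {f. f \<in> {0..<card Y} \<rightarrow>\<^sub>E Y \<and> inj_on f {0..<card Y}}" (is "?l = ?r")
    proof
      show "?l \<subseteq> ?r" using Y by (auto simp: P_def PiE_def)
      show "?r \<subseteq> ?l"
      proof
        fix f assume f: "f \<in> ?r"
        then have "f ` {0..<card Y} \<subseteq> Y" "card (f ` {0..<card Y}) = card Y"
          by (auto simp: card_image)
        then have "f ` {0..<card Y} = Y" using finY by (simp add: card_subset_eq)
        then show "f \<in> ?l" using f Y by (auto simp: P_def PiE_def Pi_def)
      qed
    qed
    then show "(\<Sum>f | f \<in> {f \<in> P. inj_on f {0..<card Y}} \<and> f ` {0..<card Y} = Y.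
        (\<Prod>i = 0..<card Y. A i (f i)) * fdet (card Y) (\<lambda>i j. B (f i) j)) =
        fdet (card Y) (\<lambda>i j. A i (sorted_list_of_set Y ! j)) * fdet (card Y) (\<lambda>i j. B (sorted_list_of_set Y ! i) j)"
      using prod_sum_enum_permutes[OF finY refl, of A B] by simp
  qed
  finally show ?thesis .
qed


section \<open>The Eynard--Mehta theorem\<close>

lemma sum_PiE_insert:
  assumes "x \<notin> S"
  shows "(\<Sum>Y\<in>PiE (insert x S) F. g Y) = (\<Sum>y\<in>F x. \<Sum>Y\<in>PiE S F. g (Y(x := y)))"
proof -
  have "(\<Sum>Y\<in>PiE (insert x S) F. g Y) = (\<Sum>(y, Y)\<in>F x \<times> PiE S F. g (Y(x := y)))"
    unfolding PiE_insert_eq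
    by (subst sum.reindex[OF inj_combinator[OF assms]]) (simp add: case_prod_unfold)
  then show ?thesis by (simp add: sum.cartesian_product)
qed

abbreviation enum :: "'b :: linorder set \<Rightarrow> nat \<Rightarrow> 'b" where
  "enum Y j \<equiv> sorted_list_of_set Y ! j"

text \<open>\<open>T m\<close> is the step from level \<open>m - 1\<close> to level
  \<open>m\<close>; a path of \<open>Suc d\<close> steps from level \<open>a\<close> therefore ends
  with \<open>T (a + Suc d)\<close>.\<close>

fun path_sum :: "'b set \<Rightarrow> (nat \<Rightarrow> 'b \<Rightarrow> 'b \<Rightarrow> 'a) \<Rightarrow> nat \<Rightarrow> nat \<Rightarrow> 'b \<Rightarrow> 'b \<Rightarrow> 'a :: comm_ring_1" where
  "path_sum X T a 0 u v = of_bool (u = v)"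
| "path_sum X T a (Suc d) u v = (\<Sum>w\<in>X. path_sum X T a d u w * T (a + Suc d) w v)"

definition level_height :: "(nat \<Rightarrow> 'b) \<Rightarrow> (nat \<Rightarrow> 'b) \<Rightarrow> nat \<Rightarrow> (nat \<Rightarrow> 'b :: linorder set) \<Rightarrow> nat \<Rightarrow> nat \<Rightarrow> 'b" where
  "level_height a b M Y m j = (if m = 0 then a j else if m = M then b j else enum (Y m) j)"

definition family_weight ::
  "nat \<Rightarrow> (nat \<Rightarrow> 'b \<Rightarrow> 'b \<Rightarrow> 'a) \<Rightarrow> (nat \<Rightarrow> 'b) \<Rightarrow> (nat \<Rightarrow> 'b) \<Rightarrow> nat \<Rightarrow> (nat \<Rightarrow> 'b :: linorder set) \<Rightarrow> 'a :: comm_ring_1" where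
  "family_weight k T a b M Y =
     (\<Prod>m = 1..M. fdet k (\<lambda>j i. T m (level_height a b M Y (m - 1) j) (level_height a b M Y m i)))"

abbreviation families :: "'b set \<Rightarrow> nat \<Rightarrow> nat \<Rightarrow> (nat \<Rightarrow> 'b set) set" where
  "families X k M \<equiv> PiE {1..<M} (\<lambda>_. {Y. Y \<subseteq> X \<and> card Y = k})"

lemma sum_of_bool_mult:
  "finite X \<Longrightarrow> (\<Sum>w\<in>X. of_bool (u = w) * f w) = (if u \<in> X then f u else (0 :: 'a :: comm_ring_1))"
  by (simp add: of_bool_def if_distrib[of "\<lambda>x. x * _"] cong: if_cong)

text \<open>The Lindstroem-Gessel-Viennot determinant, by induction on the number of levels: summing
  over the points of the last inner level is one application of Cauchy-Binet. The end points
  \<open>b\<close> have to be general, since those last inner points are the end points of the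
  shorter family.\<close>

lemma sum_family_weight:
  assumes X: "finite X" and a: "\<And>j. j < k \<Longrightarrow> a j \<in> X"
  shows "(\<Sum>Y\<in>families X k (Suc M). family_weight k T a b (Suc M) Y)
       = fdet k (\<lambda>j i. path_sum X T 0 (Suc M) (a j) (b i))"
proof (induction M arbitrary: b)
  case 0
  have "(\<Sum>w\<in>X. of_bool (a j = w) * T (Suc 0) w (b i)) = T (Suc 0) (a j) (b i)" if "j < k" for i j
    using a[OF that] X by (simp add: sum_of_bool_mult)
  then show ?case by (auto simp: family_weight_def level_height_def intro!: fdet_cong)
next
  case (Suc M)
  let ?h = "level_height a b (Suc (Suc M))"
  have eq: "{1..<Suc (Suc M)} = insert (Suc M) {1..<Suc M}" by auto
  have *: "family_weight k T a b (Suc (Suc M)) (Y(Suc M := y)) =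
      family_weight k T a (enum y) (Suc M) Y * fdet k (\<lambda>i j. T (Suc (Suc M)) (enum y i) (b j))" for Y y
  proof -
    have "family_weight k T a b (Suc (Suc M)) (Y(Suc M := y))
       = (\<Prod>m = 1..Suc M. fdet k (\<lambda>j i. T m (?h (Y(Suc M := y)) (m - 1) j) (?h (Y(Suc M := y)) m i)))
         * fdet k (\<lambda>i j. T (Suc (Suc M)) (enum y i) (b j))"
      by (simp add: family_weight_def level_height_def prod.nat_ivl_Suc')
    moreover have "(\<Prod>m = 1..Suc M. fdet k (\<lambda>j i. T m (?h (Y(Suc M := y)) (m - 1) j) (?h (Y(Suc M := y)) m i)))
      = family_weight k T a (enum y) (Suc M) Y" unfolding family_weight_def
      by (intro prod.cong refl fdet_cong) (auto simp: level_height_def)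
    ultimately show ?thesis by simp
  qed
  have "(\<Sum>Y\<in>families X k (Suc (Suc M)). family_weight k T a b (Suc (Suc M)) Y)
    = (\<Sum>y | y \<subseteq> X \<and> card y = k. \<Sum>Y\<in>families X k (Suc M). family_weight k T a b (Suc (Suc M)) (Y(Suc M := y)))"
    unfolding eq by (rule sum_PiE_insert) auto
  also have "\<dots> = (\<Sum>y | y \<subseteq> X \<and> card y = k. fdet k (\<lambda>j i. path_sum X T 0 (Suc M) (a j) (enum y i))
       * fdet k (\<lambda>i j. T (Suc (Suc M)) (enum y i) (b j)))"
    unfolding * sum_distrib_right[symmetric] Suc.IH ..
  also have "\<dots> = fdet k (\<lambda>j i. \<Sum>w\<in>X. path_sum X T 0 (Suc M) (a j) w * T (Suc (Suc M)) w (b i))"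
    by (rule cauchy_binet[symmetric, OF X])
  finally show ?case by simp
qed

section \<open>Deformation of the weights at marked points\<close>

text \<open>By injectivity at most one factor differs from 1, so the product has no terms of higher
  order in \<open>t\<close>.\<close>

lemma prod_of_single_factors:
  fixes t :: "'a :: comm_ring_1"
  assumes "finite I" "inj_on p I"
  shows "(\<Prod>k\<in>I. if p k = x then 1 + t else 1) = 1 + t * (\<Sum>k\<in>I. of_bool (p k = x))"
proof (cases "\<exists>k\<in>I. p k = x")
  case True
  then obtain k where k: "k \<in> I" "p k = x" by auto
  then have "p k' = x \<longleftrightarrow> k' = k" if "k' \<in> I" for k'
    using assms(2) that by (auto dest: inj_onD)
  then have "(\<Prod>k\<in>I. if p k = x then 1 + t else 1) = (\<Prod>k'\<in>I. if k' = k then 1 + t else 1)"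
      "(\<Sum>k\<in>I. of_bool (p k = x)) = (\<Sum>k'\<in>I. if k' = k then 1 else (0::'a))"
    by (auto intro!: prod.cong sum.cong)
  then show ?thesis using k assms(1) by simp
qed auto

text \<open>\<open>S\<close> omits the scaling factor of the vertex where the path ends; that factor
  is paid on leaving the vertex. The start carries the factor 1 by \<open>D 0 v = 1\<close>.\<close>

lemma path_sum_column_scaling:
  assumes D0: "\<And>v. D 0 v = 1"
    and S0: "\<And>u v. S 0 u v = of_bool (u = v)"
    and S: "\<And>m u v. S (Suc m) u v = (\<Sum>w\<in>X. S m u w * D m w * T (Suc m) w v)"
  shows "path_sum X (\<lambda>m u v. T m u v * D m v) 0 m u v = S m u v * D m v"
  by (induction m arbitrary: v) (simp_all add: S0 S D0 sum_distrib_right mult.assoc)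

context
  fixes T :: "nat \<Rightarrow> 'b :: linorder \<Rightarrow> 'b \<Rightarrow> 'a :: real_normed_field"
    and X :: "'b set" and k l M :: nat and a b u :: "nat \<Rightarrow> 'b" and m :: "nat \<Rightarrow> nat"
    and Q K :: "nat \<Rightarrow> nat \<Rightarrow> 'a"
  assumes X: "finite X" and a: "\<And>j. j < k \<Longrightarrow> a j \<in> X" and M: "0 < M"
    and lev: "\<And>i. i < l \<Longrightarrow> 0 < m i \<and> m i < M" and u: "\<And>i. i < l \<Longrightarrow> u i \<in> X"
    and inj: "inj_on (\<lambda>i. (m i, u i)) {..<l}"
    and Q: "\<And>i j. i < l \<Longrightarrow> j < k \<Longrightarrow>
       (\<Sum>h = 0..<k. Q i h * path_sum X T 0 M (a h) (b j)) = path_sum X T (m i) (M - m i) (u i) (b j)"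
    and K: "\<And>i i'. K i i' = - (if m i < m i' then path_sum X T (m i) (m i' - m i) (u i) (u i') else 0)
       + (\<Sum>h = 0..<k. Q i h * path_sum X T 0 (m i') (a h) (u i'))"
begin

text \<open>The factors \<open>1 + t\<close> at the marked points are absorbed in the transitions.
  If \<open>G\<close> collects the path weights from the starting to the end points, the deformed
  ones are \<open>(1 + t R Q) G\<close> by the equation for \<open>Q\<close>; so \<open>G\<close>
  splits off as a factor, and the rest moves to an \<open>l\<close> by \<open>l\<close>
  determinant.\<close>

lemma eynard_mehta_perturbed:
  "(\<Sum>Y\<in>families X k M. family_weight k T a b M Y * (\<Prod>i = 0..<l. if u i \<in> Y (m i) then 1 + t else 1))
    = fdet k (\<lambda>j i. path_sum X T 0 M (a j) (b i)) * fdet l (\<lambda>i i'. (if i = i' then 1 else 0) + t * K i i')"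
proof -
  from M obtain M' where M: "M = Suc M'" by (cases M) auto
  \<comment> \<open>Marked levels lie strictly between 0 and \<open>M\<close>, so neither the
    starting nor the end points are scaled.\<close>
  define D where "D mm v = (\<Prod>i = 0..<l. if (m i, u i) = (mm, v) then 1 + t else 1)" for mm v
  have D: "D mm v = 1 + t * (\<Sum>i = 0..<l. of_bool ((m i, u i) = (mm, v)))" for mm v
    unfolding D_def by (rule prod_of_single_factors) (use inj in \<open>auto simp: atLeast0LessThan\<close>)
  have D0: "D 0 v = 1" and DM: "D M v = 1" for v
    unfolding D_def using lev by (force intro!: prod.neutral)+
  define S where "S = rec_nat (\<lambda>u v. of_bool (u = v)) (\<lambda>m f u v. \<Sum>w\<in>X. f u w * D m w * T (Suc m) w v)"
  have S0: "S 0 u v = of_bool (u = v)"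
    and SS: "S (Suc m) u v = (\<Sum>w\<in>X. S m u w * D m w * T (Suc m) w v)" for m u v
    by (simp_all add: S_def)
  let ?P = "path_sum X T"
  \<comment> \<open>Decomposition at the last marked point where the term \<open>t\<close> of the
    factor \<open>1 + t\<close> is chosen: before it the path carries deformed weights, after it
    plain ones.\<close>
  have S: "S mm x v = ?P 0 mm x v + t * (\<Sum>i = 0..<l. if m i < mm then S (m i) x (u i) * ?P (m i) (mm - m i) (u i) v else 0)" for mm x v
  proof (induction mm arbitrary: v)
    case 0
    then show ?case by (simp add: S0)
  next
    case (Suc mm)
    have "S (Suc mm) x v = (\<Sum>w\<in>X. S mm x w * T (Suc mm) w v)
      + t * (\<Sum>w\<in>X. \<Sum>i = 0..<l. of_bool ((m i, u i) = (mm, w)) * (S mm x w * T (Suc mm) w v))"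
    proof -
      have "S mm x w * D mm w * T (Suc mm) w v = S mm x w * T (Suc mm) w v
        + t * (\<Sum>i = 0..<l. of_bool ((m i, u i) = (mm, w)) * (S mm x w * T (Suc mm) w v))" for w
        unfolding D sum_distrib_right[symmetric]
        by (simp only: distrib_left distrib_right mult_1_right mult_1_left mult_ac)
      then show ?thesis by (simp only: SS sum.distrib sum_distrib_left)
    qed
    also have "(\<Sum>w\<in>X. \<Sum>i = 0..<l. of_bool ((m i, u i) = (mm, w)) * (S mm x w * T (Suc mm) w v))
      = (\<Sum>i = 0..<l. if m i = mm then S mm x (u i) * T (Suc mm) (u i) v else 0)"
    proof (subst sum.swap, rule sum.cong[OF refl])
      fix i assume i: "i \<in> {0..<l}"
      have "(\<Sum>w\<in>X. of_bool ((m i, u i) = (mm, w)) * (S mm x w * T (Suc mm) w v))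
        = (\<Sum>w\<in>X. if w = u i then (if m i = mm then S mm x (u i) * T (Suc mm) (u i) v else 0) else 0)"
        by (rule sum.cong) auto
      then show "(\<Sum>w\<in>X. of_bool ((m i, u i) = (mm, w)) * (S mm x w * T (Suc mm) w v)) =
         (if m i = mm then S mm x (u i) * T (Suc mm) (u i) v else 0)" using u[of i] i X by simp
    qed
    also have "(\<Sum>w\<in>X. S mm x w * T (Suc mm) w v) = ?P 0 (Suc mm) x v
      + t * (\<Sum>i = 0..<l. if m i < mm then S (m i) x (u i) * ?P (m i) (Suc mm - m i) (u i) v else 0)"
    proof -
      have "(\<Sum>w\<in>X. S mm x w * T (Suc mm) w v) = ?P 0 (Suc mm) x v
        + t * (\<Sum>i = 0..<l. \<Sum>w\<in>X. (if m i < mm then S (m i) x (u i) * ?P (m i) (mm - m i) (u i) w else 0) * T (Suc mm) w v)"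
        apply (subst Suc.IH)
        apply (simp add: algebra_simps sum.distrib sum_distrib_left sum_distrib_right del: mult_if_delta)
        apply (rule sum.swap)
        done
      also have "(\<Sum>i = 0..<l. \<Sum>w\<in>X. (if m i < mm then S (m i) x (u i) * ?P (m i) (mm - m i) (u i) w else 0) * T (Suc mm) w v)
        = (\<Sum>i = 0..<l. if m i < mm then S (m i) x (u i) * ?P (m i) (Suc mm - m i) (u i) v else 0)"
        by (rule sum.cong) (auto simp: Suc_diff_le sum_distrib_left mult_ac)
      finally show ?thesis .
    qed
    also have "?P 0 (Suc mm) x v
      + t * (\<Sum>i = 0..<l. if m i < mm then S (m i) x (u i) * ?P (m i) (Suc mm - m i) (u i) v else 0)
      + t * (\<Sum>i = 0..<l. if m i = mm then S mm x (u i) * T (Suc mm) (u i) v else 0)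
      = ?P 0 (Suc mm) x v + t * (\<Sum>i = 0..<l. if m i < Suc mm then S (m i) x (u i) * ?P (m i) (Suc mm - m i) (u i) v else 0)"
    proof -
      have one: "?P mm (Suc 0) (u i) v = T (Suc mm) (u i) v" if "i < l" for i
        using u[OF that] X by (simp add: sum_of_bool_mult)
      show ?thesis unfolding add.assoc distrib_left[symmetric] sum.distrib[symmetric]
        by (intro arg_cong2[where f = plus] arg_cong2[where f = times] sum.cong refl) (use one in auto)
    qed
    finally show ?case .
  qed
  define R where "R j i = S (m i) (a j) (u i)" for j i
  define N where "N i i' = (if m i < m i' then ?P (m i) (m i' - m i) (u i) (u i') else 0)" for i i'
  define A where "A j i = ?P 0 (m i) (a j) (u i)" for j i
  define G where "G j i = ?P 0 M (a j) (b i)" for j i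
  have R: "R j i' = A j i' + t * (\<Sum>i = 0..<l. R j i * N i i')" for j i'
    unfolding R_def A_def N_def using S[of "m i'" "a j" "u i'"]
    by (simp add: if_distrib[of "times _"] cong: if_cong)
  have K': "K i i' = - N i i' + (\<Sum>h = 0..<k. Q i h * A h i')" for i i'
    unfolding K N_def A_def by simp

  have D_prod: "(\<Prod>i = 0..<l. if u i \<in> Y (m i) then 1 + t else 1) = (\<Prod>mm = 1..<M. \<Prod>j = 0..<k. D mm (enum (Y mm) j))"
    if Y: "Y \<in> families X k M" for Y
  proof -
    have fin: "finite (Y mm)" "card (Y mm) = k" if "mm \<in> {1..<M}" for mm
      using Y that X by (auto simp: PiE_def Pi_def intro: finite_subset)
    have "(\<Prod>mm = 1..<M. \<Prod>j = 0..<k. D mm (enum (Y mm) j)) = (\<Prod>mm = 1..<M. \<Prod>v\<in>Y mm. D mm v)"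
    proof (rule prod.cong[OF refl])
      fix mm assume mm: "mm \<in> {1..<M}"
      have "bij_betw (enum (Y mm)) {0..<k} (Y mm)"
        using fin[OF mm] bij_betw_nth[of "sorted_list_of_set (Y mm)" "{0..<k}" "Y mm"]
        by (simp add: atLeast0LessThan)
      then show "(\<Prod>j = 0..<k. D mm (enum (Y mm) j)) = (\<Prod>v\<in>Y mm. D mm v)"
        by (rule prod.reindex_bij_betw)
    qed
    also have "\<dots> = (\<Prod>i = 0..<l. \<Prod>mm = 1..<M. \<Prod>v\<in>Y mm. if (m i, u i) = (mm, v) then 1 + t else 1)"
      unfolding D_def by (subst prod.swap, subst (2) prod.swap) simp
    also have "\<dots> = (\<Prod>i = 0..<l. if u i \<in> Y (m i) then 1 + t else 1)"
    proof (rule prod.cong[OF refl])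
      fix i assume i: "i \<in> {0..<l}"
      have "(\<Prod>v\<in>Y mm. if (m i, u i) = (mm, v) then 1 + t else 1) = (if mm = m i then if u i \<in> Y (m i) then 1 + t else 1 else 1)"
        if "mm \<in> {1..<M}" for mm using fin[OF that] by (auto simp: prod.neutral)
      then have "(\<Prod>mm = 1..<M. \<Prod>v\<in>Y mm. if (m i, u i) = (mm, v) then 1 + t else 1)
        = (\<Prod>mm = 1..<M. if mm = m i then if u i \<in> Y (m i) then 1 + t else 1 else 1)"
        by (intro prod.cong refl) auto
      then show "(\<Prod>mm = 1..<M. \<Prod>v\<in>Y mm. if (m i, u i) = (mm, v) then 1 + t else 1)
        = (if u i \<in> Y (m i) then 1 + t else 1)" using lev[of i] i by simp
    qed
    finally show ?thesis by simp
  qed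
  have "(\<Sum>Y\<in>families X k M. family_weight k T a b M Y * (\<Prod>i = 0..<l. if u i \<in> Y (m i) then 1 + t else 1))
    = (\<Sum>Y\<in>families X k M. family_weight k (\<lambda>m u v. T m u v * D m v) a b M Y)"
  proof (rule sum.cong[OF refl])
    fix Y assume Y: "Y \<in> families X k M"
    have "family_weight k (\<lambda>m u v. T m u v * D m v) a b M Y
      = (\<Prod>mm = 1..M. fdet k (\<lambda>j i. T mm (level_height a b M Y (mm - 1) j) (level_height a b M Y mm i))
          * (\<Prod>j = 0..<k. D mm (level_height a b M Y mm j)))" unfolding family_weight_def
      by (rule prod.cong[OF refl], subst fdet_scale[where a = "\<lambda>_. 1", simplified]) simp
    also have "\<dots> = family_weight k T a b M Y * (\<Prod>mm = 1..M. \<Prod>j = 0..<k. D mm (level_height a b M Y mm j))"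
      by (simp add: prod.distrib family_weight_def)
    also have "(\<Prod>mm = 1..M. \<Prod>j = 0..<k. D mm (level_height a b M Y mm j))
      = (\<Prod>mm = 1..<M. \<Prod>j = 0..<k. D mm (level_height a b M Y mm j))"
      using M DM by (simp add: prod.nat_ivl_Suc' atLeastLessThanSuc_atLeastAtMost level_height_def)
    also have "\<dots> = (\<Prod>mm = 1..<M. \<Prod>j = 0..<k. D mm (enum (Y mm) j))"
      by (intro prod.cong refl) (auto simp: level_height_def)
    finally show "family_weight k T a b M Y * (\<Prod>i = 0..<l. if u i \<in> Y (m i) then 1 + t else 1)
        = family_weight k (\<lambda>m u v. T m u v * D m v) a b M Y" using D_prod[OF Y] by simp
  qed
  also have "\<dots> = fdet k (\<lambda>j i. path_sum X (\<lambda>m u v. T m u v * D m v) 0 M (a j) (b i))"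
    unfolding M by (rule sum_family_weight[OF X a])
  also have "\<dots> = fdet k (\<lambda>j i. S M (a j) (b i))"
    by (simp add: path_sum_column_scaling[of D S, OF D0 S0 SS] DM)
  \<comment> \<open>The equation for \<open>Q\<close> turns each weight from a marked point to an
    end point into a combination of rows of \<open>G\<close>.\<close>
  also have "\<dots> = fdet k (\<lambda>j i. \<Sum>h = 0..<k. ((if j = h then 1 else 0) + (\<Sum>c = 0..<l. t * R j c * Q c h)) * G h i)"
  proof (rule fdet_cong)
    fix j i assume ij: "j < k" "i < k"
    have "S M (a j) (b i) = G j i + t * (\<Sum>c = 0..<l. R j c * ?P (m c) (M - m c) (u c) (b i))"
      unfolding S[of M "a j" "b i"] G_def R_def
      by (intro arg_cong2[where f = plus] arg_cong2[where f = times] sum.cong refl) (use lev in auto)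
    also have "(\<Sum>c = 0..<l. R j c * ?P (m c) (M - m c) (u c) (b i))
       = (\<Sum>c = 0..<l. \<Sum>h = 0..<k. R j c * Q c h * G h i)" unfolding G_def
      by (rule sum.cong[OF refl]) (use Q ij in \<open>simp add: mult.assoc flip: sum_distrib_left\<close>)
    also have "G j i + t * (\<Sum>c = 0..<l. \<Sum>h = 0..<k. R j c * Q c h * G h i)
       = (\<Sum>h = 0..<k. (if j = h then 1 else 0) * G h i) + (\<Sum>h = 0..<k. (\<Sum>c = 0..<l. t * R j c * Q c h) * G h i)"
    proof -
      have "(\<Sum>h = 0..<k. (if j = h then 1 else 0) * G h i) = (\<Sum>h = 0..<k. if h = j then G h i else 0)"
        by (rule sum.cong) auto
      then have "(\<Sum>h = 0..<k. (if j = h then 1 else 0) * G h i) = G j i" using ij by simp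
      then show ?thesis by (subst sum.swap) (simp only: sum_distrib_left sum_distrib_right mult.assoc)
    qed
    finally show "S M (a j) (b i) = (\<Sum>h = 0..<k. ((if j = h then 1 else 0) + (\<Sum>c = 0..<l. t * R j c * Q c h)) * G h i)"
      by (simp only: distrib_right sum.distrib)
  qed
  also have "\<dots> = fdet k (\<lambda>j h. (if j = h then 1 else 0) + (\<Sum>c = 0..<l. t * R j c * Q c h)) * fdet k G"
    by (rule fdet_mult)
  also have "fdet k (\<lambda>j h. (if j = h then 1 else 0) + (\<Sum>c = 0..<l. t * R j c * Q c h))
     = fdet l (\<lambda>c c'. (if c = c' then 1 else 0) + (\<Sum>j = 0..<k. Q c j * (t * R j c')))"
    by (rule fdet_sylvester)
  \<comment> \<open>The matrix \<open>1 - t N\<close> has determinant 1, because a nonzero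
    \<open>N i i'\<close> raises the level. As \<open>R = A + t R N\<close>, multiplying by it
    replaces the deformed weights \<open>R\<close> by the plain ones \<open>A\<close> and supplies
    the term \<open>- N\<close> of \<open>K\<close>.\<close>
  also have "\<dots> = \<dots> * fdet l (\<lambda>i i'. (if i = i' then 1 else 0) - t * N i i')"
  proof -
    have "fdet l (\<lambda>i i'. (if i = i' then 1 else 0) - t * N i i') = (\<Prod>i = 0..<l. (if i = i then 1 else 0) - t * N i i)"
    proof (rule fdet_diagonal_term, rule ccontr)
      fix p assume p: "p permutes {0..<l}" "p \<noteq> id"
        and "\<not> (\<exists>i<l. (if i = p i then 1 else 0) - t * N i (p i) = 0)"
      then have *: "p i = i \<or> m i < m (p i)" if "i < l" for i
        using that by (auto simp: N_def split: if_splits)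
      have "p = id" by (rule permutes_monotone_imp_id[of _ l m]) (use p * in \<open>force+\<close>)
      then show False using p by simp
    qed
    also have "\<dots> = 1" by (simp add: N_def)
    finally show ?thesis by simp
  qed
  also have "\<dots> = fdet l (\<lambda>i i'. \<Sum>c = 0..<l. ((if i = c then 1 else 0) + (\<Sum>j = 0..<k. Q i j * (t * R j c)))
        * ((if c = i' then 1 else 0) - t * N c i'))" by (rule fdet_mult[symmetric])
  also have "\<dots> = fdet l (\<lambda>i i'. (if i = i' then 1 else 0) + t * K i i')"
  proof (rule fdet_cong)
    fix i i' assume i: "i < l" "i' < l"
    let ?W = "\<lambda>c. \<Sum>j = 0..<k. Q i j * (t * R j c)"
    have "(\<Sum>c = 0..<l. ((if i = c then 1 else 0) + ?W c) * ((if c = i' then 1 else 0) - t * N c i'))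
      = (\<Sum>c = 0..<l. (if i = c then (if c = i' then 1 else 0) - t * N c i' else 0)
          + (if c = i' then ?W c else 0) - ?W c * (t * N c i'))"
      by (rule sum.cong) (auto simp: algebra_simps)
    also have "\<dots> = (if i = i' then 1 else 0) - t * N i i' + ?W i' - (\<Sum>c = 0..<l. ?W c * (t * N c i'))"
      using i by (simp add: sum.distrib sum_subtractf)
    also have "?W i' = (\<Sum>c = 0..<l. ?W c * (t * N c i')) + t * (\<Sum>j = 0..<k. Q i j * A j i')"
      apply (subst R)
      apply (simp add: algebra_simps sum.distrib sum_distrib_left sum_distrib_right)
      apply (rule sum.swap)
      done
    finally show "(\<Sum>c = 0..<l. ((if i = c then 1 else 0) + ?W c) * ((if c = i' then 1 else 0) - t * N c i'))
      = (if i = i' then 1 else 0) + t * K i i'" by (simp add: K' algebra_simps)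
  qed
  finally show ?thesis by (simp add: G_def mult.commute)
qed

text \<open>Rescaling the deformed identity by \<open>s ^ l\<close> makes both sides polynomial in
  \<open>s\<close>. They agree off 0, and continuity, which is what \<open>real_normed_field\<close>
  is for, gives the value at 0, where only the families through all marked points survive.\<close>

theorem eynard_mehta:
  "(\<Sum>Y\<in>families X k M. family_weight k T a b M Y * of_bool (\<forall>i<l. u i \<in> Y (m i)))
    = fdet k (\<lambda>j i. path_sum X T 0 M (a j) (b i)) * fdet l K"
proof -
  let ?G = "fdet k (\<lambda>j i. path_sum X T 0 M (a j) (b i))"
  define f where "f s = (\<Sum>Y\<in>families X k M. family_weight k T a b M Y * (\<Prod>i = 0..<l. if u i \<in> Y (m i) then s + 1 else s))" for s
  define g where "g s = ?G * fdet l (\<lambda>i i'. (if i = i' then s else 0) + K i i')" for s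
  have fg: "f s = g s" if s: "s \<noteq> 0" for s
  proof -
    have "f s = s ^ l * (\<Sum>Y\<in>families X k M. family_weight k T a b M Y * (\<Prod>i = 0..<l. if u i \<in> Y (m i) then 1 + 1 / s else 1))"
      unfolding f_def sum_distrib_left
    proof (rule sum.cong[OF refl])
      fix Y
      have "(\<Prod>i = 0..<l. if u i \<in> Y (m i) then s + 1 else s) = (\<Prod>i = 0..<l. s * (if u i \<in> Y (m i) then 1 + 1 / s else 1))"
        using s by (intro prod.cong) (auto simp: field_simps)
      then show "family_weight k T a b M Y * (\<Prod>i = 0..<l. if u i \<in> Y (m i) then s + 1 else s) =
         s ^ l * (family_weight k T a b M Y * (\<Prod>i = 0..<l. if u i \<in> Y (m i) then 1 + 1 / s else 1))"
        by (simp add: prod.distrib)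
    qed
    also have "\<dots> = ?G * (s ^ l * fdet l (\<lambda>i i'. (if i = i' then 1 else 0) + 1 / s * K i i'))"
      by (subst eynard_mehta_perturbed) simp_all
    also have "s ^ l * fdet l (\<lambda>i i'. (if i = i' then 1 else 0) + 1 / s * K i i')
       = fdet l (\<lambda>i i'. s * ((if i = i' then 1 else 0) + 1 / s * K i i') * 1)"
      by (subst fdet_scale) simp
    also have "\<dots> = fdet l (\<lambda>i i'. (if i = i' then s else 0) + K i i')"
      using s by (intro fdet_cong) (simp add: field_simps)
    finally show ?thesis by (simp add: g_def)
  qed
  \<comment> \<open>With \<open>t = 1 / s\<close> the top coefficient in \<open>t\<close> becomes the value at \<open>s = 0\<close>.\<close>
  have f_alt: "f = (\<lambda>s. \<Sum>Y\<in>families X k M. family_weight k T a b M Y * (\<Prod>i = 0..<l. s + of_bool (u i \<in> Y (m i))))"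
    unfolding f_def by (intro ext sum.cong refl arg_cong2[where f = times] prod.cong) auto
  have g_alt: "g = (\<lambda>s. ?G * (\<Sum>p | p permutes {0..<l}. signof p * (\<Prod>i = 0..<l. s * of_bool (i = p i) + K i (p i))))"
    unfolding g_def fdet_leibniz[of l] by (intro ext sum.cong refl arg_cong2[where f = times] prod.cong) auto
  have "isCont f 0" by (subst f_alt) (intro continuous_intros)
  then have "f \<midarrow>0\<rightarrow> f 0" by (rule isContD)
  moreover have "isCont g 0" by (subst g_alt) (intro continuous_intros)
  then have "g \<midarrow>0\<rightarrow> g 0" by (rule isContD)
  then have "f \<midarrow>0\<rightarrow> g 0"
    by (rule Lim_transform_eventually) (simp add: eventually_at_filter fg)
  ultimately have "f 0 = g 0" by (rule LIM_unique)
  moreover have "(\<Prod>i = 0..<l. if u i \<in> Y (m i) then 0 + 1 else 0) = (of_bool (\<forall>i<l. u i \<in> Y (m i)) :: 'a)" for Y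
  proof (cases "\<forall>i<l. u i \<in> Y (m i)")
    case True
    then have "(\<Prod>i = 0..<l. if u i \<in> Y (m i) then 0 + 1 else 0) = (\<Prod>i = 0..<l. 1 :: 'a)"
      by (intro prod.cong) auto
    then show ?thesis using True by simp
  next
    case False
    then obtain i where "i < l" "u i \<notin> Y (m i)" by auto
    then have "(\<Prod>i = 0..<l. if u i \<in> Y (m i) then 0 + 1 else 0) = (0 :: 'a)"
      by (intro prod_zero) auto
    then show ?thesis using False by simp
  qed
  moreover have "fdet l (\<lambda>i i'. (if i = i' then 0 else 0) + K i i') = fdet l K"
    by (rule fdet_cong) simp
  ultimately show ?thesis by (simp only: f_def g_def)
qed

end


section \<open>Step weights and total nonnegativity\<close>

lemma laurent_coeff_linear:
  "laurent_coeff (\<lambda>z. of_real p + of_real q * inverse z) = (\<lambda>k. if k = 0 then p else if k = -1 then q else 0)"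
proof (rule laurent_coeff_eqI)
  fix z :: complex assume "norm z > 1"
  have "(\<lambda>k. complex_of_real (if - int k = 0 then p else if - int k = -1 then q else 0) * inverse z ^ k) sums
     (\<Sum>k\<in>{0, 1}. complex_of_real (if - int k = 0 then p else if - int k = -1 then q else 0) * inverse z ^ k)"
    by (rule sums_finite) auto
  then show "(\<lambda>k. complex_of_real (if - int k = 0 then p else if - int k = -1 then q else 0) * inverse z ^ k) sums
     (of_real p + of_real q * inverse z)" by simp
qed auto

text \<open>\<open>p + q x = (p + q) - q (1 - x)\<close>, so the series is \<open>p + q\<close>
  times the geometric one with \<open>q\<close> taken off the constant term.\<close>

lemma laurent_coeff_geometric:
  "laurent_coeff (\<lambda>z. 1 / (1 - inverse z) * (of_real p + of_real q * inverse z))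
     = (\<lambda>k. if k = 0 then p else if k < 0 then p + q else 0)"
proof (rule laurent_coeff_eqI)
  fix z :: complex assume z: "norm z > 1"
  let ?x = "inverse z"
  have x: "norm ?x < 1" using z by (simp add: norm_inverse inverse_less_1_iff)
  then have ne: "1 - ?x \<noteq> 0" by auto
  have "(\<lambda>k. of_real (p + q) * ?x ^ k) sums (of_real (p + q) * (1 / (1 - ?x)))"
    by (intro sums_mult geometric_sums x)
  from sums_diff[OF this sums_single[of 0 "\<lambda>_. of_real q"]]
  have "(\<lambda>k. of_real (p + q) * ?x ^ k - (if k = 0 then of_real q else 0)) sums
     (of_real (p + q) * (1 / (1 - ?x)) - of_real q)" by simp
  also have "(\<lambda>k. of_real (p + q) * ?x ^ k - (if k = 0 then of_real q else 0)) =
    (\<lambda>k. complex_of_real (if - int k = 0 then p else if - int k < 0 then p + q else 0) * ?x ^ k)"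
    by (rule ext) auto
  also have "of_real (p + q) * (1 / (1 - ?x)) - of_real q = 1 / (1 - ?x) * (of_real p + of_real q * ?x)"
    using ne by (simp add: field_simps)
  finally show "(\<lambda>k. complex_of_real (if - int k = 0 then p else if - int k < 0 then p + q else 0) * ?x ^ k) sums
     (1 / (1 - ?x) * (of_real p + of_real q * ?x))" .
qed auto

text \<open>On heights, the polynomial symbols are steps that stay or drop by one; those with the
  geometric prefactor, \<open>jump\<close> below, may drop by any amount. The parity of the starting
  height enters because it selects the row of the block.\<close>

definition hop :: "real \<Rightarrow> real \<Rightarrow> int \<Rightarrow> int \<Rightarrow> real" where
  "hop a b u v = (if v = u then 1 else if v = u - 1 then (if even u then a else b) else 0)"

definition jump :: "real \<Rightarrow> real \<Rightarrow> int \<Rightarrow> int \<Rightarrow> real" where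
  "jump a b u v = (if v \<le> u then if even u = even v then 1 else if even u then a else b else 0)"

lemma int_parity_cases:
  fixes u :: int
  obtains x where "u = 2 * x" | x where "u = 2 * x + 1" by (metis evenE oddE)

abbreviation mats2 :: "'a mat set" where
  "mats2 \<equiv> carrier_mat 2 2"

lemma mat_of_rows_list_2_index [simp]:
  "mat_of_rows_list 2 [[a, b], [c, d]] $$ (0, 0) = a"
  "mat_of_rows_list 2 [[a, b], [c, d]] $$ (0, Suc 0) = b"
  "mat_of_rows_list 2 [[a, b], [c, d]] $$ (Suc 0, 0) = c"
  "mat_of_rows_list 2 [[a, b], [c, d]] $$ (Suc 0, Suc 0) = d"
  "dim_row (mat_of_rows_list 2 [[a, b], [c, d]]) = 2"
  "dim_col (mat_of_rows_list 2 [[a, b], [c, d]]) = 2"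
  "mat_of_rows_list 2 [[a, b], [c, d]] \<in> mats2" by (auto simp: mat_of_rows_list_def)

lemma block_toeplitz_block:
  "block_toeplitz (aztec_block a b) u v = hop a b u v"
proof -
  have l: "laurent_coeff (\<lambda>z. 1) = (\<lambda>k. if k = 0 then 1 else 0)"
    "laurent_coeff (\<lambda>z. of_real q * inverse z) = (\<lambda>k. if k = -1 then q else 0)"
    "laurent_coeff (\<lambda>z. of_real p) = (\<lambda>k. if k = 0 then p else 0)" for p q
    using laurent_coeff_linear[of 1 0] laurent_coeff_linear[of 0 q] laurent_coeff_linear[of p 0]
    by (auto simp: fun_eq_iff)
  show ?thesis by (cases u rule: int_parity_cases; cases v rule: int_parity_cases)
      (auto simp: block_toeplitz_def aztec_block_def hop_def l, (presburger+)?)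
qed

lemma block_toeplitz_geometric_block:
  "block_toeplitz (\<lambda>z. (1 / (1 - inverse z)) \<cdot>\<^sub>m aztec_block a b z) u v = jump a b u v"
proof -
  have l: "laurent_coeff (\<lambda>z. 1 / (1 - inverse z)) = (\<lambda>k. if k \<le> 0 then 1 else 0)"
    "laurent_coeff (\<lambda>z. 1 / (1 - inverse z) * (of_real q * inverse z)) = (\<lambda>k. if k < 0 then q else 0)"
    "laurent_coeff (\<lambda>z. 1 / (1 - inverse z) * of_real p) = (\<lambda>k. if k \<le> 0 then p else 0)" for p q
    using laurent_coeff_geometric[of 1 0] laurent_coeff_geometric[of 0 q] laurent_coeff_geometric[of p 0]
    by (auto simp: fun_eq_iff)
  have dims: "dim_row (aztec_block a b z) = 2" "dim_col (aztec_block a b z) = 2" for z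
    by (simp_all add: aztec_block_def)
  have "block_toeplitz (\<lambda>z. (1 / (1 - inverse z)) \<cdot>\<^sub>m aztec_block a b z) u v
    = laurent_coeff (\<lambda>z. 1 / (1 - inverse z) * aztec_block a b z $$ (nat (u mod 2), nat (v mod 2))) (v div 2 - u div 2)"
    unfolding block_toeplitz_def by (subst index_smult_mat) (auto simp: dims nat_less_iff)
  then show ?thesis by (cases u rule: int_parity_cases; cases v rule: int_parity_cases)
      (auto simp: aztec_block_def jump_def l simp del: times_divide_eq_left, (presburger+)?)
qed

context
  fixes \<alpha> \<beta> :: real
begin

definition step :: "nat \<Rightarrow> int \<Rightarrow> int \<Rightarrow> real" where
  "step m = (if odd m then hop else jump)
     (if m mod 4 \<in> {1, 2} then \<alpha>\<^sup>2 else 1) (if m mod 4 \<in> {1, 2} then \<beta>\<^sup>2 else 1)"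

lemma block_toeplitz_symbol: "block_toeplitz (aztec_symbol \<alpha> \<beta> m) = step m"
proof (intro ext)
  fix u v
  have "odd m \<longleftrightarrow> m mod 4 = 1 \<or> m mod 4 = 3" by presburger
  moreover have "m mod 4 < 4" by simp
  then consider "m mod 4 = 0" | "m mod 4 = 1" | "m mod 4 = 2" | "m mod 4 = 3" by linarith
  ultimately show "block_toeplitz (aztec_symbol \<alpha> \<beta> m) u v = step m u v"
    unfolding aztec_symbol_def[abs_def] step_def
    by cases (simp_all add: block_toeplitz_block block_toeplitz_geometric_block)
qed

section \<open>Total nonnegativity of the steps\<close>

text \<open>A nonzero Leibniz term needs \<open>v (p i)\<close> to be \<open>u i\<close> or
  \<open>u i - 1\<close>. As \<open>u\<close> increases by at least one each time, such a
  \<open>p\<close> preserves the order and is the identity, which leaves a single product of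
  nonnegative weights.\<close>

lemma fdet_hop_nonneg:
  assumes ab: "a > 0" "b > 0"
    and u: "\<And>i j. i < j \<Longrightarrow> j < k \<Longrightarrow> u i < u j" and v: "\<And>i j. i < j \<Longrightarrow> j < k \<Longrightarrow> v i < v j"
  shows "fdet k (\<lambda>i j. hop a b (u i) (v j)) \<ge> 0"
proof -
  have "fdet k (\<lambda>i j. hop a b (u i) (v j)) = (\<Prod>i = 0..<k. hop a b (u i) (v i))"
  proof (rule fdet_diagonal_term, rule ccontr)
    fix p assume p: "p permutes {0..<k}" "p \<noteq> id" and "\<not> (\<exists>i<k. hop a b (u i) (v (p i)) = 0)"
    then have *: "v (p i) = u i \<or> v (p i) = u i - 1" if "i < k" for i
      using that by (auto simp: hop_def split: if_splits)
    have pk: "p i < k" if "i < k" for i using permutes_in_image[OF p(1), of i] that by simp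
    have strict: "p i < p j" if "i < j" "j < k" for i j
    proof -
      have "u i < u j" using u that by blast
      then have "\<not> v (p j) < v (p i)" using *[of i] *[of j] that by auto
      moreover have "p i \<noteq> p j" using permutes_inj[OF p(1)] that by (auto dest: injD)
      ultimately show ?thesis using v[of "p j" "p i"] pk[of i] that by (meson less_trans linorder_neqE_nat)
    qed
    have "i \<le> p i" if "i < k" for i using that
    proof (induction i)
      case (Suc i)
      then show ?case using strict[of i "Suc i"] by simp
    qed simp
    then have "p = id" by (intro permutes_natset_ge[OF p(1)]) auto
    then show False using p by simp
  qed
  also have "\<dots> \<ge> 0" using ab by (intro prod_nonneg) (auto simp: hop_def)
  finally show ?thesis .
qed

text \<open>\<open>a * b = 1\<close> makes the parity weights a diagonal scaling:
  \<open>d (u i)\<close> and \<open>1 / d (v j)\<close> come out as row and column factors and leave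
  the 0-1 matrix of the relation \<open>v j \<le> u i\<close>. Its rows are initial segments of ones
  of nondecreasing length, so its determinant is 0 or 1.\<close>

lemma fdet_jump_nonneg:
  assumes ab: "a > 0" "a * b = 1"
    and u: "\<And>i j. i < j \<Longrightarrow> j < k \<Longrightarrow> u i < u j" and v: "\<And>i j. i < j \<Longrightarrow> j < k \<Longrightarrow> v i < v j"
  shows "fdet k (\<lambda>i j. jump a b (u i) (v j)) \<ge> 0"
proof -
  define d where "d w = (if even w then a else 1)" for w :: int
  have d: "d w > 0" for w using ab by (simp add: d_def)
  have b: "b = 1 / a" using ab by (simp add: field_simps)
  define s where "s i j = (if v j \<le> u i then 1 else 0 :: real)" for i j
  have "fdet k (\<lambda>i j. jump a b (u i) (v j)) = fdet k (\<lambda>i j. d (u i) * s i j * (1 / d (v j)))"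
    using ab by (intro fdet_cong) (auto simp: jump_def d_def s_def b)
  also have "\<dots> = (\<Prod>i = 0..<k. d (u i)) * fdet k s * (\<Prod>j = 0..<k. 1 / d (v j))"
    by (rule fdet_scale)
  finally have eq: "fdet k (\<lambda>i j. jump a b (u i) (v j)) = (\<Prod>i = 0..<k. d (u i)) * fdet k s * (\<Prod>j = 0..<k. 1 / d (v j))" .
  \<comment> \<open>The number of ones in row \<open>i\<close>. A zero row or two equal rows give
    determinant 0; otherwise these numbers increase strictly, from at least 1 to at most
    \<open>k\<close>, and hence are 1, ..., \<open>k\<close>.\<close>
  define r where "r i = card {j. j < k \<and> v j \<le> u i}" for i
  have s_r: "s i j = (if j < r i then 1 else 0)" if "j < k" for i j
  proof -
    define A where "A = {j. j < k \<and> v j \<le> u i}"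
    have fin: "finite A" by (simp add: A_def)
    have down: "j' \<in> A" if "j \<in> A" "j' < j" for j j' using that v[of j' j] by (force simp: A_def)
    have "A = {..<card A}"
    proof (cases "A = {}")
      case False
      have "A = {..Max A}"
      proof
        show "A \<subseteq> {..Max A}" using fin by auto
        show "{..Max A} \<subseteq> A"
          using down[OF Max_in[OF fin False]] Max_in[OF fin False] by (auto simp: le_less)
      qed
      then show ?thesis by (metis card_atMost lessThan_Suc_atMost)
    qed simp
    then have "j \<in> A \<longleftrightarrow> j < card A" by blast
    then show ?thesis using that by (simp add: s_def r_def A_def)
  qed
  have r_mono: "r i \<le> r j" if "i < j" "j < k" for i j
    unfolding r_def using u[OF that] by (intro card_mono) auto
  have r_le: "r i \<le> k" for i unfolding r_def by (rule order.trans[OF card_mono[of "{..<k}"]]) auto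
  have "fdet k s \<ge> 0"
  proof (cases "\<exists>i<k. r i = 0")
    case True
    then obtain i where i: "i < k" "r i = 0" by auto
    have "(\<Prod>i = 0..<k. s i (p i)) = 0" if "p permutes {0..<k}" for p
      using permutes_in_image[OF that, of i] i by (intro prod_zero bexI[of _ i]) (auto simp: s_r)
    then have "fdet k s = 0" unfolding fdet_leibniz by (intro sum.neutral) auto
    then show ?thesis by simp
  next
    case pos: False
    show ?thesis
    proof (cases "\<exists>i j. i < j \<and> j < k \<and> r i = r j")
      case True
      then obtain i j where "i < j" "j < k" "r i = r j" by auto
      then have "fdet k s = 0" by (intro fdet_identical_rows[of i k j]) (auto simp: s_r)
      then show ?thesis by simp
    next
      case False
      then have strict: "r i < r j" if "i < j" "j < k" for i j
        using r_mono[OF that] that by (metis le_neq_implies_less)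
      have lower: "i < r i" if "i < k" for i using that
      proof (induction i)
        case 0
        then show ?case using pos by auto
      next
        case (Suc i)
        then show ?case using strict[of i "Suc i"] by simp
      qed
      \<comment> \<open>Counted from the last row upwards: each strict increase lowers the bound
        \<open>k\<close> by one.\<close>
      have upper: "r (k - 1 - i) \<le> k - i" if "i < k" for i using that
      proof (induction i)
        case 0
        then show ?case using r_le by simp
      next
        case (Suc i)
        then have "k - 1 - Suc i < k - 1 - i" "k - 1 - i < k" by auto
        from strict[OF this] Suc show ?case by auto
      qed
      have r: "r i = Suc i" if "i < k" for i using lower[OF that] upper[of "k - 1 - i"] that by simp
      have "fdet k s = (\<Prod>i = 0..<k. s i i)"
      proof (rule fdet_diagonal_term, rule ccontr)
        fix p assume p: "p permutes {0..<k}" "p \<noteq> id" and *: "\<not> (\<exists>i<k. s i (p i) = 0)"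
        have le: "p i \<le> i" if "i < k" for i
          using * that s_r[of "p i" i] r[of i] permutes_in_image[OF p(1), of i] by (auto split: if_splits)
        have "p = id" by (rule permutes_natset_le[OF p(1)]) (use le in auto)
        then show False using p by simp
      qed
      then show ?thesis by (simp add: s_def prod_nonneg)
    qed
  qed
  then show ?thesis
    unfolding eq using d by (intro mult_nonneg_nonneg prod_nonneg) (auto simp: less_imp_le)
qed

lemma fdet_step_nonneg:
  assumes "\<alpha> > 0" "\<beta> > 0" "\<alpha> * \<beta> = 1"
    and "\<And>i j. i < j \<Longrightarrow> j < k \<Longrightarrow> u i < u j" and "\<And>i j. i < j \<Longrightarrow> j < k \<Longrightarrow> v i < v j"
  shows "fdet k (\<lambda>i j. step m (u i) (v j)) \<ge> 0"
proof -
  have "\<alpha>\<^sup>2 * \<beta>\<^sup>2 = 1" using assms(3) by (metis power_mult_distrib power_one)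
  with assms show ?thesis unfolding step_def by (auto intro!: fdet_hop_nonneg fdet_jump_nonneg)
qed

lemma step_eq_0: "u < v \<Longrightarrow> step m u v = 0" by (simp add: step_def hop_def jump_def)

lemma fdet_nonzero_permutation:
  assumes "fdet k f \<noteq> (0 :: 'a :: idom)"
  obtains p where "p permutes {0..<k}" "\<And>i. i < k \<Longrightarrow> f i (p i) \<noteq> 0"
proof -
  obtain p where "p permutes {0..<k}" "signof p * (\<Prod>i = 0..<k. f i (p i)) \<noteq> 0"
    using assms unfolding fdet_leibniz by (metis (mono_tags, lifting) mem_Collect_eq sum.neutral)
  then show ?thesis by (intro that[of p]) auto
qed


section \<open>The measure as a finite sum\<close>

definition config_of :: "nat \<Rightarrow> (nat \<Rightarrow> int set) \<Rightarrow> (nat \<times> int) set" where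
  "config_of N Y = {(m, u). m \<in> {1..4 * N - 1} \<and> u \<in> Y m}"

text \<open>Paths never rise, start below \<open>2 * n\<close> and end at heights of at least
  \<open>-2 * N\<close>, so configurations of nonzero weight stay in this window. Both bounds are
  even: the window consists of whole blocks, as the composition of block Toeplitz matrices on it
  requires.\<close>

definition slab :: "nat \<Rightarrow> nat \<Rightarrow> int set" where
  "slab N n = {- 2 * int N..<2 * int n}"

definition end_height :: "nat \<Rightarrow> nat \<Rightarrow> int" where
  "end_height N j = - 2 * int N + int j"

abbreviation tiling_weight :: "nat \<Rightarrow> nat \<Rightarrow> (nat \<Rightarrow> int set) \<Rightarrow> real" where
  "tiling_weight N n \<equiv> family_weight (2 * n) (step) int (end_height N) (4 * N)"

abbreviation slab_families :: "nat \<Rightarrow> nat \<Rightarrow> (nat \<Rightarrow> int set) set" where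
  "slab_families N n \<equiv> families (slab N n) (2 * n) (4 * N)"

lemma finite_slab [simp]: "finite (slab N n)" by (simp add: slab_def)

section \<open>Support, sign and total mass of the weight\<close>

lemma sorted_enum_less:
  assumes "finite Y" "card Y = k" "i < j" "j < k"
  shows "enum Y i < (enum Y j :: int)"
  using assms strict_sorted_list_of_set[of Y] by (simp add: sorted_wrt_iff_nth_less)

lemma enum_surj: "finite Y \<Longrightarrow> card Y = k \<Longrightarrow> y \<in> (Y :: int set) \<Longrightarrow> \<exists>j<k. enum Y j = y"
  by (metis in_set_conv_nth length_sorted_list_of_set set_sorted_list_of_set)

lemma aztec_weight_eq:
  "aztec_weight \<alpha> \<beta> N n C = (\<Prod>m = 1..4 * N. fdet (2 * n)
      (\<lambda>j k. step m (aztec_height N C (m - 1) j) (aztec_height N C m k)))"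
  by (simp add: aztec_weight_def fdet_def block_toeplitz_symbol)

lemma aztec_height_less:
  assumes "C \<in> aztec_configs N n" "m \<le> 4 * N" "i < j" "j < 2 * n"
  shows "aztec_height N C m i < aztec_height N C m j"
  using assms sorted_enum_less[of "{u. (m, u) \<in> C}" "2 * n" i j]
  by (auto simp: aztec_height_def aztec_configs_def)

text \<open>The density passes through \<open>ennreal\<close>, which cuts negative values to 0;
  nonnegativity lets probabilities be read as quotients of sums of weights.\<close>

lemma aztec_weight_nonneg:
  assumes "\<alpha> > 0" "\<beta> > 0" "\<alpha> * \<beta> = 1" "C \<in> aztec_configs N n"
  shows "aztec_weight \<alpha> \<beta> N n C \<ge> 0" unfolding aztec_weight_eq using assms
  by (intro prod_nonneg ballI fdet_step_nonneg) (auto intro!: aztec_height_less)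

text \<open>A nonzero step determinant provides a bijection between the points of two neighbouring
  levels along which heights do not increase. The upper bound is carried from level 0 forwards, the
  lower one from level \<open>4 * N\<close> backwards.\<close>

lemma aztec_height_bounds:
  assumes N: "N > 0" and w: "aztec_weight \<alpha> \<beta> N n C \<noteq> 0" and m: "m \<le> 4 * N" and j: "j < 2 * n"
  shows "aztec_height N C m j \<in> slab N n"
proof -
  have nz: "fdet (2 * n) (\<lambda>j k. step (Suc m) (aztec_height N C m j) (aztec_height N C (Suc m) k)) \<noteq> 0"
    if "m < 4 * N" for m
    using w that unfolding aztec_weight_eq by (auto simp: prod_zero_iff dest!: bspec[of _ _ "Suc m"])
  have step: "\<exists>p. p permutes {0..<2 * n} \<and> (\<forall>i<2 * n. aztec_height N C (Suc m) (p i) \<le> aztec_height N C m i)"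
    if m: "m < 4 * N" for m
  proof -
    obtain p where "p permutes {0..<2 * n}"
      "\<And>i. i < 2 * n \<Longrightarrow> step (Suc m) (aztec_height N C m i) (aztec_height N C (Suc m) (p i)) \<noteq> 0"
      by (rule fdet_nonzero_permutation[OF nz[OF m]]) blast
    then show ?thesis by (metis step_eq_0 not_less)
  qed
  have "aztec_height N C m j < 2 * int n" using m j
  proof (induction m arbitrary: j)
    case 0
    then show ?case by (simp add: aztec_height_def)
  next
    case (Suc m)
    obtain p where p: "p permutes {0..<2 * n}" "\<forall>i<2 * n. aztec_height N C (Suc m) (p i) \<le> aztec_height N C m i"
      using step[of m] Suc.prems by auto
    obtain i where i: "p i = j" using permutes_surj[OF p(1)] by (metis surjD)
    then have "i < 2 * n" using permutes_in_image[OF p(1), of i] Suc.prems by simp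
    then show ?case using p(2) i Suc.IH[of i] Suc.prems by force
  qed
  moreover have "- 2 * int N \<le> aztec_height N C m j" using m j
  proof (induction "4 * N - m" arbitrary: m j)
    case 0
    then show ?case using N by (simp add: aztec_height_def)
  next
    case (Suc d)
    then have m: "m < 4 * N" by simp
    obtain p where p: "p permutes {0..<2 * n}" "\<forall>i<2 * n. aztec_height N C (Suc m) (p i) \<le> aztec_height N C m i"
      using step[OF m] by auto
    have "p j < 2 * n" using permutes_in_image[OF p(1), of j] Suc.prems by simp
    then have "- 2 * int N \<le> aztec_height N C (Suc m) (p j)"
      using Suc.hyps(1)[of "Suc m" "p j"] Suc.hyps(2) m by simp
    then show ?case using p(2) Suc.prems by force
  qed
  ultimately show ?thesis by (simp add: slab_def)
qed

lemma families_level: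
  assumes "Y \<in> families (slab N n) k M" "m \<in> {1..<M}"
  shows "finite (Y m)" "card (Y m) = k" "Y m \<subseteq> slab N n"
  using assms by (auto simp: PiE_def Pi_def intro: finite_subset[OF _ finite_slab])

lemma config_of_level: "0 < m \<Longrightarrow> m < 4 * N \<Longrightarrow> {u. (m, u) \<in> config_of N Y} = Y m"
  by (auto simp: config_of_def)

lemma config_of_in_configs:
  assumes "Y \<in> slab_families N n"
  shows "config_of N Y \<in> aztec_configs N n" unfolding aztec_configs_def
proof (clarsimp, intro conjI ballI)
  show "config_of N Y \<subseteq> {Suc 0..4 * N - Suc 0} \<times> UNIV" by (auto simp: config_of_def)
  fix m assume m: "m \<in> {Suc 0..4 * N - Suc 0}"
  show "finite {u. (m, u) \<in> config_of N Y}" "card {u. (m, u) \<in> config_of N Y} = 2 * n"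
    using families_level[OF assms, of m] m by (auto simp: config_of_level)
qed

lemma inj_on_config_of: "inj_on (config_of N) (families (slab N n) k (4 * N))"
proof (rule inj_onI)
  fix Y Y' assume Y: "Y \<in> families (slab N n) k (4 * N)" "Y' \<in> families (slab N n) k (4 * N)"
    and eq: "config_of N Y = config_of N Y'"
  show "Y = Y'"
  proof (rule PiE_ext[OF Y])
    fix m assume "m \<in> {1..<4 * N}"
    then have "0 < m" "m < 4 * N" by auto
    from config_of_level[OF this] show "Y m = Y' m" using eq by metis
  qed
qed

lemma config_of_surj:
  assumes N: "N > 0" and C: "C \<in> aztec_configs N n" and w: "aztec_weight \<alpha> \<beta> N n C \<noteq> 0"
  shows "C \<in> config_of N ` slab_families N n"
proof
  define Y where "Y = (\<lambda>m\<in>{1..<4 * N}. {u. (m, u) \<in> C})"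
  have "m \<in> {1..<4 * N} \<longleftrightarrow> m \<in> {1..4 * N - 1}" for m using N by auto
  moreover have "C \<subseteq> {1..4 * N - 1} \<times> UNIV"
    using C by (simp only: aztec_configs_def mem_Collect_eq)
  ultimately show "C = config_of N Y"
    by (force simp only: config_of_def Y_def restrict_apply split: if_splits)
  show "Y \<in> slab_families N n"
  proof (rule PiE_I)
    fix m assume m: "m \<in> {1..<4 * N}"
    then have fin: "finite {u. (m, u) \<in> C}" "card {u. (m, u) \<in> C} = 2 * n"
      using C by (auto simp: aztec_configs_def)
    have "u \<in> slab N n" if u: "(m, u) \<in> C" for u
    proof -
      obtain j where "j < 2 * n" "enum {u. (m, u) \<in> C} j = u" using enum_surj[OF fin, of u] u by auto
      then show ?thesis using aztec_height_bounds[OF N w, of m j] m by (auto simp: aztec_height_def)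
    qed
    then show "Y m \<in> {Y. Y \<subseteq> slab N n \<and> card Y = 2 * n}"
      using m fin by (auto simp: Y_def)
  qed (auto simp: Y_def)
qed

lemma aztec_weight_config_of:
  "aztec_weight \<alpha> \<beta> N n (config_of N Y) = tiling_weight N n Y"
  unfolding aztec_weight_eq family_weight_def by (intro prod.cong refl fdet_cong)
    (auto simp: aztec_height_def level_height_def end_height_def config_of_level)

lemma of_real_family_weight:
  "of_real (family_weight k T a b M Y) = (family_weight k (\<lambda>m u v. of_real (T m u v)) a b M Y :: complex)"
  by (simp add: family_weight_def fdet_leibniz)

text \<open>In the tightly packed configuration every path drops by one at each odd step and stays
  at each even one. Packing makes every step matrix triangular, so its determinant is the product of
  positive diagonal weights. The normalising sum is therefore positive.\<close>

lemma packed_family_weight_pos: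
  assumes "\<alpha> > 0" "\<beta> > 0" "N > 0"
  shows "\<exists>Y\<in>slab_families N n. tiling_weight N n Y > 0"
proof
  \<comment> \<open>\<open>c m\<close> is the number of odd steps among the first \<open>m\<close>;
    \<open>c (4 * N) = 2 * N\<close> matches the end heights.\<close>
  define c where "c m = int ((m + 1) div 2)" for m :: nat
  define Y where "Y = (\<lambda>m\<in>{1..<4 * N}. {- c m..<2 * int n - c m})"
  have c: "c m \<le> 2 * int N" if "m \<le> 4 * N" for m using that by (auto simp: c_def)
  show Y: "Y \<in> slab_families N n"
  proof (rule PiE_I)
    fix m assume m: "m \<in> {1..<4 * N}"
    have "c m \<ge> 0" by (simp add: c_def)
    then show "Y m \<in> {Y. Y \<subseteq> slab N n \<and> card Y = 2 * n}"
      using m c[of m] by (auto simp: Y_def slab_def)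
  qed (auto simp: Y_def)
  have enum: "enum {a..<a + int k} j = a + int j" if "j < k" for a k j
  proof -
    have "sorted_list_of_set {a..<a + int k} = map (\<lambda>i. a + int i) [0..<k]"
      by (rule sorted_list_of_set_unique[THEN iffD1])
        (auto simp: sorted_wrt_map sorted_wrt_upt image_iff intro!: bexI[of _ "nat (_ - a)"])
    then show ?thesis using that by simp
  qed
  have h: "level_height int (end_height N) (4 * N) Y m j = int j - c m" if "m \<le> 4 * N" "j < 2 * n" for m j
  proof -
    consider "m = 0" | "m = 4 * N" | "m \<in> {1..<4 * N}" using \<open>m \<le> 4 * N\<close> by fastforce
    then show ?thesis
    proof cases
      case 3
      have "{- c m..<2 * int n - c m} = {- c m..<- c m + int (2 * n)}" by auto
      with 3 show ?thesis using enum[OF that(2), of "- c m"] by (auto simp: level_height_def Y_def)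
    qed (use \<open>N > 0\<close> in \<open>auto simp: level_height_def end_height_def c_def\<close>)
  qed
  have pos: "fdet (2 * n) (\<lambda>j i. step (Suc m) (int j - c m) (int i - c (Suc m))) > 0" for m
  proof -
    let ?f = "\<lambda>j i. step (Suc m) (int j - c m) (int i - c (Suc m))"
    have d: "?f j j > 0" for j
      using assms by (cases "even m") (auto simp: step_def hop_def jump_def c_def elim!: evenE oddE)
    have "fdet (2 * n) ?f = (\<Prod>j = 0..<2 * n. ?f j j)"
    proof (rule fdet_diagonal_term, rule ccontr)
      fix p assume p: "p permutes {0..<2 * n}" "p \<noteq> id" and *: "\<not> (\<exists>i<2 * n. ?f i (p i) = 0)"
      show False
      proof (cases "even m")
        case True
        then have cc: "c (Suc m) = c m + 1" by (auto simp: c_def elim!: evenE)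
        have "p i \<ge> i" if "i < 2 * n" for i
        proof (rule ccontr)
          assume "\<not> p i \<ge> i"
          then have "?f i (p i) = 0" using True by (auto simp: step_def hop_def cc)
          with * that show False by blast
        qed
        then have "p = id" by (intro permutes_natset_ge[OF p(1)]) auto
        with p show False by simp
      next
        case False
        then have cc: "c (Suc m) = c m" by (auto simp: c_def elim!: oddE)
        have "p i \<le> i" if "i < 2 * n" for i
        proof (rule ccontr)
          assume "\<not> p i \<le> i"
          then have "?f i (p i) = 0" using False by (auto simp: step_def jump_def cc)
          with * that show False by blast
        qed
        then have "p = id" by (intro permutes_natset_le[OF p(1)]) auto
        with p show False by simp
      qed
    qed
    also have "\<dots> > 0" using d by (intro prod_pos) auto
    finally show ?thesis .
  qed
  show "tiling_weight N n Y > 0" unfolding family_weight_def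
  proof (rule prod_pos, goal_cases)
    case (1 m)
    then obtain m' where m': "m = Suc m'" by (cases m) auto
    have "fdet (2 * n) (\<lambda>j i. step m (level_height int (end_height N) (4 * N) Y (m - 1) j)
              (level_height int (end_height N) (4 * N) Y m i)) =
       fdet (2 * n) (\<lambda>j i. step (Suc m') (int j - c m') (int i - c (Suc m')))"
      using 1 m' by (intro fdet_cong) (simp add: h)
    then show ?case using pos[of m'] by simp
  qed
qed

text \<open>Outside the image of the slab families all weights vanish, so the infinite normalising
  sum and the point measure both reduce to finite sums over these families.\<close>

lemma measure_aztec:
  assumes "\<alpha> > 0" "\<beta> > 0" "\<alpha> * \<beta> = 1" and N: "N > 0"
  shows "measure (aztec_measure \<alpha> \<beta> N n) {C \<in> aztec_configs N n. P C}
     = (\<Sum>Y\<in>slab_families N n.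
          tiling_weight N n Y * of_bool (P (config_of N Y)))
       / (\<Sum>Y\<in>slab_families N n. tiling_weight N n Y)"
    and "(\<Sum>Y\<in>slab_families N n. tiling_weight N n Y) > 0"
proof -
  let ?F = "slab_families N n"
  let ?w = "aztec_weight \<alpha> \<beta> N n"
  let ?fw = "tiling_weight N n"
  define Z where "Z = (\<Sum>Y\<in>?F. ?fw Y)"
  have finF: "finite ?F" by (intro finite_PiE) auto
  have fw: "?fw Y \<ge> 0" if "Y \<in> ?F" for Y
    using aztec_weight_nonneg[OF assms(1-3) config_of_in_configs[OF that]] by (simp add: aztec_weight_config_of)
  show Z: "Z > 0" unfolding Z_def
  proof -
    obtain Y where "Y \<in> ?F" "?fw Y > 0"
      using packed_family_weight_pos[OF assms(1,2) N, of n] by blast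
    then show "(\<Sum>Y\<in>?F. ?fw Y) > 0" using finF fw by (meson sum_pos2)
  qed
  have sum_C: "(\<Sum>C\<in>config_of N ` ?F. f C) = (\<Sum>Y\<in>?F. f (config_of N Y))" for f :: "_ \<Rightarrow> real"
    by (rule sum.reindex[OF inj_on_config_of, unfolded o_def])
  have "(\<Sum>\<^sub>\<infinity>D\<in>aztec_configs N n. ?w D) = (\<Sum>\<^sub>\<infinity>D\<in>config_of N ` ?F. ?w D)"
    by (rule infsum_cong_neutral) (use config_of_surj[OF N] config_of_in_configs in auto)
  also have "\<dots> = (\<Sum>D\<in>config_of N ` ?F. ?w D)" using finF by (intro infsum_finite) simp
  also have "\<dots> = Z" by (simp only: sum_C aztec_weight_config_of Z_def)
  finally have infsum: "(\<Sum>\<^sub>\<infinity>D\<in>aztec_configs N n. ?w D) = Z" .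
  let ?A = "{C \<in> aztec_configs N n. P C}"
  have sub: "{C\<in>?A. 0 < ennreal (?w C / Z)} \<subseteq> config_of N ` ?F"
  proof
    fix C assume "C \<in> {C\<in>?A. 0 < ennreal (?w C / Z)}"
    then have "C \<in> aztec_configs N n" "?w C \<noteq> 0" by auto
    then show "C \<in> config_of N ` ?F" by (rule config_of_surj[OF N])
  qed
  have "emeasure (aztec_measure \<alpha> \<beta> N n) ?A = (\<Sum>C\<in>{C\<in>?A. 0 < ennreal (?w C / Z)}. ennreal (?w C / Z))"
    unfolding aztec_measure_def infsum
    by (subst emeasure_point_measure) (use finF finite_subset[OF sub] in \<open>auto intro!: sum.cong\<close>)
  also have "\<dots> = (\<Sum>C\<in>config_of N ` ?F. ennreal (?w C / Z * of_bool (P C)))"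
    by (rule sum.mono_neutral_cong_left) (use finF sub config_of_in_configs in \<open>auto simp: ennreal_eq_0_iff not_le\<close>)
  also have "\<dots> = ennreal (\<Sum>C\<in>config_of N ` ?F. ?w C / Z * of_bool (P C))"
    by (rule sum_ennreal) (use fw Z in \<open>auto simp: aztec_weight_config_of\<close>)
  also have "(\<Sum>C\<in>config_of N ` ?F. ?w C / Z * of_bool (P C)) = (\<Sum>Y\<in>?F. ?fw Y * of_bool (P (config_of N Y))) / Z"
    by (simp only: sum_C aztec_weight_config_of sum_divide_distrib times_divide_eq_left)
  finally have em: "emeasure (aztec_measure \<alpha> \<beta> N n) ?A = ennreal ((\<Sum>Y\<in>?F. ?fw Y * of_bool (P (config_of N Y))) / Z)" .
  have "(\<Sum>Y\<in>?F. ?fw Y * of_bool (P (config_of N Y))) / Z \<ge> 0"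
    using fw Z by (intro divide_nonneg_pos sum_nonneg) auto
  then show "measure (aztec_measure \<alpha> \<beta> N n) ?A = (\<Sum>Y\<in>?F. ?fw Y * of_bool (P (config_of N Y))) / (\<Sum>Y\<in>?F. ?fw Y)"
    using em by (simp add: measure_def Z_def del: sum_mult_of_bool_eq)
qed

end

section \<open>Contour integrals as Laurent coefficients\<close>

lemma eval_fps_split:
  fixes F :: "complex fps"
  assumes "ereal (norm x) < fps_conv_radius F"
  shows "eval_fps F x = (\<Sum>s<n. fps_nth F s * x ^ s) + x ^ n * eval_fps (fps_shift n F) x"
proof -
  have "summable (\<lambda>s. fps_nth F s * x ^ s)" using sums_eval_fps[OF assms] by (simp add: sums_iff)
  then have "eval_fps F x = (\<Sum>s. fps_nth F (s + n) * x ^ (s + n)) + (\<Sum>s<n. fps_nth F s * x ^ s)"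
    unfolding eval_fps_def by (rule suminf_split_initial_segment)
  also have "(\<Sum>s. fps_nth F (s + n) * x ^ (s + n)) = (\<Sum>s. x ^ n * (fps_nth (fps_shift n F) s * x ^ s))"
    by (simp add: power_add mult_ac)
  also have "\<dots> = x ^ n * eval_fps (fps_shift n F) x"
    using sums_eval_fps[of x "fps_shift n F"] assms unfolding eval_fps_def
    by (intro suminf_mult) (simp add: sums_iff)
  finally show ?thesis by simp
qed

text \<open>Both contours wind once round every singularity, so the residue theorem assigns them the
  same sum; no homotopy between them has to be constructed.\<close>

lemma contour_integral_eq_circlepath:
  assumes \<gamma>: "valid_path \<gamma>" "pathfinish \<gamma> = pathstart \<gamma>" and P: "finite P" "P \<inter> path_image \<gamma> = {}"
    and wn: "\<And>p. p \<in> P \<Longrightarrow> winding_number \<gamma> p = 1" and g: "g holomorphic_on - P"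
    and r: "r > 0" "P \<subseteq> ball 0 r"
  shows "contour_integral \<gamma> g = contour_integral (circlepath 0 r) g"
proof -
  have "contour_integral \<gamma> g = of_real (2 * pi) * \<i> * (\<Sum>p\<in>P. winding_number \<gamma> p * residue g p)"
    by (rule Residue_theorem[of UNIV]) (use assms in \<open>auto simp: Compl_eq_Diff_UNIV\<close>)
  also have "\<dots> = of_real (2 * pi) * \<i> * (\<Sum>p\<in>P. winding_number (circlepath 0 r) p * residue g p)"
    using r wn by (intro arg_cong2[where f = times] sum.cong refl)
      (auto simp: winding_number_circlepath subset_iff)
  also have "\<dots> = contour_integral (circlepath 0 r) g" by (rule Residue_theorem[of UNIV, symmetric])
      (use assms in \<open>auto simp: Compl_eq_Diff_UNIV path_image_circlepath_minus\<close>)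
  finally show ?thesis .
qed

text \<open>A residue at infinity: the coefficient of \<open>1/z\<close> in \<open>z powi d\<close>
  times a series in \<open>1/z\<close> is the one of index \<open>d + 1\<close>, and there is none
  for \<open>d + 1 < 0\<close>. The contour is replaced by circles of radius \<open>r\<close>. Once
  an entire part and \<open>c / z\<close> are removed, the integrand is of order
  \<open>1/r^2\<close>, so the error is of order \<open>1/r\<close>.\<close>

lemma contour_integral_laurent_coeff:
  assumes \<gamma>: "valid_path \<gamma>" "pathfinish \<gamma> = pathstart \<gamma>" and P: "finite P" "P \<inter> path_image \<gamma> = {}"
    and wn: "\<And>p. p \<in> P \<Longrightarrow> winding_number \<gamma> p = 1" and g: "g holomorphic_on - P"
    and F: "fps_conv_radius F > 0"
    and gF: "eventually (\<lambda>z. g z = z powi d * eval_fps F (inverse z)) at_infinity"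
  shows "contour_integral \<gamma> g = 2 * of_real pi * \<i> * (if d + 1 \<ge> 0 then fps_nth F (nat (d + 1)) else 0)"
proof -
  define c where "c = (if d + 1 \<ge> 0 then fps_nth F (nat (d + 1)) else 0)"
  obtain \<rho> :: real where \<rho>: "0 < \<rho>" "ereal \<rho> < fps_conv_radius F"
    using ereal_dense3[OF F] by (metis ereal_less(2) less_ereal.simps(1) zero_ereal_def ereal_dense2 F)
  obtain R0 where R0: "\<And>z. norm z \<ge> R0 \<Longrightarrow> g z = z powi d * eval_fps F (inverse z)"
    using gF unfolding eventually_at_infinity by auto
  have "bounded P" using P finite_imp_bounded by blast
  then obtain R1 where R1: "R1 > 0" "P \<subseteq> ball 0 R1" by (metis bounded_subset_ballD)
  \<comment> \<open>Beyond \<open>R\<close> the expansion of \<open>g\<close> is valid, all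
    singularities are enclosed, and \<open>1/z\<close> stays in a closed disc on which
    \<open>F\<close> and its shifts are bounded.\<close>
  define R where "R = max (max 1 R0) (max R1 (1 / \<rho>))"
  have R: "R \<ge> 1" "R \<ge> R0" "R \<ge> R1" "R \<ge> 1 / \<rho>" by (auto simp: R_def)
  have inv: "norm (inverse z) \<le> \<rho>" if "norm z \<ge> R" for z :: complex
  proof -
    have "1 / \<rho> \<le> norm z" using that R by simp
    from le_imp_inverse_le[OF this] \<rho> show ?thesis by (simp add: norm_inverse)
  qed
  have bnd: "\<exists>B\<ge>0. \<forall>z. norm z \<ge> R \<longrightarrow> norm (eval_fps G (inverse z)) \<le> B"
    if G: "fps_conv_radius G = fps_conv_radius F" for G :: "complex fps"
  proof -
    have sub: "cball 0 \<rho> \<subseteq> eball (0 :: complex) (fps_conv_radius G)"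
    proof
      fix x :: complex assume "x \<in> cball 0 \<rho>"
      then have "ereal (norm x) \<le> ereal \<rho>" by simp
      also have "\<dots> < fps_conv_radius G" using \<rho> G by simp
      finally show "x \<in> eball 0 (fps_conv_radius G)" by (simp add: in_eball_iff)
    qed
    have "continuous_on (cball 0 \<rho>) (eval_fps G)"
      by (rule continuous_on_subset[OF continuous_on_eval_fps sub])
    then have "bounded (eval_fps G ` cball 0 \<rho>)"
      by (intro compact_imp_bounded compact_continuous_image) auto
    then obtain B where B: "B > 0" "\<forall>y\<in>eval_fps G ` cball 0 \<rho>. norm y \<le> B"
      unfolding bounded_pos by auto
    then show ?thesis using inv by (intro exI[of _ B]) auto
  qed
  have "\<exists>p B. p holomorphic_on UNIV \<and> B \<ge> 0 \<and> (\<forall>z. norm z \<ge> R \<longrightarrow> norm (g z - (p z + c * (1 / (z - 0)))) \<le> B / norm z ^ 2)"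
  proof (cases "d + 1 \<ge> 0")
    case False
    obtain B where B: "B \<ge> 0" "\<And>z. norm z \<ge> R \<Longrightarrow> norm (eval_fps F (inverse z)) \<le> B"
      using bnd[of F] by auto
    have "norm (g z) \<le> B / norm z ^ 2" if z: "norm z \<ge> R" for z
    proof -
      have "norm z \<ge> 1" using z R by simp
      have "norm z powi d \<le> norm z powi (-2)"
        using False \<open>norm z \<ge> 1\<close> by (intro power_int_increasing) auto
      also have "\<dots> = 1 / norm z ^ 2" by (simp add: power_int_def field_simps)
      finally have "norm z powi d \<le> 1 / norm z ^ 2" .
      moreover have "norm (g z) = norm z powi d * norm (eval_fps F (inverse z))"
        using R0[of z] z R by (simp add: norm_mult norm_power_int)
      ultimately show ?thesis
        using B(2)[OF z] mult_mono[of "norm z powi d" "1 / norm z ^ 2" "norm (eval_fps F (inverse z))" B] by simp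
    qed
    then show ?thesis using False B(1) by (intro exI[of _ "\<lambda>_. 0"] exI[of _ B]) (auto simp: c_def)
  next
    case True
    define e where "e = nat (d + 1)"
    have d: "d = int e - 1" using True by (simp add: e_def)
    have c: "c = fps_nth F e" using True by (simp add: c_def e_def)
    obtain B where B: "B \<ge> 0" "\<And>z. norm z \<ge> R \<Longrightarrow> norm (eval_fps (fps_shift (Suc e) F) (inverse z)) \<le> B"
      using bnd[of "fps_shift (Suc e) F"] by auto
    define p where "p z = (\<Sum>s<e. fps_nth F s * z ^ (e - 1 - s))" for z
    have "norm (g z - (p z + c * (1 / (z - 0)))) \<le> B / norm z ^ 2" if z: "norm z \<ge> R" for z
    proof -
      have z1: "norm z \<ge> 1" using z R by simp
      then have z0: "z \<noteq> 0" by auto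
      have pw: "z powi d * inverse z ^ s = z powi (d - int s)" for s
        using z0 by (simp add: power_int_diff power_inverse divide_inverse)
      have "ereal (norm (inverse z)) \<le> ereal \<rho>" using inv[OF z] by simp
      also have "\<dots> < fps_conv_radius F" by (rule \<rho>)
      finally have "eval_fps F (inverse z) = (\<Sum>s<Suc e. fps_nth F s * inverse z ^ s)
           + inverse z ^ Suc e * eval_fps (fps_shift (Suc e) F) (inverse z)" by (rule eval_fps_split)
      then have "g z = (\<Sum>s<Suc e. fps_nth F s * (z powi d * inverse z ^ s)) + (z powi d * inverse z ^ Suc e) * eval_fps (fps_shift (Suc e) F) (inverse z)"
        using R0[of z] z R by (simp add: algebra_simps sum_distrib_left del: power_Suc)
      also have "(\<Sum>s<Suc e. fps_nth F s * (z powi d * inverse z ^ s)) = p z + c * (1 / (z - 0))"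
      proof -
        have "(\<Sum>s<e. fps_nth F s * z powi (d - int s)) = p z" unfolding p_def
        proof (rule sum.cong[OF refl])
          fix s assume "s \<in> {..<e}"
          then have "d - int s = int (e - 1 - s)" by (auto simp: d)
          then show "fps_nth F s * z powi (d - int s) = fps_nth F s * z ^ (e - 1 - s)"
            by (simp only: power_int_of_nat)
        qed
        then show ?thesis unfolding pw by (simp add: c d power_int_minus divide_inverse)
      qed
      also have "z powi d * inverse z ^ Suc e = inverse z ^ 2"
        unfolding pw by (simp add: d power_int_minus power_inverse)
      finally have "g z - (p z + c * (1 / (z - 0))) = inverse z ^ 2 * eval_fps (fps_shift (Suc e) F) (inverse z)"
        by simp
      also have "norm \<dots> = norm (eval_fps (fps_shift (Suc e) F) (inverse z)) / norm z ^ 2"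
        by (simp add: norm_mult norm_power norm_inverse divide_inverse power_inverse)
      also have "\<dots> \<le> B / norm z ^ 2" by (rule divide_right_mono[OF B(2)[OF z]]) simp
      finally show ?thesis .
    qed
    moreover have "p holomorphic_on UNIV" unfolding p_def by (intro holomorphic_intros)
    ultimately show ?thesis using B(1) by (intro exI[of _ p] exI[of _ B]) auto
  qed
  then obtain p B where p: "p holomorphic_on UNIV" and B: "B \<ge> 0"
    and est: "\<And>z. norm z \<ge> R \<Longrightarrow> norm (g z - (p z + c * (1 / (z - 0)))) \<le> B / norm z ^ 2" by blast
  let ?I = "contour_integral \<gamma> g"
  have le: "norm (?I - 2 * of_real pi * \<i> * c) \<le> 2 * pi * B / r" if r: "r \<ge> R" for r
  proof -
    have r0: "r > 0" and Pr: "P \<subseteq> ball 0 r" using r R R1 by auto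
    have eq: "?I = contour_integral (circlepath 0 r) g"
      by (rule contour_integral_eq_circlepath[OF \<gamma> P wn g r0 Pr])
    have "g contour_integrable_on circlepath 0 r" by (rule contour_integrable_holomorphic_simple[OF g])
        (use P Pr r0 in \<open>auto simp: finite_imp_closed subset_iff\<close>)
    then have hg: "(g has_contour_integral ?I) (circlepath 0 r)"
      using eq by (simp add: has_contour_integral_integral)
    have hp: "(p has_contour_integral 0) (circlepath 0 r)"
      by (rule Cauchy_theorem_convex_simple[OF p]) auto
    have hc: "((\<lambda>z. c * (1 / (z - 0))) has_contour_integral (c * (2 * of_real pi * \<i>))) (circlepath 0 r)"
      using Cauchy_integral_circlepath_simple[of "\<lambda>_. c" 0 r 0] r0 by (simp add: mult_ac)
    have "((\<lambda>z. g z - (p z + c * (1 / (z - 0)))) has_contour_integral (?I - (0 + c * (2 * of_real pi * \<i>)))) (circlepath 0 r)"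
      by (intro has_contour_integral_diff has_contour_integral_add hg hp hc)
    then have "norm (?I - (0 + c * (2 * of_real pi * \<i>))) \<le> (B / r\<^sup>2) * (2 * pi * r)"
      by (rule has_contour_integral_bound_circlepath) (use r0 B est r in auto)
    also have "(B / r\<^sup>2) * (2 * pi * r) = 2 * pi * B / r" using r0 by (simp add: power2_eq_square)
    finally show ?thesis by (simp add: mult_ac)
  qed
  have "norm (?I - 2 * of_real pi * \<i> * c) \<le> 0"
  proof (rule tendsto_lowerbound)
    show "((\<lambda>r. 2 * pi * B / r) \<longlongrightarrow> 0) at_top"
      by (intro tendsto_divide_0[OF tendsto_const] filterlim_at_top_imp_at_infinity filterlim_ident)
    show "eventually (\<lambda>r. norm (?I - 2 * of_real pi * \<i> * c) \<le> 2 * pi * B / r) at_top"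
      using eventually_ge_at_top[of R] by eventually_elim (rule le)
  qed auto
  then show ?thesis by (simp add: c_def)
qed

section \<open>Cauchy's theorem in the slit plane and nested contours\<close>

text \<open>The slit plane is star-shaped, so every closed path in it is admissible.\<close>

lemma contour_integral_slit_plane_eq_0:
  assumes "f holomorphic_on - \<real>\<^sub>\<le>\<^sub>0" "valid_path \<gamma>" "pathfinish \<gamma> = pathstart \<gamma>" "path_image \<gamma> \<inter> \<real>\<^sub>\<le>\<^sub>0 = {}"
  shows "(f has_contour_integral 0) \<gamma>"
proof (rule Cauchy_theorem_starlike_simple)
  have "(\<real>\<^sub>\<le>\<^sub>0 :: complex set) = of_real ` {..0}" by (auto simp: nonpos_Reals_def)
  then show "starlike (- \<real>\<^sub>\<le>\<^sub>0 :: complex set)"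
    using starlike_slotted_complex_plane_left[of 0] by simp
qed (use assms in \<open>auto simp: open_Compl\<close>)

lemma pos_contour_around_closed:
  "pos_contour_around \<gamma> A \<Longrightarrow> valid_path \<gamma>" "pos_contour_around \<gamma> A \<Longrightarrow> pathfinish \<gamma> = pathstart \<gamma>"
  by (auto simp: pos_contour_around_def)

lemma pos_contour_around_winding:
  assumes "pos_contour_around \<gamma> A" "p \<in> A"
  shows "winding_number \<gamma> p = 1" "p \<notin> path_image \<gamma>"
  using assms inside_no_overlap[of "path_image \<gamma>"] unfolding pos_contour_around_def by blast+

text \<open>The outer contour is given as surrounding 0 and the image of the inner one, but it has
  to enclose the pole at 1 as well. If a point inside the inner curve were not inside the outer one,
  the closed exterior of the outer curve would be a connected unbounded set through that point
  avoiding the inner curve.\<close>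

lemma pos_contour_around_nested:
  assumes 1: "pos_contour_around \<gamma>1 A" and 2: "pos_contour_around \<gamma>2 B" and sub: "path_image \<gamma>1 \<subseteq> B"
  shows "pos_contour_around \<gamma>2 (A \<union> B)"
proof -
  let ?S = "path_image \<gamma>1" and ?T = "path_image \<gamma>2"
  have in2: "?S \<subseteq> inside ?T" using 2 sub by (auto simp: pos_contour_around_def)
  have J: "inside ?T \<inter> outside ?T = {}" "connected (outside ?T)" "\<not> bounded (outside ?T)" "frontier (outside ?T) = ?T"
    and un: "inside ?T \<union> outside ?T = - ?T"
    using Jordan_inside_outside[of \<gamma>2] 2 by (auto simp: pos_contour_around_def)
  have cl: "closure (outside ?T) = outside ?T \<union> ?T"
    using closure_Un_frontier[of "outside ?T"] J(4) by simp
  have "inside ?S \<subseteq> inside ?T"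
  proof
    fix p assume p: "p \<in> inside ?S"
    show "p \<in> inside ?T"
    proof (rule ccontr)
      assume "p \<notin> inside ?T"
      with un have pC: "p \<in> closure (outside ?T)" unfolding cl by blast
      have "closure (outside ?T) \<subseteq> connected_component_set (- ?S) p"
      proof (rule connected_component_maximal[OF pC])
        show "connected (closure (outside ?T))" using J(2) by (rule connected_imp_connected_closure)
        show "closure (outside ?T) \<subseteq> - ?S"
          using J(1) in2 inside_no_overlap[of ?T] unfolding cl by blast
      qed
      then have "\<not> bounded (connected_component_set (- ?S) p)"
        using J closure_subset bounded_subset by metis
      then show False using p by (simp add: inside_def)
    qed
  qed
  then show ?thesis using 1 2 by (auto simp: pos_contour_around_def)
qed


section \<open>Matrix symbols as formal power series\<close>

lemma mat_2_eqI:
  assumes "A \<in> mats2" "B \<in> mats2"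
    and "A $$ (0, 0) = B $$ (0, 0)" "A $$ (0, Suc 0) = B $$ (0, Suc 0)"
    and "A $$ (Suc 0, 0) = B $$ (Suc 0, 0)" "A $$ (Suc 0, Suc 0) = B $$ (Suc 0, Suc 0)"
  shows "A = B"
proof (rule eq_matI)
  fix i j assume "i < dim_row B" "j < dim_col B"
  then have "i \<in> {0, Suc 0}" "j \<in> {0, Suc 0}" using assms(2) by auto
  then show "A $$ (i, j) = B $$ (i, j)" using assms by auto
qed (use assms in auto)

lemma mat_2_mult_index:
  assumes "A \<in> mats2" "B \<in> mats2" "i < 2" "j < 2"
  shows "(A * B) $$ (i, j) = A $$ (i, 0) * B $$ (0, j) + A $$ (i, Suc 0) * B $$ (Suc 0, j)"
  using assms by (simp add: scalar_prod_def numeral_2_eq_2)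

lemma mat_of_rows_list_2_mult:
  "mat_of_rows_list 2 [[a, b], [c, d]] * mat_of_rows_list 2 [[a', b'], [c', d']] =
   mat_of_rows_list 2 [[a * a' + b * c', a * b' + b * d'], [c * a' + d * c', c * b' + d * d']]"
  by (rule mat_2_eqI) (auto simp: mat_2_mult_index simp del: index_mult_mat(1))

lemma mat_of_rows_list_2_smult:
  "k \<cdot>\<^sub>m mat_of_rows_list 2 [[a, b], [c, d]] = mat_of_rows_list 2 [[k * a, k * b], [k * c, k * d]]"
  by (rule mat_2_eqI) auto

lemma mat_of_rows_list_2_one: "1\<^sub>m 2 = mat_of_rows_list 2 [[1, 0], [0, 1]]"
  by (rule mat_2_eqI) auto

lemma map_mat_of_rows_list_2:
  "map_mat f (mat_of_rows_list 2 [[a, b], [c, d]]) = mat_of_rows_list 2 [[f a, f b], [f c, f d]]"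
  by (rule mat_2_eqI) auto

lemma of_real_squares_mult:
  assumes "\<alpha> * \<beta> = 1"
  shows "complex_of_real (\<alpha>\<^sup>2) * complex_of_real (\<beta>\<^sup>2) = 1"
proof -
  have "complex_of_real (\<alpha>\<^sup>2) * of_real (\<beta>\<^sup>2) = of_real ((\<alpha> * \<beta>)\<^sup>2)" by (simp add: power_mult_distrib)
  then show ?thesis using assms by simp
qed

text \<open>Here \<open>x = 1/z\<close>. The ring is left open because the same identities are used
  for complex numbers, polynomials and power series.\<close>

definition block :: "'a \<Rightarrow> 'a \<Rightarrow> 'a \<Rightarrow> 'a :: comm_ring_1 mat" where
  "block a b x = mat_of_rows_list 2 [[1, a * x], [b, 1]]"

definition A2B2 :: "'a \<Rightarrow> 'a \<Rightarrow> 'a \<Rightarrow> 'a :: comm_ring_1 mat" where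
  "A2B2 a b x = mat_of_rows_list 2 [[(1 + x)\<^sup>2 + 4 * a * x, 2 * (1 + a) * x * (1 + x)],
     [2 * (1 + b) * (1 + x), (1 + x)\<^sup>2 + 4 * b * x]]"

text \<open>The adjugate of \<open>A2B2\<close>; it stands in for the inverse over polynomials,
  where \<open>1 - x\<close> is no unit.\<close>

definition adjA2B2 :: "'a \<Rightarrow> 'a \<Rightarrow> 'a \<Rightarrow> 'a :: comm_ring_1 mat" where
  "adjA2B2 a b x = mat_of_rows_list 2 [[(1 + x)\<^sup>2 + 4 * b * x, - (2 * (1 + a) * x * (1 + x))],
     [- (2 * (1 + b) * (1 + x)), (1 + x)\<^sup>2 + 4 * a * x]]"

lemma block_carrier [simp]: "block a b x \<in> mats2"
  and A2B2_carrier [simp]: "A2B2 a b x \<in> mats2"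
  and adjA2B2_carrier [simp]: "adjA2B2 a b x \<in> mats2"
  by (simp_all add: block_def A2B2_def adjA2B2_def)

lemma block_squares:
  assumes "a * b = 1"
  shows "block a b x * block a b x * (block 1 1 x * block 1 1 x) = A2B2 a b x"
proof -
  have ab: "a * (b * y) = y" for y using assms by (metis mult.assoc mult_1)
  have "block a b x * block a b x = mat_of_rows_list 2 [[1 + x, 2 * a * x], [2 * b, 1 + x]]"
    using assms unfolding block_def mat_of_rows_list_2_mult
    by (intro mat_2_eqI) (auto simp: algebra_simps ab)
  moreover have "block 1 1 x * block 1 1 x = mat_of_rows_list 2 [[1 + x, 2 * x], [2, 1 + x]]"
    unfolding block_def mat_of_rows_list_2_mult by (intro mat_2_eqI) (auto simp: algebra_simps)
  moreover have "mat_of_rows_list 2 [[1 + x, 2 * a * x], [2 * b, 1 + x]] * mat_of_rows_list 2 [[1 + x, 2 * x], [2, 1 + x]]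
     = A2B2 a b x" unfolding A2B2_def mat_of_rows_list_2_mult
    by (intro mat_2_eqI) (auto simp: algebra_simps power2_eq_square)
  ultimately show ?thesis by simp
qed

text \<open>Each of the four blocks multiplied in \<open>A2B2\<close> has determinant
  \<open>1 - x\<close> when \<open>a * b = 1\<close>, so their product has determinant
  \<open>(1 - x) ^ 4\<close>.\<close>

lemma adjA2B2_A2B2:
  assumes "a * b = 1"
  shows "adjA2B2 a b x * A2B2 a b x = (1 - x) ^ 4 \<cdot>\<^sub>m 1\<^sub>m 2" "A2B2 a b x * adjA2B2 a b x = (1 - x) ^ 4 \<cdot>\<^sub>m 1\<^sub>m 2"
proof -
  have ab: "a * (b * y) = y" for y using assms by (metis mult.assoc mult_1)
  have 1: "((1 + x)\<^sup>2 + 4 * a * x) * ((1 + x)\<^sup>2 + 4 * b * x) - (2 * (1 + a) * x * (1 + x)) * (2 * (1 + b) * (1 + x)) = (1 - x) ^ 4"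
    using assms by (simp add: algebra_simps power2_eq_square power4_eq_xxxx ab)
  show "adjA2B2 a b x * A2B2 a b x = (1 - x) ^ 4 \<cdot>\<^sub>m 1\<^sub>m 2" "A2B2 a b x * adjA2B2 a b x = (1 - x) ^ 4 \<cdot>\<^sub>m 1\<^sub>m 2"
    unfolding A2B2_def adjA2B2_def mat_of_rows_list_2_mult mat_of_rows_list_2_one mat_of_rows_list_2_smult
    by (intro mat_2_eqI; simp add: 1[symmetric] mult_ac)+
qed

context comm_ring_hom
begin

lemma map_A2B2: "map_mat hom (A2B2 a b x) = A2B2 (hom a) (hom b) (hom x)"
  by (simp add: A2B2_def map_mat_of_rows_list_2 hom_distribs)

lemma map_adjA2B2: "map_mat hom (adjA2B2 a b x) = adjA2B2 (hom a) (hom b) (hom x)"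
  by (simp add: adjA2B2_def map_mat_of_rows_list_2 hom_distribs)

end

lemma smult_pow_mat:
  fixes A :: "'a :: comm_ring_1 mat"
  assumes "A \<in> carrier_mat k k"
  shows "(c \<cdot>\<^sub>m A) ^\<^sub>m p = c ^ p \<cdot>\<^sub>m (A ^\<^sub>m p)"
proof (induction p)
  case 0
  then show ?case using assms by (auto intro!: eq_matI)
next
  case (Suc p)
  then show ?case
    using assms by (simp add: mult_smult_assoc_mat[of _ k k _ k] mult_smult_distrib[of _ k k _ k] pow_carrier_mat)
      (auto intro!: eq_matI)
qed

lemma commuting_pow_mat:
  fixes A :: "'a :: comm_ring_1 mat"
  assumes A: "A \<in> carrier_mat k k" and B: "B \<in> carrier_mat k k" and AB: "A * B = B * A"
  shows "A ^\<^sub>m p * B = B * A ^\<^sub>m p"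
proof (induction p)
  case 0
  then show ?case using A B by simp
next
  case (Suc p)
  have P: "A ^\<^sub>m p \<in> carrier_mat k k" using A by (rule pow_carrier_mat)
  have "A ^\<^sub>m Suc p * B = A ^\<^sub>m p * (A * B)" using assoc_mult_mat[OF P A B] by simp
  also have "\<dots> = A ^\<^sub>m p * B * A" using assoc_mult_mat[OF P B A] AB by simp
  also have "\<dots> = B * (A ^\<^sub>m p * A)" using assoc_mult_mat[OF B P A] Suc by simp
  finally show ?case by simp
qed

text \<open>Cancellation between powers of two matrices that are inverse up to the scalar
  \<open>c\<close>. No division by \<open>c\<close> occurs, so it applies over every commutative
  ring in use.\<close>

lemma pow_mat_mult_inverse:
  fixes A :: "'a :: comm_ring_1 mat"
  assumes A: "A \<in> carrier_mat k k" and B: "B \<in> carrier_mat k k"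
    and AB: "A * B = c \<cdot>\<^sub>m 1\<^sub>m k" and BA: "B * A = c \<cdot>\<^sub>m 1\<^sub>m k"
  shows "B ^\<^sub>m p * A ^\<^sub>m (p + q) = c ^ p \<cdot>\<^sub>m A ^\<^sub>m q" "B ^\<^sub>m (p + q) * A ^\<^sub>m p = c ^ p \<cdot>\<^sub>m B ^\<^sub>m q"
proof -
  have main: "Y ^\<^sub>m p * X ^\<^sub>m p = c ^ p \<cdot>\<^sub>m 1\<^sub>m k"
    if X: "X \<in> carrier_mat k k" and Y: "Y \<in> carrier_mat k k" and YX: "Y * X = c \<cdot>\<^sub>m 1\<^sub>m k"
      and comm: "X * Y = Y * X" for X Y :: "'a mat" and p
  proof (induction p)
    case 0
    then show ?case using X Y by (auto intro!: eq_matI)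
  next
    case (Suc p)
    have Xp: "X ^\<^sub>m p \<in> carrier_mat k k" and Yp: "Y ^\<^sub>m p \<in> carrier_mat k k"
      using X Y by (auto intro: pow_carrier_mat)
    have "Y ^\<^sub>m Suc p * X ^\<^sub>m Suc p = Y ^\<^sub>m p * (Y * (X ^\<^sub>m p * X))"
      using assoc_mult_mat[OF Yp Y mult_carrier_mat[OF Xp X]] by simp
    also have "Y * (X ^\<^sub>m p * X) = (X ^\<^sub>m p * Y) * X"
      using commuting_pow_mat[OF X Y comm] assoc_mult_mat[OF Y Xp X] by simp
    also have "\<dots> = c \<cdot>\<^sub>m X ^\<^sub>m p"
      using assoc_mult_mat[OF Xp Y X] YX Xp right_mult_one_mat[OF Xp] by (simp add: mult_smult_distrib[of _ k k _ k])
    also have "Y ^\<^sub>m p * (c \<cdot>\<^sub>m X ^\<^sub>m p) = c \<cdot>\<^sub>m (Y ^\<^sub>m p * X ^\<^sub>m p)"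
      using mult_smult_distrib[OF Yp Xp] .
    finally show ?case using Suc by (auto intro!: eq_matI)
  qed
  have [simp]: "A ^\<^sub>m p \<in> carrier_mat k k" "B ^\<^sub>m p \<in> carrier_mat k k" for p
    using A B by (auto intro: pow_carrier_mat)
  have add: "X ^\<^sub>m (p + q) = X ^\<^sub>m p * X ^\<^sub>m q" if "X \<in> carrier_mat k k" for X :: "'a mat" and p q
  proof (induction q)
    case 0
    then show ?case using that right_mult_one_mat[OF pow_carrier_mat[OF that, of p]] by simp
  next
    case (Suc q)
    then show ?case
      using assoc_mult_mat[OF pow_carrier_mat[OF that, of p] pow_carrier_mat[OF that, of q] that] by simp
  qed
  have comm: "X ^\<^sub>m p * X ^\<^sub>m q = X ^\<^sub>m q * X ^\<^sub>m p" if "X \<in> carrier_mat k k" for X :: "'a mat" and p q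
    using add[OF that, of p q] add[OF that, of q p] by (simp add: add.commute)
  have m: "B ^\<^sub>m p * A ^\<^sub>m p = c ^ p \<cdot>\<^sub>m 1\<^sub>m k" by (rule main) (use assms in auto)
  have "B ^\<^sub>m p * A ^\<^sub>m (p + q) = (B ^\<^sub>m p * A ^\<^sub>m p) * A ^\<^sub>m q"
    using A by (simp add: add[OF A] assoc_mult_mat[of _ k k _ k _ k])
  also have "\<dots> = c ^ p \<cdot>\<^sub>m A ^\<^sub>m q"
    unfolding m by (subst mult_smult_assoc_mat[of _ k k _ k]) (auto simp: left_mult_one_mat[of _ k k])
  finally show "B ^\<^sub>m p * A ^\<^sub>m (p + q) = c ^ p \<cdot>\<^sub>m A ^\<^sub>m q" .
  have "B ^\<^sub>m (p + q) * A ^\<^sub>m p = B ^\<^sub>m q * (B ^\<^sub>m p * A ^\<^sub>m p)"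
    using B by (simp add: add[OF B] comm[OF B, of p q] assoc_mult_mat[of _ k k _ k _ k])
  also have "\<dots> = c ^ p \<cdot>\<^sub>m B ^\<^sub>m q"
    unfolding m by (subst mult_smult_distrib[of _ k k _ k]) (auto simp: right_mult_one_mat[of _ k k])
  finally show "B ^\<^sub>m (p + q) * A ^\<^sub>m p = c ^ p \<cdot>\<^sub>m B ^\<^sub>m q" .
qed

section \<open>Block Toeplitz matrices of power series\<close>

definition geo :: "complex fps" where "geo = Abs_fps (\<lambda>_. 1)"

lemma geo_inverse: "geo * (1 - fps_X) = 1"
  by (rule fps_ext) (simp add: geo_def right_diff_distrib fps_X_mult_right_nth)

text \<open>The symbol is a power series in \<open>x = 1/z\<close>, so the coefficient index is
  start block minus end block, opposite in sign to \<open>block_toeplitz\<close>.\<close>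

definition toeplitz :: "complex fps mat \<Rightarrow> int \<Rightarrow> int \<Rightarrow> complex" where
  "toeplitz F u v = (if v div 2 \<le> u div 2
     then fps_nth (F $$ (nat (u mod 2), nat (v mod 2))) (nat (u div 2 - v div 2)) else 0)"

context
  fixes \<alpha> \<beta> :: real
begin

definition step_fps :: "nat \<Rightarrow> complex fps mat" where
  "step_fps m = (if odd m then 1 else geo) \<cdot>\<^sub>m
     block (if m mod 4 \<in> {1, 2} then fps_const (of_real (\<alpha>\<^sup>2)) else 1)
            (if m mod 4 \<in> {1, 2} then fps_const (of_real (\<beta>\<^sup>2)) else 1) fps_X"

lemma toeplitz_step: "toeplitz (step_fps m) u v = of_real (step \<alpha> \<beta> m u v)"
proof -
  have geo: "fps_nth (geo * (c * fps_X)) k = (if k = 0 then 0 else fps_nth (geo * c) (k - 1))" for c k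
    by (simp add: mult.assoc[symmetric] fps_X_mult_right_nth)
  have geo1: "fps_nth geo k = 1" for k by (simp add: geo_def)
  show ?thesis by (cases u rule: int_parity_cases; cases v rule: int_parity_cases)
      (auto simp: toeplitz_def step_fps_def step_def hop_def jump_def block_def mat_of_rows_list_2_smult
         geo geo1 fps_X_mult_right_nth nat_eq_iff, (presburger+)?)
qed

lemma sum_even_odd_interval:
  fixes L U :: int
  shows "(\<Sum>w\<in>{2 * L..<2 * U}. f w) = (\<Sum>y\<in>{L..<U}. f (2 * y) + f (2 * y + 1))"
proof -
  have "(\<Sum>w\<in>{2 * L..<2 * U}. f w) = (\<Sum>(y, s)\<in>{L..<U} \<times> {0, 1}. f (2 * y + s))"
    by (rule sum.reindex_bij_witness[where i = "\<lambda>(y, s). 2 * y + s" and j = "\<lambda>w. (w div 2, w mod 2)"]) auto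
  also have "\<dots> = (\<Sum>y\<in>{L..<U}. f (2 * y) + f (2 * y + 1))"
    by (subst sum.cartesian_product[symmetric]) simp
  finally show ?thesis .
qed

text \<open>Both factors are block triangular: an intermediate block with a nonzero term lies
  between those of \<open>v\<close> and \<open>u\<close>, hence in the window. The restricted sum is
  therefore the whole Cauchy product.\<close>

lemma toeplitz_mult:
  assumes F: "F \<in> mats2" and G: "G \<in> mats2"
    and u: "u \<in> {2 * L..<2 * U}" and v: "v \<in> {2 * L..<2 * U}"
  shows "(\<Sum>w\<in>{2 * L..<2 * U}. toeplitz F u w * toeplitz G w v) = toeplitz (F * G) u v"
proof -
  define x y r s where "x = u div 2" and "y = v div 2" and "r = nat (u mod 2)" and "s = nat (v mod 2)"
  have rs: "r < 2" "s < 2" by (auto simp: r_def s_def nat_less_iff)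
  have xy: "L \<le> x" "x < U" "L \<le> y" "y < U" using u v by (auto simp: x_def y_def)
  let ?t = "\<lambda>w q. (if w \<le> x then fps_nth (F $$ (r, q)) (nat (x - w)) else 0)
       * (if y \<le> w then fps_nth (G $$ (q, s)) (nat (w - y)) else 0)"
  have "(\<Sum>w\<in>{2 * L..<2 * U}. toeplitz F u w * toeplitz G w v) = (\<Sum>w\<in>{L..<U}. ?t w 0 + ?t w 1)"
    unfolding sum_even_odd_interval by (simp add: toeplitz_def x_def y_def r_def s_def cong: if_cong)
  also have "\<dots> = (\<Sum>w\<in>{y..x}. ?t w 0 + ?t w 1)"
    by (rule sum.mono_neutral_right) (use xy in auto)
  also have "\<dots> = toeplitz (F * G) u v"
  proof (cases "y \<le> x")
    case False
    then show ?thesis by (simp add: toeplitz_def x_def y_def)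
  next
    case True
    define D where "D = nat (x - y)"
    have "(\<Sum>w\<in>{y..x}. ?t w 0 + ?t w 1) = (\<Sum>i = 0..D. fps_nth (F $$ (r, 0)) i * fps_nth (G $$ (0, s)) (D - i)
        + fps_nth (F $$ (r, 1)) i * fps_nth (G $$ (1, s)) (D - i))"
      by (rule sum.reindex_bij_witness[where i = "\<lambda>i. x - int i" and j = "\<lambda>w. nat (x - w)"])
        (use True in \<open>auto simp: D_def nat_diff_distrib' intro!: arg_cong2[where f = plus] arg_cong2[where f = times] arg_cong2[where f = fps_nth]\<close>)
    also have "\<dots> = fps_nth ((F * G) $$ (r, s)) D"
      using F G rs by (simp add: mat_2_mult_index fps_mult_nth sum.distrib del: index_mult_mat(1))
    finally show ?thesis using True by (simp add: toeplitz_def x_def y_def r_def s_def D_def)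
  qed
  finally show ?thesis .
qed

lemma toeplitz_one: "toeplitz (1\<^sub>m 2) u v = of_bool (u = v)"
  by (cases u rule: int_parity_cases; cases v rule: int_parity_cases)
    (auto simp: toeplitz_def, (presburger+)?)

fun step_fps_prod :: "nat \<Rightarrow> nat \<Rightarrow> complex fps mat" where
  "step_fps_prod a 0 = 1\<^sub>m 2"
| "step_fps_prod a (Suc d) = step_fps_prod a d * step_fps (a + Suc d)"

lemma step_fps_carrier [simp]: "step_fps m \<in> mats2" by (simp add: step_fps_def)

lemma step_fps_prod_carrier [simp]: "step_fps_prod a d \<in> mats2"
  by (induction d) (auto intro!: mult_carrier_mat[of _ 2 2])

lemma path_sum_toeplitz:
  assumes "u \<in> {2 * L..<2 * U}" "v \<in> {2 * L..<2 * U}"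
  shows "path_sum {2 * L..<2 * U} (\<lambda>m u v. of_real (step \<alpha> \<beta> m u v)) a d u v = toeplitz (step_fps_prod a d) u v"
  using assms(2)
proof (induction d arbitrary: v)
  case 0
  then show ?case by (simp add: toeplitz_one)
next
  case (Suc d)
  have "path_sum {2 * L..<2 * U} (\<lambda>m u v. of_real (step \<alpha> \<beta> m u v)) a (Suc d) u v
    = (\<Sum>w\<in>{2 * L..<2 * U}. toeplitz (step_fps_prod a d) u w * toeplitz (step_fps (a + Suc d)) w v)"
    using Suc.IH by (simp add: toeplitz_step)
  also have "\<dots> = toeplitz (step_fps_prod a (Suc d)) u v"
    using toeplitz_mult[OF step_fps_prod_carrier step_fps_carrier assms(1) Suc.prems] by simp
  finally show ?case .
qed

definition Phi_fps :: "complex fps mat" where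
  "Phi_fps = geo\<^sup>2 \<cdot>\<^sub>m A2B2 (fps_const (of_real (\<alpha>\<^sup>2))) (fps_const (of_real (\<beta>\<^sup>2))) fps_X"

lemma Phi_fps_carrier [simp]: "Phi_fps \<in> mats2"
  and Phi_fps_dim [simp]: "dim_row (Phi_fps) = 2" "dim_col (Phi_fps) = 2"
  by (simp_all add: Phi_fps_def A2B2_def)

lemma smult_mult_mat_2:
  fixes A :: "'a :: comm_ring_1 mat"
  assumes "A \<in> mats2" "B \<in> mats2"
  shows "(c \<cdot>\<^sub>m A) * (d \<cdot>\<^sub>m B) = (c * d) \<cdot>\<^sub>m (A * B)"
  using assms by (simp add: mult_smult_assoc_mat[of _ 2 2 _ 2] mult_smult_distrib[of _ 2 2 _ 2])
    (auto intro!: eq_matI simp: mult_ac)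

text \<open>From a multiple of 4 on, the steps come in the order A, A, B, B, with the scalar
  \<open>geo\<close> in the second and the fourth; the scalars collect to
  \<open>geo\<^sup>2\<close>.\<close>

lemma step_fps_prod_4:
  assumes "\<alpha> * \<beta> = 1"
  shows "step_fps_prod (4 * m) (4 * d) = Phi_fps ^\<^sub>m d"
proof (induction d)
  case 0
  then show ?case by simp
next
  case (Suc d)
  let ?P = "Phi_fps ^\<^sub>m d"
  define a b where "a = fps_const (complex_of_real (\<alpha>\<^sup>2))" and "b = fps_const (complex_of_real (\<beta>\<^sup>2))"
  let ?A = "block a b fps_X" and ?B = "block 1 1 fps_X :: complex fps mat"
  have ab: "a * b = 1" unfolding a_def b_def fps_const_mult of_real_squares_mult[OF assms] by simp
  have P: "?P \<in> mats2" by (rule pow_carrier_mat) simp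
  have mod4: "(4 * m + (4 * d + 1)) mod 4 = 1" "(4 * m + (4 * d + 2)) mod 4 = 2"
     "(4 * m + (4 * d + 3)) mod 4 = 3" "(4 * m + (4 * d + 4)) mod 4 = 0" by presburger+
  have s: "step_fps (4 * m + (4 * d + 1)) = 1 \<cdot>\<^sub>m ?A" "step_fps (4 * m + (4 * d + 2)) = geo \<cdot>\<^sub>m ?A"
    "step_fps (4 * m + (4 * d + 3)) = 1 \<cdot>\<^sub>m ?B" "step_fps (4 * m + (4 * d + 4)) = geo \<cdot>\<^sub>m ?B"
    unfolding step_fps_def mod4 by (auto simp: a_def b_def)
  have eq: "4 * Suc d = Suc (Suc (Suc (Suc (4 * d))))" by simp
  have "step_fps_prod (4 * m) (4 * Suc d) = ?P * step_fps (4 * m + (4 * d + 1)) * step_fps (4 * m + (4 * d + 2))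
      * step_fps (4 * m + (4 * d + 3)) * step_fps (4 * m + (4 * d + 4))"
    unfolding eq step_fps_prod.simps Suc by (simp add: numeral_eq_Suc)
  also have "\<dots> = ?P * (((1 \<cdot>\<^sub>m ?A) * (geo \<cdot>\<^sub>m ?A)) * ((1 \<cdot>\<^sub>m ?B) * (geo \<cdot>\<^sub>m ?B)))"
    unfolding s using P by (simp add: assoc_mult_mat[of _ 2 2 _ 2 _ 2] mult_carrier_mat[of _ 2 2])
  also have "((1 \<cdot>\<^sub>m ?A) * (geo \<cdot>\<^sub>m ?A)) * ((1 \<cdot>\<^sub>m ?B) * (geo \<cdot>\<^sub>m ?B)) = geo\<^sup>2 \<cdot>\<^sub>m (?A * ?A * (?B * ?B))"
    by (subst smult_mult_mat_2 | simp add: mult_carrier_mat[of _ 2 2] power2_eq_square)+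
  also have "?A * ?A * (?B * ?B) = A2B2 a b fps_X" by (rule block_squares[OF ab])
  also have "geo\<^sup>2 \<cdot>\<^sub>m A2B2 a b fps_X = Phi_fps" by (simp add: Phi_fps_def a_def b_def)
  finally show ?case by simp
qed

end

section \<open>Evaluating the symbols\<close>

lemma mat_inv_eqI:
  fixes A :: "'a :: field mat"
  assumes A: "A \<in> carrier_mat k k" and B: "B \<in> carrier_mat k k" and AB: "A * B = 1\<^sub>m k" and BA: "B * A = 1\<^sub>m k"
  shows "mat_inv A = B"
proof (cases "mat_inverse A")
  case None
  have "A \<in> Units (ring_mat TYPE('a) k ())"
    unfolding Units_def ring_mat_simps mem_Collect_eq using A B AB BA by blast
  with mat_inverse(1)[OF A None, where b = "()"] show ?thesis by simp
next
  case (Some B')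
  with mat_inverse(2)[OF A Some] have B': "A * B' = 1\<^sub>m k" "B' \<in> carrier_mat k k" by auto
  have "B = B * (A * B')" using B B' by simp
  also have "\<dots> = B'" using assoc_mult_mat[OF B A B'(2)] BA B' by simp
  finally show ?thesis using Some by (simp add: mat_inv_def)
qed

lemma aztec_block_eq: "aztec_block a b z = block (of_real a) (of_real b) (inverse z)"
  by (simp add: aztec_block_def block_def)

lemma pow_mat_2: "A \<in> carrier_mat k k \<Longrightarrow> A ^\<^sub>m 2 = A * A"
  by (simp add: numeral_2_eq_2)

lemma aztec_Phi_eq:
  assumes "\<alpha> * \<beta> = 1"
  shows "aztec_Phi \<alpha> \<beta> z = (1 / (1 - inverse z)\<^sup>2) \<cdot>\<^sub>m A2B2 (of_real (\<alpha>\<^sup>2)) (of_real (\<beta>\<^sup>2)) (inverse z)"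
proof -
  show ?thesis unfolding aztec_Phi_def aztec_block_eq
    using block_squares[OF of_real_squares_mult[OF assms]] by (simp add: pow_mat_2[of _ 2])
qed

lemma aztec_Phi_carrier [simp]: "\<alpha> * \<beta> = 1 \<Longrightarrow> aztec_Phi \<alpha> \<beta> z \<in> mats2"
  by (simp add: aztec_Phi_eq)

lemma inverse_neq_1: "z \<noteq> 1 \<Longrightarrow> inverse z \<noteq> (1 :: complex)"
  by (metis inverse_1 inverse_inverse_eq)

text \<open>The determinant \<open>(1 - x) ^ 4\<close> of \<open>A2B2\<close> cancels against the
  prefactors \<open>1 / (1 - x) ^ 2\<close> of both matrices, so inversion keeps the prefactor and
  only passes to the adjugate.\<close>

lemma mat_inv_aztec_Phi:
  assumes ab: "\<alpha> * \<beta> = 1" and z: "z \<noteq> 1"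
  shows "mat_inv (aztec_Phi \<alpha> \<beta> z) = (1 / (1 - inverse z)\<^sup>2) \<cdot>\<^sub>m adjA2B2 (of_real (\<alpha>\<^sup>2)) (of_real (\<beta>\<^sup>2)) (inverse z)"
proof (rule mat_inv_eqI[where k = 2])
  let ?a = "complex_of_real (\<alpha>\<^sup>2)" and ?b = "complex_of_real (\<beta>\<^sup>2)" and ?x = "inverse z"
  note ab' = of_real_squares_mult[OF ab]
  have k: "1 / (1 - ?x)\<^sup>2 * (1 / (1 - ?x)\<^sup>2) * (1 - ?x) ^ 4 = 1"
  proof -
    have "1 / y\<^sup>2 * (1 / y\<^sup>2) * y ^ 4 = 1" if "y \<noteq> 0" for y :: complex
      using that by (simp add: field_simps power2_eq_square power4_eq_xxxx)
    then show ?thesis using inverse_neq_1[OF z] by simp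
  qed
  have *: "(c \<cdot>\<^sub>m A) * (c \<cdot>\<^sub>m B) = (c * c * d) \<cdot>\<^sub>m 1\<^sub>m 2"
    if "A * B = d \<cdot>\<^sub>m 1\<^sub>m 2" "A \<in> mats2" "B \<in> mats2" for A B :: "complex mat" and c d
    using that by (simp add: smult_mult_mat_2) (auto intro!: eq_matI)
  show "aztec_Phi \<alpha> \<beta> z * ((1 / (1 - ?x)\<^sup>2) \<cdot>\<^sub>m adjA2B2 ?a ?b ?x) = 1\<^sub>m 2"
    unfolding aztec_Phi_eq[OF ab] *[OF adjA2B2_A2B2(2)[OF ab'] A2B2_carrier adjA2B2_carrier] k
    by (auto intro!: eq_matI)
  show "((1 / (1 - ?x)\<^sup>2) \<cdot>\<^sub>m adjA2B2 ?a ?b ?x) * aztec_Phi \<alpha> \<beta> z = 1\<^sub>m 2"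
    unfolding aztec_Phi_eq[OF ab] *[OF adjA2B2_A2B2(1)[OF ab'] adjA2B2_carrier A2B2_carrier] k
    by (auto intro!: eq_matI)
qed (use ab in auto)

text \<open>For \<open>N = 2 * h\<close> the right side is the \<open>z\<close>-dependent matrix of
  the kernel together with \<open>(1 - 1/z) ^ N\<close>; the left side has no negative powers of a
  matrix. The two cases follow \<open>mat_powi\<close>, which switches to the inverse for negative
  exponents.\<close>

lemma adjA2B2_pow_aztec_Phi_pow:
  assumes ab: "\<alpha> * \<beta> = 1" and z: "z \<noteq> 1"
  shows "adjA2B2 (of_real (\<alpha>\<^sup>2)) (of_real (\<beta>\<^sup>2)) (inverse z) ^\<^sub>m h * aztec_Phi \<alpha> \<beta> z ^\<^sub>m m
    = (1 - inverse z) ^ (2 * h) \<cdot>\<^sub>m mat_powi (aztec_Phi \<alpha> \<beta> z) (int m - int h)"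
proof -
  let ?a = "complex_of_real (\<alpha>\<^sup>2)" and ?b = "complex_of_real (\<beta>\<^sup>2)" and ?x = "inverse z"
  let ?k = "1 / (1 - ?x)\<^sup>2" and ?C = "A2B2 ?a ?b ?x" and ?D = "adjA2B2 ?a ?b ?x"
  note ab' = of_real_squares_mult[OF ab]
  have ne: "1 - ?x \<noteq> 0" using inverse_neq_1[OF z] by simp
  have pc: "?C ^\<^sub>m p \<in> mats2" "?D ^\<^sub>m p \<in> mats2" for p
    by (auto intro: pow_carrier_mat)
  note inv = pow_mat_mult_inverse[OF A2B2_carrier adjA2B2_carrier adjA2B2_A2B2(2)[OF ab'] adjA2B2_A2B2(1)[OF ab']]
  have sm: "\<And>c d A. c \<cdot>\<^sub>m (d \<cdot>\<^sub>m A) = (c * d :: complex) \<cdot>\<^sub>m A" by (auto intro!: eq_matI)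
  have "?k * (1 - ?x) ^ 4 = (1 - ?x)\<^sup>2" using ne by (simp add: power2_eq_square power4_eq_xxxx)
  then have k1: "?k ^ p * ((1 - ?x) ^ 4) ^ p = (1 - ?x) ^ (2 * p)" for p
    by (simp only: power_mult_distrib[symmetric] power_mult)
  have k2: "(1 - ?x) ^ (2 * p) * ?k ^ p = 1" for p using ne by (simp add: power_mult power_one_over)
  have L: "?D ^\<^sub>m h * aztec_Phi \<alpha> \<beta> z ^\<^sub>m m = ?k ^ m \<cdot>\<^sub>m (?D ^\<^sub>m h * ?C ^\<^sub>m m)"
    unfolding aztec_Phi_eq[OF ab] smult_pow_mat[OF A2B2_carrier] mult_smult_distrib[OF pc(2) pc(1)] ..
  show ?thesis
  proof (cases "m \<ge> h")
    case True
    then obtain q where m: "m = h + q" by (metis le_Suc_ex)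
    have mp: "mat_powi (aztec_Phi \<alpha> \<beta> z) (int m - int h) = ?k ^ q \<cdot>\<^sub>m ?C ^\<^sub>m q"
      by (simp add: mat_powi_def m aztec_Phi_eq[OF ab] smult_pow_mat[of _ 2])
    have sc: "?k ^ m * ((1 - ?x) ^ 4) ^ h = (1 - ?x) ^ (2 * h) * ?k ^ q"
    proof -
      have "?k ^ m * ((1 - ?x) ^ 4) ^ h = (?k ^ h * ((1 - ?x) ^ 4) ^ h) * ?k ^ q"
        by (simp only: m power_add mult_ac)
      then show ?thesis by (simp only: k1)
    qed
    show ?thesis unfolding L mp by (simp only: m inv(1) sm sc[unfolded m])
  next
    case False
    then obtain q where h: "h = m + q" and q: "q > 0" by (metis less_imp_add_positive not_le)
    have mp: "mat_powi (aztec_Phi \<alpha> \<beta> z) (int m - int h) = ?k ^ q \<cdot>\<^sub>m ?D ^\<^sub>m q"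
      using q by (simp add: mat_powi_def h mat_inv_aztec_Phi[OF ab z] smult_pow_mat[of _ 2])
    have sc: "?k ^ m * ((1 - ?x) ^ 4) ^ m = (1 - ?x) ^ (2 * h) * ?k ^ q"
      using k2[of q] by (simp only: h k1 power_add distrib_left mult.assoc mult_1_right)
    show ?thesis unfolding L mp by (simp only: h inv(2) sm sc[unfolded h])
  qed
qed

lemma A2B2_pow_eq:
  assumes ab: "\<alpha> * \<beta> = 1" and z: "z \<noteq> 1"
  shows "A2B2 (of_real (\<alpha>\<^sup>2)) (of_real (\<beta>\<^sup>2)) (inverse z) ^\<^sub>m h = (1 - inverse z) ^ (2 * h) \<cdot>\<^sub>m aztec_Phi \<alpha> \<beta> z ^\<^sub>m h"
proof -
  have sm: "\<And>c d A. c \<cdot>\<^sub>m (d \<cdot>\<^sub>m A) = (c * d :: complex) \<cdot>\<^sub>m A" by (auto intro!: eq_matI)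
  have ne: "1 - inverse z \<noteq> 0" using inverse_neq_1[OF z] by simp
  have "(1 - inverse z) ^ (2 * h) * (1 / (1 - inverse z)\<^sup>2) ^ h = 1"
    using ne by (simp add: power_one_over power_mult[symmetric])
  then show ?thesis
    by (simp add: aztec_Phi_eq[OF ab] smult_pow_mat[of _ 2] sm del: times_divide_eq_right)
       (auto intro!: eq_matI)?
qed

section \<open>Evaluation of power series at the reciprocal variable\<close>

text \<open>Radius 1 is what is available and enough: the series are evaluated at \<open>1/z\<close>
  with \<open>|z| > 1\<close>, and the symbols, as functions of \<open>1/z\<close>, are singular
  only at 1.\<close>

definition fps_mat_ok :: "complex fps mat \<Rightarrow> bool" where
  "fps_mat_ok F \<longleftrightarrow> F \<in> mats2 \<and> (\<forall>i<2. \<forall>j<2. fps_conv_radius (F $$ (i, j)) \<ge> 1)"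

abbreviation eval_fps_mat :: "complex fps mat \<Rightarrow> complex \<Rightarrow> complex mat" where
  "eval_fps_mat F x \<equiv> map_mat (\<lambda>f. eval_fps f x) F"

lemma fps_mat_ok_mult:
  assumes "fps_mat_ok F" "fps_mat_ok G"
  shows "fps_mat_ok (F * G)" using assms unfolding fps_mat_ok_def
  by (auto simp: mat_2_mult_index simp del: index_mult_mat(1)
      intro!: mult_carrier_mat[of _ 2 2] fps_conv_radius_add_ge fps_conv_radius_mult_ge)

lemma eval_fps_mat_mult:
  assumes "fps_mat_ok F" "fps_mat_ok G" and x: "norm x < 1"
  shows "eval_fps_mat (F * G) x = eval_fps_mat F x * eval_fps_mat G x"
proof -
  have F: "F \<in> mats2" and G: "G \<in> mats2"
    using assms by (auto simp: fps_mat_ok_def)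
  have r: "ereal (norm x) < fps_conv_radius (F $$ (i, j))" "ereal (norm x) < fps_conv_radius (G $$ (i, j))"
    if "i < 2" "j < 2" for i j
    using assms that x by (auto simp: fps_mat_ok_def intro: less_le_trans[of _ 1])
  have rm: "ereal (norm x) < fps_conv_radius (F $$ (i, l) * G $$ (l, j))" if "i < 2" "j < 2" "l < 2" for i j l
    using r[of i l] r[of l j] that fps_conv_radius_mult[of "F $$ (i, l)" "G $$ (l, j)"]
    by (meson less_le_trans min_less_iff_conj)
  show ?thesis by (rule mat_2_eqI)
      (use F G in \<open>auto simp: mat_2_mult_index eval_fps_add rm eval_fps_mult r simp del: index_mult_mat(1) intro!: mult_carrier_mat[of _ 2 2]\<close>)
qed

lemma fps_mat_ok_one: "fps_mat_ok (1\<^sub>m 2)" by (auto simp: fps_mat_ok_def)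

lemma eval_fps_mat_one: "eval_fps_mat (1\<^sub>m 2) x = 1\<^sub>m 2" by (rule eq_matI) auto

lemma fps_mat_ok_pow:
  assumes "fps_mat_ok F"
  shows "fps_mat_ok (F ^\<^sub>m p)"
proof -
  have "dim_row F = 2" using assms by (auto simp: fps_mat_ok_def)
  then show ?thesis using assms by (induction p) (auto intro: fps_mat_ok_mult fps_mat_ok_one)
qed

lemma eval_fps_mat_pow:
  assumes "fps_mat_ok F" "norm x < 1"
  shows "eval_fps_mat (F ^\<^sub>m p) x = eval_fps_mat F x ^\<^sub>m p"
proof -
  have "dim_row F = 2" using assms by (auto simp: fps_mat_ok_def)
  then show ?thesis using assms
    by (induction p) (auto simp: eval_fps_mat_mult fps_mat_ok_pow eval_fps_mat_one)
qed

text \<open>With the next lemma this gives the expansion of the Cauchy kernel,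
  \<open>1 / (1 - w x)\<close> at \<open>x = 1/z\<close>, which converges for
  \<open>|z| > |w|\<close>.\<close>

lemma conv_radius_geo: "fps_conv_radius (Abs_fps (\<lambda>k. w ^ k)) \<ge> ereal (1 / norm w)" if "w \<noteq> 0" for w :: complex
  unfolding fps_conv_radius_def
proof (rule conv_radius_geI_ex)
  fix r assume r: "0 < r" "ereal r < ereal (1 / norm w)"
  then have "norm (w * of_real r) < 1" using that by (simp add: norm_mult field_simps)
  then have "summable (\<lambda>n. (w * of_real r) ^ n)" by (rule summable_geometric)
  then show "\<exists>z. norm z = r \<and> summable (\<lambda>n. fps_nth (Abs_fps (\<lambda>k. w ^ k)) n * z ^ n)"
    using r by (intro exI[of _ "of_real r"]) (simp add: power_mult_distrib)
qed

lemma eval_geometric_fps: "norm (w * x) < 1 \<Longrightarrow> eval_fps (Abs_fps (\<lambda>k. w ^ k)) x = 1 / (1 - w * (x :: complex))"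
  unfolding eval_fps_def using suminf_geometric[of "w * x"] by (simp add: power_mult_distrib)

lemma geo_conv: "fps_conv_radius geo \<ge> 1" and eval_geo: "norm x < 1 \<Longrightarrow> eval_fps geo x = 1 / (1 - x)"
  using conv_radius_geo[of 1] eval_geometric_fps[of 1 x] by (auto simp: geo_def one_ereal_def)

interpretation fps_of_poly_hom: comm_ring_hom "fps_of_poly :: complex poly \<Rightarrow> complex fps"
  by standard (auto simp: fps_of_poly_add fps_of_poly_mult)

interpretation poly_eval_hom: comm_ring_hom "\<lambda>p :: complex poly. poly p x" for x by standard auto

lemma poly_mat_ok: "P \<in> mats2 \<Longrightarrow> fps_mat_ok (map_mat fps_of_poly P)"
  and eval_poly_mat: "eval_fps_mat (map_mat fps_of_poly P) x = map_mat (\<lambda>p. poly p x) P"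
  by (auto simp: fps_mat_ok_def intro!: eq_matI)

section \<open>Polynomial factors of the symbol and their degrees\<close>

context
  fixes \<alpha> \<beta> :: real
begin

abbreviation "PhiF \<equiv> Phi_fps \<alpha> \<beta>"

definition A2B2_poly :: "complex poly mat" where
  "A2B2_poly = A2B2 [:of_real (\<alpha>\<^sup>2):] [:of_real (\<beta>\<^sup>2):] [:0, 1:]"

definition adjA2B2_poly :: "complex poly mat" where
  "adjA2B2_poly = adjA2B2 [:of_real (\<alpha>\<^sup>2):] [:of_real (\<beta>\<^sup>2):] [:0, 1:]"

lemma poly_mats_carrier [simp]: "A2B2_poly \<in> mats2" "adjA2B2_poly \<in> mats2"
    "dim_row (A2B2_poly) = 2" "dim_col (A2B2_poly) = 2"
    "dim_row (adjA2B2_poly) = 2" "dim_col (adjA2B2_poly) = 2"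
  by (simp_all add: A2B2_poly_def adjA2B2_poly_def A2B2_def adjA2B2_def)

lemma Phi_fps_poly: "PhiF = geo\<^sup>2 \<cdot>\<^sub>m map_mat fps_of_poly (A2B2_poly)"
  by (simp add: Phi_fps_def A2B2_poly_def fps_of_poly_hom.map_A2B2 fps_of_poly_const fps_of_poly_fps_X)

lemma eval_A2B2_poly: "map_mat (\<lambda>p. poly p x) (A2B2_poly) = A2B2 (of_real (\<alpha>\<^sup>2)) (of_real (\<beta>\<^sup>2)) x"
  and eval_adjA2B2_poly: "map_mat (\<lambda>p. poly p x) (adjA2B2_poly) = adjA2B2 (of_real (\<alpha>\<^sup>2)) (of_real (\<beta>\<^sup>2)) x"
  by (simp_all add: A2B2_poly_def adjA2B2_poly_def poly_eval_hom.map_A2B2 poly_eval_hom.map_adjA2B2)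

lemma Phi_fps_ok: "fps_mat_ok (PhiF)"
proof -
  have "fps_conv_radius (geo\<^sup>2) \<ge> 1"
    using geo_conv fps_conv_radius_power[of geo 2] by (rule order.trans)
  then show ?thesis using poly_mat_ok[of "A2B2_poly"]
    by (auto simp: Phi_fps_poly fps_mat_ok_def intro!: fps_conv_radius_mult_ge)
qed

lemma eval_Phi_fps:
  assumes "\<alpha> * \<beta> = 1" "norm z > 1"
  shows "eval_fps_mat (PhiF) (inverse z) = aztec_Phi \<alpha> \<beta> z"
proof -
  have x: "norm (inverse z) < 1" using assms by (simp add: norm_inverse inverse_less_1_iff)
  have g: "ereal (norm (inverse z)) < fps_conv_radius geo"
    by (rule less_le_trans[OF _ geo_conv]) (use x in \<open>simp add: one_ereal_def\<close>)
  then have g2: "ereal (norm (inverse z)) < fps_conv_radius (geo\<^sup>2)"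
    using fps_conv_radius_power[of geo 2] by (rule less_le_trans)
  have "eval_fps_mat (PhiF) (inverse z) = eval_fps (geo\<^sup>2) (inverse z) \<cdot>\<^sub>m map_mat (\<lambda>p. poly p (inverse z)) (A2B2_poly)"
    by (rule mat_2_eqI) (auto simp: Phi_fps_poly eval_fps_mult g2 intro!: carrier_matI)
  also have "eval_fps (geo\<^sup>2) (inverse z) = 1 / (1 - inverse z)\<^sup>2"
    using g x by (simp add: eval_fps_power eval_geo power_one_over)
  finally show ?thesis by (simp add: eval_A2B2_poly aztec_Phi_eq[OF assms(1)])
qed

definition degree_mat_le :: "nat \<Rightarrow> complex poly mat \<Rightarrow> bool" where
  "degree_mat_le d P \<longleftrightarrow> P \<in> mats2 \<and> (\<forall>i<2. \<forall>j<2. degree (P $$ (i, j)) \<le> d)"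

lemma degree_mat_le_mult: "degree_mat_le d P \<Longrightarrow> degree_mat_le e Q \<Longrightarrow> degree_mat_le (d + e) (P * Q)"
  unfolding degree_mat_le_def by (auto simp: mat_2_mult_index simp del: index_mult_mat(1)
      intro!: mult_carrier_mat[of _ 2 2] degree_add_le order.trans[OF degree_mult_le] add_mono)

lemma degree_mat_le_pow: "degree_mat_le d P \<Longrightarrow> degree_mat_le (p * d) (P ^\<^sub>m p)"
proof (induction p)
  case 0
  then have "dim_row P = 2" by (auto simp: degree_mat_le_def)
  then show ?case by (auto simp: degree_mat_le_def)
next
  case (Suc p)
  then show ?case using degree_mat_le_mult[of "p * d" "P ^\<^sub>m p" d P] by (simp add: add.commute)
qed

lemma degree_A2B2_poly: "degree_mat_le 2 (A2B2_poly)" and degree_adjA2B2_poly: "degree_mat_le 2 (adjA2B2_poly)"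
proof -
  have i: "i = 0 \<or> i = Suc 0" if "i < 2" for i using that by auto
  show "degree_mat_le 2 (A2B2_poly)" "degree_mat_le 2 (adjA2B2_poly)" unfolding degree_mat_le_def
    by (auto dest!: i simp: A2B2_poly_def adjA2B2_poly_def A2B2_def adjA2B2_def power2_eq_square
        one_pCons numeral_poly degree_pCons_eq_if)
qed

text \<open>Over power series \<open>geo\<close> inverts \<open>1 - x\<close>: the factor
  \<open>geo ^ (4 * h)\<close> from the powers of the symbol cancels the \<open>h\<close>
  determinants \<open>(1 - x) ^ 4\<close> produced by the adjugates.\<close>

lemma adjA2B2_pow_Phi_pow_fps:
  assumes ab: "\<alpha> * \<beta> = 1"
  shows "map_mat fps_of_poly (adjA2B2_poly ^\<^sub>m h) * PhiF ^\<^sub>m (2 * h) = map_mat fps_of_poly (A2B2_poly ^\<^sub>m h)"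
proof -
  define a b where "a = fps_const (complex_of_real (\<alpha>\<^sup>2))" and "b = fps_const (complex_of_real (\<beta>\<^sup>2))"
  let ?C = "A2B2 a b fps_X" and ?D = "adjA2B2 a b fps_X"
  have ab': "a * b = 1" unfolding a_def b_def fps_const_mult of_real_squares_mult[OF ab] by simp
  have C: "map_mat fps_of_poly (A2B2_poly ^\<^sub>m h) = ?C ^\<^sub>m h"
    and D: "map_mat fps_of_poly (adjA2B2_poly ^\<^sub>m h) = ?D ^\<^sub>m h"
    by (simp_all add: fps_of_poly_hom.mat_hom_pow[of _ 2] A2B2_poly_def adjA2B2_poly_def fps_of_poly_hom.map_A2B2
       fps_of_poly_hom.map_adjA2B2 fps_of_poly_const fps_of_poly_fps_X a_def b_def)
  have Cp: "?C ^\<^sub>m p \<in> mats2" "?D ^\<^sub>m p \<in> mats2" for p by (auto intro: pow_carrier_mat)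
  have sm: "\<And>c d A. c \<cdot>\<^sub>m (d \<cdot>\<^sub>m A) = (c * d :: complex fps) \<cdot>\<^sub>m A" by (auto intro!: eq_matI simp: mult.assoc)
  have "?D ^\<^sub>m h * PhiF ^\<^sub>m (2 * h) = (geo\<^sup>2) ^ (2 * h) \<cdot>\<^sub>m (?D ^\<^sub>m h * ?C ^\<^sub>m (h + h))"
    unfolding Phi_fps_def a_def[symmetric] b_def[symmetric] by (simp add: smult_pow_mat[of _ 2] mult_smult_distrib[OF Cp(2) Cp(1)] mult_2)
  also have "\<dots> = ((geo\<^sup>2) ^ (2 * h) * ((1 - fps_X) ^ 4) ^ h) \<cdot>\<^sub>m ?C ^\<^sub>m h"
    by (simp only: pow_mat_mult_inverse[OF A2B2_carrier adjA2B2_carrier adjA2B2_A2B2(2)[OF ab'] adjA2B2_A2B2(1)[OF ab']] sm)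
  also have "(geo\<^sup>2) ^ (2 * h) * ((1 - fps_X) ^ 4) ^ h = (geo * (1 - fps_X)) ^ (4 * h)"
    by (simp add: power_mult[symmetric] power_mult_distrib mult_ac)
  also have "\<dots> = 1" by (simp add: geo_inverse)
  finally show ?thesis unfolding C D by (auto intro!: eq_matI)
qed

end

section \<open>Spectral projections\<close>

abbreviation proj1 :: "complex mat" where
  "proj1 \<equiv> mat_of_rows_list 2 [[1, 0], [0, 0]]"

lemma diag_mat_2_pow:
  "mat_of_rows_list 2 [[a, 0], [0, b]] ^\<^sub>m k = mat_of_rows_list 2 [[a ^ k, 0], [0, b ^ k :: complex]]"
proof (induction k)
  case 0
  have "dim_row (mat_of_rows_list 2 [[a, 0], [0, b]]) = 2" by (rule mat_of_rows_list_2_index)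
  then show ?case by (simp only: pow_mat.simps power_0 mat_of_rows_list_2_one)
next
  case (Suc k)
  then show ?case by (simp add: mat_of_rows_list_2_mult mult.commute)
qed

text \<open>Conjugation by \<open>P\<close> turns the coordinate projections \<open>proj1\<close>
  and \<open>J2\<close> into the two spectral projections, which add up to the identity.\<close>

lemma similar_diag_pow:
  fixes A :: "complex mat"
  assumes sim: "similar_mat_wit A (mat_of_rows_list 2 [[r1, 0], [0, r2]]) P Q" and A: "A \<in> mats2"
  shows "(P * proj1 * Q) * A ^\<^sub>m k = r1 ^ k \<cdot>\<^sub>m (P * proj1 * Q)"
    and "A ^\<^sub>m k = r1 ^ k \<cdot>\<^sub>m (P * proj1 * Q) + r2 ^ k \<cdot>\<^sub>m (1\<^sub>m 2 - P * proj1 * Q)"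
    and "P * proj1 * Q \<in> mats2"
proof -
  note D = similar_mat_witD2[OF A sim]
  let ?D = "\<lambda>k. mat_of_rows_list 2 [[r1 ^ k, 0], [0, r2 ^ k]]"
  have P: "P \<in> mats2" and Q: "Q \<in> mats2" and J: "proj1 \<in> mats2"
    and Dk: "?D k \<in> mats2" by (auto simp: D)
  show car: "P * proj1 * Q \<in> mats2" using P Q by (auto intro!: mult_carrier_mat[of _ 2 2])
  have Ak: "A ^\<^sub>m k = P * ?D k * Q"
    using similar_mat_wit_pow_id[OF sim, of k] by (simp add: diag_mat_2_pow)
  have PJ: "P * proj1 \<in> mats2" using P by (auto intro!: mult_carrier_mat[of _ 2 2])
  have "(P * proj1 * Q) * (P * ?D k * Q) = P * proj1 * (Q * P) * ?D k * Q"
    using P Q J Dk PJ by (simp add: assoc_mult_mat[of _ 2 2 _ 2 _ 2] mult_carrier_mat[of _ 2 2 _ 2])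
  also have "\<dots> = P * (proj1 * ?D k) * Q"
    using P Q J Dk PJ D(2) by (simp add: assoc_mult_mat[of _ 2 2 _ 2 _ 2] mult_carrier_mat[of _ 2 2 _ 2] right_mult_one_mat[of _ 2 2])
  also have "proj1 * ?D k = r1 ^ k \<cdot>\<^sub>m proj1"
    by (simp add: mat_of_rows_list_2_mult mat_of_rows_list_2_smult)
  also have "P * (r1 ^ k \<cdot>\<^sub>m proj1) * Q = r1 ^ k \<cdot>\<^sub>m (P * proj1 * Q)"
    using mult_smult_distrib[OF P J] mult_smult_assoc_mat[OF PJ Q] by simp
  finally show "(P * proj1 * Q) * A ^\<^sub>m k = r1 ^ k \<cdot>\<^sub>m (P * proj1 * Q)" by (simp add: Ak)
  define R where "R = P * proj1 * Q"
  define J2 :: "complex mat" where "J2 = mat_of_rows_list 2 [[0, 0], [0, 1]]"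
  have J2: "J2 \<in> mats2" by (simp add: J2_def)
  have PJ2: "P * J2 \<in> mats2" using P J2 by (auto intro!: mult_carrier_mat[of _ 2 2])
  have "?D k = r1 ^ k \<cdot>\<^sub>m proj1 + r2 ^ k \<cdot>\<^sub>m J2"
    by (rule mat_2_eqI) (auto simp: J2_def mat_of_rows_list_2_smult)
  then have "A ^\<^sub>m k = P * (r1 ^ k \<cdot>\<^sub>m proj1 + r2 ^ k \<cdot>\<^sub>m J2) * Q" using Ak by simp
  also have "\<dots> = r1 ^ k \<cdot>\<^sub>m (P * proj1 * Q) + r2 ^ k \<cdot>\<^sub>m (P * J2 * Q)"
    using mult_smult_distrib[OF P J] mult_smult_assoc_mat[OF PJ Q] mult_smult_distrib[OF P J2] mult_smult_assoc_mat[OF PJ2 Q]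
      PJ PJ2 by (simp add: mult_add_distrib_mat[OF P smult_carrier_mat[OF J] smult_carrier_mat[OF J2]]
      add_mult_distrib_mat[OF smult_carrier_mat[OF PJ] smult_carrier_mat[OF PJ2] Q])
  also have "P * J2 * Q = 1\<^sub>m 2 - P * proj1 * Q"
  proof -
    have "J2 = 1\<^sub>m 2 - proj1" by (rule mat_2_eqI) (auto simp: J2_def)
    then have "P * J2 = P - P * proj1"
      using mult_minus_distrib_mat[OF P one_carrier_mat J] P by (simp add: right_mult_one_mat[of _ 2 2])
    then show ?thesis using minus_mult_distrib_mat[OF P PJ Q] D(1) by simp
  qed
  finally show "A ^\<^sub>m k = r1 ^ k \<cdot>\<^sub>m (P * proj1 * Q) + r2 ^ k \<cdot>\<^sub>m (1\<^sub>m 2 - P * proj1 * Q)" .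
qed

lemma A2B2_adjA2B2_dim [simp]:
  "dim_row (A2B2 a b x) = 2" "dim_col (A2B2 a b x) = 2" "dim_row (adjA2B2 a b x) = 2" "dim_col (adjA2B2 a b x) = 2"
  by (simp_all add: A2B2_def adjA2B2_def)

locale aztec_spectral =
  fixes \<alpha> \<beta> :: real and S :: "complex \<Rightarrow> complex" and E :: "complex \<Rightarrow> complex mat"
  assumes \<alpha>: "\<alpha> > 0" and \<beta>: "\<beta> > 0" and \<alpha>\<beta>: "\<alpha> * \<beta> = 1"
    and branch: "aztec_sqrt_branch \<alpha> \<beta> S"
    and decomp: "\<And>z. z \<notin> \<real>\<^sub>\<le>\<^sub>0 \<Longrightarrow> z \<noteq> 1 \<Longrightarrow>
           similar_mat_wit (aztec_Phi \<alpha> \<beta> z)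
             (mat_of_rows_list 2 [[aztec_rho1 \<alpha> \<beta> S z, 0], [0, aztec_rho2 \<alpha> \<beta> S z]])
             (E z) (mat_inv (E z))"
begin

abbreviation "\<Phi> \<equiv> aztec_Phi \<alpha> \<beta>"
abbreviation "\<rho>\<^sub>1 \<equiv> aztec_rho1 \<alpha> \<beta> S"
abbreviation "\<rho>\<^sub>2 \<equiv> aztec_rho2 \<alpha> \<beta> S"
abbreviation "A2B2_at z \<equiv> A2B2 (complex_of_real (\<alpha>\<^sup>2)) (of_real (\<beta>\<^sup>2)) (inverse z)"
abbreviation "adjA2B2_at z \<equiv> adjA2B2 (complex_of_real (\<alpha>\<^sup>2)) (of_real (\<beta>\<^sup>2)) (inverse z)"
abbreviation "A2B2p \<equiv> A2B2_poly \<alpha> \<beta>"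
abbreviation "adjA2B2p \<equiv> adjA2B2_poly \<alpha> \<beta>"
abbreviation "\<Phi>F \<equiv> Phi_fps \<alpha> \<beta>"
abbreviation "evalp z \<equiv> map_mat (\<lambda>p. poly p (inverse z))"
abbreviation "fpsm \<equiv> map_mat fps_of_poly"
abbreviation "projm z \<equiv> E z * proj1 * mat_inv (E z)"

section \<open>The eigenvalues in the slit plane and at 1\<close>

definition num1 :: "complex \<Rightarrow> complex" where
  "num1 z = (z + 1)\<^sup>2 + 2 * z * of_real (\<alpha>\<^sup>2 + \<beta>\<^sup>2) + 2 * of_real (\<alpha> + \<beta>) * S z"

definition num2 :: "complex \<Rightarrow> complex" where
  "num2 z = (z + 1)\<^sup>2 + 2 * z * of_real (\<alpha>\<^sup>2 + \<beta>\<^sup>2) - 2 * of_real (\<alpha> + \<beta>) * S z"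

lemma rho_eq: "\<rho>\<^sub>1 z = num1 z / (z - 1)\<^sup>2" "\<rho>\<^sub>2 z = num2 z / (z - 1)\<^sup>2"
  by (simp_all add: aztec_rho1_def aztec_rho2_def num1_def num2_def)

lemma S_square: "z \<notin> \<real>\<^sub>\<le>\<^sub>0 \<Longrightarrow> (S z)\<^sup>2 = z * (z\<^sup>2 + of_real (\<alpha>\<^sup>2 + \<beta>\<^sup>2) * z + 1)"
  using branch by (simp add: aztec_sqrt_branch_def)

lemma S_holomorphic: "S holomorphic_on - \<real>\<^sub>\<le>\<^sub>0"
  using branch by (auto simp: aztec_sqrt_branch_def analytic_imp_holomorphic)

lemma sum_squares: "\<alpha>\<^sup>2 + \<beta>\<^sup>2 = (\<alpha> + \<beta>)\<^sup>2 - 2"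
  using \<alpha>\<beta> by (simp add: power2_sum)

text \<open>As \<open>\<alpha> * \<beta> = 1\<close>, the quadratic factor has the roots
  \<open>-\<alpha>\<^sup>2\<close> and \<open>-\<beta>\<^sup>2\<close>, which lie on the slit. Since
  \<open>num1 - num2\<close> is a multiple of \<open>S\<close>, the two eigenvalues stay
  distinct.\<close>

lemma S_nonzero:
  assumes z: "z \<notin> \<real>\<^sub>\<le>\<^sub>0"
  shows "S z \<noteq> 0"
proof
  assume "S z = 0"
  then have "z * (z\<^sup>2 + of_real (\<alpha>\<^sup>2 + \<beta>\<^sup>2) * z + 1) = 0" using S_square[OF z] by simp
  moreover have "z \<noteq> 0" using z by auto
  moreover have "z\<^sup>2 + of_real (\<alpha>\<^sup>2 + \<beta>\<^sup>2) * z + 1 = (z + of_real (\<alpha>\<^sup>2)) * (z + of_real (\<beta>\<^sup>2))"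
  proof -
    show ?thesis using of_real_squares_mult[OF \<alpha>\<beta>] by (simp add: algebra_simps power2_eq_square)
  qed
  ultimately have "z = of_real (- (\<alpha>\<^sup>2)) \<or> z = of_real (- (\<beta>\<^sup>2))"
    by (auto simp: add_eq_0_iff2)
  moreover have "complex_of_real (- (r\<^sup>2)) \<in> \<real>\<^sub>\<le>\<^sub>0" for r
    by (simp only: nonpos_Reals_of_real_iff) simp
  ultimately show False using z by metis
qed

text \<open>This is \<open>det \<Phi> = 1\<close> in terms of the numerators; it rests on
  \<open>(\<alpha> + \<beta>)\<^sup>2 = \<alpha>\<^sup>2 + \<beta>\<^sup>2 + 2\<close>.\<close>

lemma num1_num2:
  assumes "z \<notin> \<real>\<^sub>\<le>\<^sub>0"
  shows "num1 z * num2 z = (z - 1) ^ 4"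
proof -
  define s where "s = complex_of_real (\<alpha>\<^sup>2 + \<beta>\<^sup>2)"
  define t where "t = complex_of_real (\<alpha> + \<beta>)"
  have t: "t\<^sup>2 = s + 2" unfolding s_def t_def sum_squares by simp
  have "num1 z * num2 z = ((z + 1)\<^sup>2 + 2 * z * s)\<^sup>2 - 4 * t\<^sup>2 * (S z)\<^sup>2"
    unfolding num1_def num2_def s_def[symmetric] t_def[symmetric] by (simp add: algebra_simps power2_eq_square)
  also have "\<dots> = ((z + 1)\<^sup>2 + 2 * z * s)\<^sup>2 - 4 * (s + 2) * (z * (z\<^sup>2 + s * z + 1))"
    unfolding t S_square[OF assms] s_def ..
  also have "\<dots> = (z - 1) ^ 4" by (simp add: algebra_simps power2_eq_square power4_eq_xxxx)
  finally show ?thesis .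
qed

text \<open>Off 1 the product with \<open>num2\<close> is nonzero. At 1 that product vanishes, and
  the positivity of the branch decides which numerator survives: \<open>\<rho>\<^sub>1\<close> is
  the eigenvalue with the double pole.\<close>

lemma num1_nonzero:
  assumes z: "z \<notin> \<real>\<^sub>\<le>\<^sub>0"
  shows "num1 z \<noteq> 0"
proof (cases "z = 1")
  case False
  then show ?thesis using num1_num2[OF z] by auto
next
  case True
  have "Re (S 1) > 0"
  proof -
    have "\<forall>x::real. x > 0 \<longrightarrow> S (of_real x) \<in> \<real> \<and> Re (S (of_real x)) > 0"
      using branch unfolding aztec_sqrt_branch_def by blast
    from this[rule_format, of 1] show ?thesis by simp
  qed
  then have "Re (num1 1) > 0"
  proof -
    have "Re (num1 1) = 4 + 2 * (\<alpha>\<^sup>2 + \<beta>\<^sup>2) + 2 * (\<alpha> + \<beta>) * Re (S 1)"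
      by (simp add: num1_def power2_eq_square)
    moreover have "2 * (\<alpha>\<^sup>2 + \<beta>\<^sup>2) \<ge> 0" "2 * (\<alpha> + \<beta>) * Re (S 1) > 0"
      using \<alpha> \<beta> \<open>Re (S 1) > 0\<close> by simp_all
    ultimately show ?thesis by linarith
  qed
  then show ?thesis using True by auto
qed

lemma rho1_rho2:
  assumes "z \<notin> \<real>\<^sub>\<le>\<^sub>0" "z \<noteq> 1"
  shows "\<rho>\<^sub>1 z * \<rho>\<^sub>2 z = 1" "\<rho>\<^sub>1 z \<noteq> 0"
proof -
  show "\<rho>\<^sub>1 z * \<rho>\<^sub>2 z = 1"
  proof -
    have "(z - 1)\<^sup>2 * (z - 1)\<^sup>2 = (z - 1) ^ 4" by (simp flip: power_add)
    then have "\<rho>\<^sub>1 z * \<rho>\<^sub>2 z = num1 z * num2 z / (z - 1) ^ 4"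
      by (simp only: rho_eq times_divide_times_eq)
    then show ?thesis using num1_num2[OF assms(1)] assms(2) by simp
  qed
  then show "\<rho>\<^sub>1 z \<noteq> 0" by auto
qed

text \<open>Unlike the definition, this quotient has a nonvanishing denominator on the whole slit
  plane; it continues \<open>\<rho>\<^sub>2\<close> analytically to 1, with a double zero
  there.\<close>

lemma rho2_alt:
  assumes "z \<notin> \<real>\<^sub>\<le>\<^sub>0" "z \<noteq> 1"
  shows "\<rho>\<^sub>2 z = (z - 1)\<^sup>2 / num1 z"
proof -
  have "\<rho>\<^sub>2 z = 1 / \<rho>\<^sub>1 z"
    using rho1_rho2[OF assms] by (simp add: nonzero_eq_divide_eq mult.commute)
  then show ?thesis by (simp add: rho_eq(1))
qed

lemma num_holomorphic: "num1 holomorphic_on - \<real>\<^sub>\<le>\<^sub>0" "num2 holomorphic_on - \<real>\<^sub>\<le>\<^sub>0"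
  unfolding num1_def num2_def by (intro holomorphic_intros S_holomorphic)+

text \<open>The spectral projection \<open>(\<Phi> - \<rho>\<^sub>2) / (\<rho>\<^sub>1 - \<rho>\<^sub>2)\<close> with the poles at \<open>1\<close> cancelled.\<close>

definition proj_entry :: "nat \<Rightarrow> nat \<Rightarrow> complex \<Rightarrow> complex" where
  "proj_entry i j z = (z\<^sup>2 * A2B2_at z $$ (i, j) - (if i = j then num2 z else 0))
      / (4 * of_real (\<alpha> + \<beta>) * S z)"

lemma proj_entry_holomorphic:
  assumes "i < 2" "j < 2"
  shows "proj_entry i j holomorphic_on - \<real>\<^sub>\<le>\<^sub>0"
proof -
  have "i \<in> {0, Suc 0}" "j \<in> {0, Suc 0}" using assms by auto
  then have "(\<lambda>z. A2B2_at z $$ (i, j)) holomorphic_on - \<real>\<^sub>\<le>\<^sub>0"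
    unfolding A2B2_def by (auto intro!: holomorphic_intros)
  then have num: "(\<lambda>z. z\<^sup>2 * A2B2_at z $$ (i, j) - (if i = j then num2 z else 0))
      holomorphic_on - \<real>\<^sub>\<le>\<^sub>0"
    by (cases "i = j") (auto intro!: holomorphic_intros num_holomorphic)
  have "complex_of_real (\<alpha> + \<beta>) \<noteq> 0" using \<alpha> \<beta> by (simp add: complex_eq_iff)
  then show ?thesis unfolding proj_entry_def
    by (intro holomorphic_on_divide[OF num] holomorphic_intros S_holomorphic) (simp add: S_nonzero del: of_real_add)
qed

section \<open>The spectral projection at a point of the slit plane\<close>

context
  fixes z :: complex assumes z: "z \<notin> \<real>\<^sub>\<le>\<^sub>0" "z \<noteq> 1"
begin

lemma projm_carrier [simp]: "projm z \<in> mats2"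
  and projm_pow: "projm z * \<Phi> z ^\<^sub>m k = \<rho>\<^sub>1 z ^ k \<cdot>\<^sub>m projm z"
  and Phi_pow: "\<Phi> z ^\<^sub>m k = \<rho>\<^sub>1 z ^ k \<cdot>\<^sub>m projm z + \<rho>\<^sub>2 z ^ k \<cdot>\<^sub>m (1\<^sub>m 2 - projm z)"
  using similar_diag_pow[OF decomp[OF z]] \<alpha>\<beta> by simp_all

lemma Phi_pow_entry:
  assumes "i < 2" "j < 2"
  shows "(\<Phi> z ^\<^sub>m k) $$ (i, j) = \<rho>\<^sub>1 z ^ k * projm z $$ (i, j) + \<rho>\<^sub>2 z ^ k * ((if i = j then 1 else 0) - projm z $$ (i, j))"
proof -
  have d: "dim_row (projm z) = 2" "dim_col (projm z) = 2" using projm_carrier by (auto simp del: projm_carrier)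
  show ?thesis unfolding Phi_pow using assms d by (simp add: algebra_simps del: index_mult_mat)
qed

text \<open>Multiplying the spectral decomposition by \<open>(z - 1)\<^sup>2\<close> clears the
  poles and lets the projection be solved for, whatever \<open>E\<close> is. Analyticity is
  therefore always argued for \<open>proj_entry\<close>, never for \<open>E\<close>.\<close>

lemma projm_entry:
  assumes "i < 2" "j < 2"
  shows "projm z $$ (i, j) = proj_entry i j z"
proof -
  have z0: "z \<noteq> 0" using z by auto
  have t: "complex_of_real (\<alpha> + \<beta>) \<noteq> 0" using \<alpha> \<beta> by (simp add: complex_eq_iff)
  have diff: "(\<rho>\<^sub>1 z - \<rho>\<^sub>2 z) * (z - 1)\<^sup>2 = 4 * of_real (\<alpha> + \<beta>) * S z"
    using z by (simp add: rho_eq num1_def num2_def field_simps)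
  have phi: "\<Phi> z $$ (i, j) * (z - 1)\<^sup>2 = z\<^sup>2 * A2B2_at z $$ (i, j)"
  proof -
    have "1 / (1 - inverse z)\<^sup>2 * (z - 1)\<^sup>2 = z\<^sup>2"
    proof -
      have "z - 1 = z * (1 - inverse z)" using z0 by (simp add: algebra_simps)
      then show ?thesis using inverse_neq_1[OF z(2)] by (simp add: power_mult_distrib)
    qed
    moreover have "\<Phi> z $$ (i, j) = 1 / (1 - inverse z)\<^sup>2 * A2B2_at z $$ (i, j)"
      using assms by (simp add: aztec_Phi_eq[OF \<alpha>\<beta>])
    ultimately show ?thesis
      by (simp only: mult.assoc mult.commute[of "A2B2 _ _ _ $$ _"]) (simp only: mult.assoc[symmetric])
  qed
  have "\<Phi> z $$ (i, j) = (\<rho>\<^sub>1 z - \<rho>\<^sub>2 z) * projm z $$ (i, j) + (if i = j then \<rho>\<^sub>2 z else 0)"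
    using Phi_pow_entry[OF assms, of 1] \<alpha>\<beta> by (simp add: algebra_simps left_mult_one_mat[of _ 2 2] carrier_matD[OF aztec_Phi_carrier] del: index_mult_mat)
  then have "\<Phi> z $$ (i, j) * (z - 1)\<^sup>2 = ((\<rho>\<^sub>1 z - \<rho>\<^sub>2 z) * (z - 1)\<^sup>2) * projm z $$ (i, j) + (if i = j then num2 z else 0)"
  proof -
    have *: "(d * p + r) * y = (d * y) * p + r * y" for d p r y :: complex by (simp add: algebra_simps)
    have "(if i = j then \<rho>\<^sub>2 z else 0) * (z - 1)\<^sup>2 = (if i = j then num2 z else 0)"
      using z by (simp add: rho_eq(2))
    with \<open>\<Phi> z $$ (i, j) = _\<close> show ?thesis by (simp only: *)
  qed
  then show ?thesis
    unfolding diff phi proj_entry_def using t S_nonzero[OF z(1)] by (simp add: field_simps del: index_mult_mat of_real_add)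
qed

lemma projm_A2B2_pow:
  "projm z * A2B2_at z ^\<^sub>m h
     = ((1 - inverse z) ^ (2 * h) * \<rho>\<^sub>1 z ^ h) \<cdot>\<^sub>m projm z"
proof -
  have P: "\<Phi> z ^\<^sub>m h \<in> mats2" using \<alpha>\<beta> by (auto intro: pow_carrier_mat)
  show ?thesis
    unfolding A2B2_pow_eq[OF \<alpha>\<beta> z(2)] mult_smult_distrib[OF projm_carrier P] projm_pow
    by (auto intro!: eq_matI simp del: index_mult_mat(1))
qed

text \<open>With \<open>A2B2 ^ h\<close> inserted between the projection and the adjugate power, the
  product can be evaluated from either side; comparing the scalars gives the power of
  \<open>1 / \<rho>\<^sub>1 = \<rho>\<^sub>2\<close>.\<close>

lemma projm_adjA2B2_pow:
  "projm z * adjA2B2_at z ^\<^sub>m h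
     = ((1 - inverse z) ^ (2 * h) * \<rho>\<^sub>2 z ^ h) \<cdot>\<^sub>m projm z"
proof -
  let ?C = "A2B2_at z" and ?D = "adjA2B2_at z"
  let ?y = "1 - inverse z"
  have y: "?y \<noteq> 0" using inverse_neq_1[OF z(2)] by simp
  note ab = of_real_squares_mult[OF \<alpha>\<beta>]
  have Dp: "?D ^\<^sub>m h \<in> mats2" and Cp: "?C ^\<^sub>m h \<in> mats2" by (auto intro: pow_carrier_mat)
  have "?C ^\<^sub>m h * ?D ^\<^sub>m (h + 0) = (?y ^ 4) ^ h \<cdot>\<^sub>m ?D ^\<^sub>m 0"
    by (rule pow_mat_mult_inverse[OF adjA2B2_carrier A2B2_carrier adjA2B2_A2B2(1)[OF ab] adjA2B2_A2B2(2)[OF ab]])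
  then have CD: "?C ^\<^sub>m h * ?D ^\<^sub>m h = ?y ^ (4 * h) \<cdot>\<^sub>m 1\<^sub>m 2"
    using carrier_matD(1)[OF adjA2B2_carrier] by (simp add: power_mult)
  have "(?y ^ (2 * h) * \<rho>\<^sub>1 z ^ h) \<cdot>\<^sub>m (projm z * ?D ^\<^sub>m h) = projm z * ?C ^\<^sub>m h * ?D ^\<^sub>m h"
    unfolding projm_A2B2_pow using mult_smult_assoc_mat[OF projm_carrier Dp] by simp
  also have "\<dots> = projm z * (?y ^ (4 * h) \<cdot>\<^sub>m 1\<^sub>m 2)"
    using assoc_mult_mat[OF projm_carrier Cp Dp] CD by simp
  also have "\<dots> = ?y ^ (4 * h) \<cdot>\<^sub>m projm z"
    using mult_smult_distrib[OF projm_carrier one_carrier_mat] right_mult_one_mat[OF projm_carrier] by simp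
  finally have eq: "(?y ^ (2 * h) * \<rho>\<^sub>1 z ^ h) \<cdot>\<^sub>m (projm z * ?D ^\<^sub>m h) = ?y ^ (4 * h) \<cdot>\<^sub>m projm z" .
  have sm: "\<And>c d A. c \<cdot>\<^sub>m (d \<cdot>\<^sub>m A) = (c * d :: complex) \<cdot>\<^sub>m A" by (auto intro!: eq_matI)
  have "?y ^ (4 * h) = ?y ^ (2 * h) * ?y ^ (2 * h)" by (simp add: power_add[symmetric])
  then have 1: "\<rho>\<^sub>2 z ^ h * inverse (?y ^ (2 * h)) * ?y ^ (4 * h) = ?y ^ (2 * h) * \<rho>\<^sub>2 z ^ h"
    using y by simp
  have "\<rho>\<^sub>2 z ^ h * \<rho>\<^sub>1 z ^ h = 1"
    using rho1_rho2(1)[OF z] by (metis mult.commute power_mult_distrib power_one)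
  then have 2: "\<rho>\<^sub>2 z ^ h * inverse (?y ^ (2 * h)) * (?y ^ (2 * h) * \<rho>\<^sub>1 z ^ h) = 1"
  proof -
    have "inverse (?y ^ (2 * h)) * ?y ^ (2 * h) = 1" using y by simp
    then have "(inverse (?y ^ (2 * h)) * ?y ^ (2 * h)) * (\<rho>\<^sub>2 z ^ h * \<rho>\<^sub>1 z ^ h) = 1"
      using \<open>\<rho>\<^sub>2 z ^ h * \<rho>\<^sub>1 z ^ h = 1\<close> by (simp only: mult_1)
    then show ?thesis by (simp only: mult_ac)
  qed
  have "projm z * ?D ^\<^sub>m h = (\<rho>\<^sub>2 z ^ h * inverse (?y ^ (2 * h)) * (?y ^ (2 * h) * \<rho>\<^sub>1 z ^ h)) \<cdot>\<^sub>m (projm z * ?D ^\<^sub>m h)"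
    unfolding 2 by (auto intro!: eq_matI)
  also have "\<dots> = (\<rho>\<^sub>2 z ^ h * inverse (?y ^ (2 * h)) * ?y ^ (4 * h)) \<cdot>\<^sub>m projm z"
    using eq sm by metis
  finally show ?thesis unfolding 1 .
qed

end

end


section \<open>Inverting the Gram matrix\<close>

lemma poly_inverse_mult_power:
  fixes w :: complex
  assumes "w \<noteq> 0" "degree q \<le> D"
  shows "w ^ D * poly q (inverse w) = (\<Sum>s\<le>D. Polynomial.coeff q s * w ^ (D - s))"
proof -
  have "poly q (inverse w) = (\<Sum>s\<le>D. Polynomial.coeff q s * inverse w ^ s)"
    unfolding poly_altdef using assms(2) by (intro sum.mono_neutral_left) (auto simp: coeff_eq_0)
  moreover have "w ^ D * (c * inverse w ^ s) = c * w ^ (D - s)" if "s \<le> D" for s c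
    using assms(1) that by (simp add: power_diff power_inverse divide_inverse mult_ac)
  ultimately show ?thesis unfolding sum_distrib_left by (auto intro!: sum.cong simp: sum_distrib_left)
qed

lemma poly_inverse_holomorphic:
  assumes "0 \<notin> A"
  shows "(\<lambda>z :: complex. poly q (inverse z)) holomorphic_on A"
  unfolding poly_altdef using assms by (intro holomorphic_intros) auto

section \<open>Moments on the inner contour\<close>

text \<open>By \<open>1 / (z - w) = (\<Sum>k. w ^ k / z ^ (k + 1))\<close> this is, up to a factor
  \<open>1/z\<close>, the expansion in \<open>1/z\<close> of the Cauchy integral of \<open>f\<close>
  over \<open>\<gamma>\<close>.\<close>

definition moment_fps :: "(real \<Rightarrow> complex) \<Rightarrow> (complex \<Rightarrow> complex) \<Rightarrow> complex fps" where
  "moment_fps \<gamma> f = Abs_fps (\<lambda>k. 1 / (2 * of_real pi * \<i>) * contour_integral \<gamma> (\<lambda>w. f w * w ^ k))"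

text \<open>Coefficient \<open>t\<close> of the product collects the powers
  \<open>w ^ (t - s)\<close> weighted by the coefficients of \<open>q\<close>, and this is
  \<open>w ^ t\<close> times \<open>q(1/w)\<close> as soon as all of \<open>q\<close> fits below
  \<open>t\<close>. From its degree on, a polynomial factor thus acts under the integral.\<close>

lemma moment_fps_mult_poly:
  assumes f: "\<And>k. (\<lambda>w. f w * w ^ k) contour_integrable_on \<gamma>" and 0: "0 \<notin> path_image \<gamma>" and q: "degree q \<le> t"
  shows "fps_nth (moment_fps \<gamma> f * fps_of_poly q) t
     = 1 / (2 * of_real pi * \<i>) * contour_integral \<gamma> (\<lambda>w. f w * w ^ t * poly q (inverse w))"
    and "(\<lambda>w. f w * w ^ t * poly q (inverse w)) contour_integrable_on \<gamma>"
proof -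
  let ?c = "1 / (2 * of_real pi * \<i>)"
  have eq: "f w * w ^ t * poly q (inverse w) = (\<Sum>s\<le>t. Polynomial.coeff q s * (f w * w ^ (t - s)))" if "w \<in> path_image \<gamma>" for w
  proof -
    have "w \<noteq> 0" using that 0 by auto
    then have "f w * (w ^ t * poly q (inverse w)) = f w * (\<Sum>s\<le>t. Polynomial.coeff q s * w ^ (t - s))"
      using poly_inverse_mult_power[OF _ q] by simp
    then show ?thesis by (simp add: sum_distrib_left mult_ac)
  qed
  have int: "(\<lambda>w. Polynomial.coeff q s * (f w * w ^ (t - s))) contour_integrable_on \<gamma>" for s
    by (intro contour_integrable_lmul f)
  show "(\<lambda>w. f w * w ^ t * poly q (inverse w)) contour_integrable_on \<gamma>"
  proof (rule contour_integrable_eq)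
    show "(\<lambda>w. \<Sum>s\<le>t. Polynomial.coeff q s * (f w * w ^ (t - s))) contour_integrable_on \<gamma>"
      using int by (intro contour_integrable_sum) auto
  qed (simp add: eq)
  have "fps_nth (fps_of_poly q * moment_fps \<gamma> f) t
    = (\<Sum>s\<le>t. Polynomial.coeff q s * (?c * contour_integral \<gamma> (\<lambda>w. f w * w ^ (t - s))))"
    by (simp add: fps_mult_nth moment_fps_def atLeast0AtMost)
  also have "\<dots> = ?c * (\<Sum>s\<le>t. contour_integral \<gamma> (\<lambda>w. Polynomial.coeff q s * (f w * w ^ (t - s))))"
    unfolding contour_integral_lmul[OF f] sum_distrib_left by (simp only: mult_ac)
  also have "(\<Sum>s\<le>t. contour_integral \<gamma> (\<lambda>w. Polynomial.coeff q s * (f w * w ^ (t - s))))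
    = contour_integral \<gamma> (\<lambda>w. \<Sum>s\<le>t. Polynomial.coeff q s * (f w * w ^ (t - s)))"
    using int by (intro contour_integral_sum[symmetric]) auto
  also have "\<dots> = contour_integral \<gamma> (\<lambda>w. f w * w ^ t * poly q (inverse w))"
    by (rule contour_integral_eq) (simp add: eq)
  finally show "fps_nth (moment_fps \<gamma> f * fps_of_poly q) t
     = ?c * contour_integral \<gamma> (\<lambda>w. f w * w ^ t * poly q (inverse w))"
    by (simp only: mult.commute)
qed

locale aztec_contours = aztec_spectral +
  fixes \<gamma>1 \<gamma>01 :: "real \<Rightarrow> complex"
  assumes gamma1: "pos_contour_around \<gamma>1 {1}" and slit: "path_image \<gamma>1 \<inter> \<real>\<^sub>\<le>\<^sub>0 = {}"
    and gamma01: "pos_contour_around \<gamma>01 ({0} \<union> path_image \<gamma>1)"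
begin

lemma on_path:
  assumes "w \<in> path_image \<gamma>1"
  shows "w \<notin> \<real>\<^sub>\<le>\<^sub>0" "w \<noteq> 0" "w \<noteq> 1"
  using assms slit pos_contour_around_winding(2)[OF gamma1, of 1] by auto

lemma gamma01_all: "pos_contour_around \<gamma>01 ({1} \<union> ({0} \<union> path_image \<gamma>1))"
  by (rule pos_contour_around_nested[OF gamma1 gamma01]) auto

text \<open>The \<open>w\<close>-dependent factor of the double integral for
  \<open>N = 2 * h\<close>, apart from \<open>1 / (z - w)\<close>. It is written with powers of
  \<open>w - 1\<close> as denominators and \<open>proj_entry\<close> in place of \<open>E\<close>,
  so that its holomorphy off the slit and 1 can be seen.\<close>

definition moment_ker :: "nat \<Rightarrow> nat \<Rightarrow> int \<Rightarrow> nat \<Rightarrow> nat \<Rightarrow> complex \<Rightarrow> complex" where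
  "moment_ker h m' \<xi>' i l w = w powi \<xi>' * (w / (w - 1)) ^ (2 * h) * (num1 w / (w - 1)\<^sup>2) powi (int h - int m') * proj_entry i l w"

abbreviation hscal :: "nat \<Rightarrow> nat \<Rightarrow> int \<Rightarrow> complex \<Rightarrow> complex" where
  "hscal h m' \<xi>' w \<equiv> w powi \<xi>' / (1 - inverse w) ^ (2 * h) * \<rho>\<^sub>1 w powi (int h - int m')"

lemma moment_ker_holomorphic:
  assumes "i < 2" "l < 2"
  shows "moment_ker h m' \<xi>' i l holomorphic_on (- \<real>\<^sub>\<le>\<^sub>0) - {1}"
proof -
  have "proj_entry i l holomorphic_on (- \<real>\<^sub>\<le>\<^sub>0) - {1}" "num1 holomorphic_on (- \<real>\<^sub>\<le>\<^sub>0) - {1}"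
    using proj_entry_holomorphic[OF assms] num_holomorphic(1) by (auto elim: holomorphic_on_subset)
  then show ?thesis unfolding moment_ker_def by (intro holomorphic_intros) (auto simp: num1_nonzero)
qed

lemma moment_ker_integrable:
  assumes "i < 2" "l < 2"
  shows "(\<lambda>w. moment_ker h m' \<xi>' i l w * w ^ k) contour_integrable_on \<gamma>1"
proof (rule contour_integrable_holomorphic_simple)
  show "(\<lambda>w. moment_ker h m' \<xi>' i l w * w ^ k) holomorphic_on (- \<real>\<^sub>\<le>\<^sub>0) - {1}"
    by (intro holomorphic_intros moment_ker_holomorphic assms)
  show "open ((- \<real>\<^sub>\<le>\<^sub>0) - {1 :: complex})" by (intro open_Diff) auto
  show "valid_path \<gamma>1" using gamma1 by (rule pos_contour_around_closed)
  show "path_image \<gamma>1 \<subseteq> (- \<real>\<^sub>\<le>\<^sub>0) - {1}" using on_path by auto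
qed

lemma moment_ker_eq:
  assumes w: "w \<notin> \<real>\<^sub>\<le>\<^sub>0" "w \<noteq> 1" and "i < 2" "l < 2"
  shows "moment_ker h m' \<xi>' i l w = hscal h m' \<xi>' w * projm w $$ (i, l)"
proof -
  have "w \<noteq> 0" using w by auto
  then have "1 - inverse w = (w - 1) / w" by (simp add: field_simps)
  then have "(w / (w - 1)) ^ (2 * h) = 1 / (1 - inverse w) ^ (2 * h)" by (simp add: power_divide)
  then show ?thesis by (simp add: moment_ker_def rho_eq(1) projm_entry[OF w assms(3,4)] del: index_mult_mat)
qed

text \<open>A power of the adjugate contributes \<open>\<rho>\<^sub>2 ^ h\<close>, a power of
  \<open>A2B2\<close> contributes \<open>\<rho>\<^sub>1 ^ h\<close>; in both cases a nonnegative
  exponent remains.\<close>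

lemma rho1_powi_power:
  assumes "w \<notin> \<real>\<^sub>\<le>\<^sub>0" "w \<noteq> 1"
  shows "\<rho>\<^sub>1 w powi (int h - int m') * \<rho>\<^sub>2 w ^ h = \<rho>\<^sub>2 w ^ m'"
    and "m' \<le> 2 * h \<Longrightarrow> \<rho>\<^sub>1 w powi (int h - int m') * \<rho>\<^sub>1 w ^ h = \<rho>\<^sub>1 w ^ (2 * h - m')"
proof -
  note r = rho1_rho2[OF assms]
  have r2: "\<rho>\<^sub>2 w ^ k = \<rho>\<^sub>1 w powi (- int k)" for k
  proof -
    have "\<rho>\<^sub>2 w = inverse (\<rho>\<^sub>1 w)" using r by (simp add: field_simps)
    then show ?thesis using r by (simp add: power_int_minus power_inverse)
  qed
  show "\<rho>\<^sub>1 w powi (int h - int m') * \<rho>\<^sub>2 w ^ h = \<rho>\<^sub>2 w ^ m'"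
    unfolding r2 using r(2) by (simp flip: power_int_add)
  assume "m' \<le> 2 * h"
  then have "int h - int m' + int h = int (2 * h - m')" by simp
  moreover have "\<rho>\<^sub>1 w powi (int h - int m' + int h) = \<rho>\<^sub>1 w powi (int h - int m') * \<rho>\<^sub>1 w powi int h"
    by (rule power_int_add) (use r(2) in simp)
  ultimately show "\<rho>\<^sub>1 w powi (int h - int m') * \<rho>\<^sub>1 w ^ h = \<rho>\<^sub>1 w ^ (2 * h - m')"
    by (simp only: power_int_of_nat)
qed

definition moment_mat :: "nat \<Rightarrow> nat \<Rightarrow> int \<Rightarrow> complex fps mat" where
  "moment_mat h m' \<xi>' = Matrix.mat 2 2 (\<lambda>(i, l). moment_fps \<gamma>1 (moment_ker h m' \<xi>' i l))"

lemma moment_mat_carrier [simp]: "moment_mat h m' \<xi>' \<in> mats2"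
  by (simp add: moment_mat_def)

lemma moment_mat_mult_poly:
  assumes P: "degree_mat_le d P" and t: "d \<le> t" and ij: "i < 2" "j < 2"
  shows "fps_nth ((moment_mat h m' \<xi>' * fpsm P) $$ (i, j)) t
    = 1 / (2 * of_real pi * \<i>) * contour_integral \<gamma>1 (\<lambda>w. hscal h m' \<xi>' w * w ^ t * (projm w * evalp w P) $$ (i, j))"
proof -
  let ?c = "1 / (2 * of_real pi * \<i>)"
  have Pc: "P \<in> mats2" and deg: "\<And>l. l < 2 \<Longrightarrow> degree (P $$ (l, j)) \<le> t"
    using P t ij by (auto simp: degree_mat_le_def intro: order.trans)
  have 0: "0 \<notin> path_image \<gamma>1" using on_path(2) by blast
  note M = moment_fps_mult_poly[OF moment_ker_integrable[OF ij(1)] 0 deg]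
  have "fps_nth ((moment_mat h m' \<xi>' * fpsm P) $$ (i, j)) t =
     (fps_nth (moment_fps \<gamma>1 (moment_ker h m' \<xi>' i 0) * fps_of_poly (P $$ (0, j))) t
    + fps_nth (moment_fps \<gamma>1 (moment_ker h m' \<xi>' i (Suc 0)) * fps_of_poly (P $$ (Suc 0, j))) t)"
    using Pc ij by (simp add: mat_2_mult_index moment_mat_def del: index_mult_mat(1))
  also have "\<dots> = ?c * (contour_integral \<gamma>1 (\<lambda>w. moment_ker h m' \<xi>' i 0 w * w ^ t * poly (P $$ (0, j)) (inverse w)) +
      contour_integral \<gamma>1 (\<lambda>w. moment_ker h m' \<xi>' i (Suc 0) w * w ^ t * poly (P $$ (Suc 0, j)) (inverse w)))"
    by (simp add: M(1) distrib_left)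
  also have "contour_integral \<gamma>1 (\<lambda>w. moment_ker h m' \<xi>' i 0 w * w ^ t * poly (P $$ (0, j)) (inverse w)) +
      contour_integral \<gamma>1 (\<lambda>w. moment_ker h m' \<xi>' i (Suc 0) w * w ^ t * poly (P $$ (Suc 0, j)) (inverse w))
    = contour_integral \<gamma>1 (\<lambda>w. moment_ker h m' \<xi>' i 0 w * w ^ t * poly (P $$ (0, j)) (inverse w) +
        moment_ker h m' \<xi>' i (Suc 0) w * w ^ t * poly (P $$ (Suc 0, j)) (inverse w))"
    by (intro contour_integral_add[symmetric] M(2)) auto
  also have "\<dots> = contour_integral \<gamma>1 (\<lambda>w. hscal h m' \<xi>' w * w ^ t * (projm w * evalp w P) $$ (i, j))"
  proof (rule contour_integral_eq, goal_cases)
    case (1 w)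
    note w = on_path(1,3)[OF 1]
    have "(projm w * evalp w P) $$ (i, j)
      = projm w $$ (i, 0) * poly (P $$ (0, j)) (inverse w) + projm w $$ (i, Suc 0) * poly (P $$ (Suc 0, j)) (inverse w)"
      using Pc ij mat_2_mult_index[OF projm_carrier[OF w], of "evalp w P" i j] by simp
    then show ?case using ij by (simp add: moment_ker_eq[OF w] algebra_simps del: index_mult_mat)
  qed
  finally show ?thesis .
qed

section \<open>The two coefficient identities behind the linear system\<close>

text \<open>\<open>2 * h\<close> bounds the degree of the polynomial matrix, which therefore acts
  under the integral. Its scalar on the projection cancels the denominator
  \<open>(1 - 1/w) ^ (2 * h)\<close> and leaves a power of \<open>\<rho>\<^sub>2\<close>, so
  Cauchy's theorem applies in the whole slit plane.\<close>

lemma adjA2B2_truncates: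
  assumes t: "2 * h \<le> t" and ij: "i < 2" "j < 2"
  shows "fps_nth ((moment_mat h m' \<xi>' * fpsm (adjA2B2p ^\<^sub>m h)) $$ (i, j)) t = 0"
proof -
  have deg: "degree_mat_le (2 * h) (adjA2B2p ^\<^sub>m h)"
    using degree_mat_le_pow[OF degree_adjA2B2_poly, of h] by (simp add: mult.commute)
  let ?f = "\<lambda>w. w powi \<xi>' * ((w - 1)\<^sup>2 / num1 w) ^ m' * w ^ t * proj_entry i j w"
  have "contour_integral \<gamma>1 (\<lambda>w. hscal h m' \<xi>' w * w ^ t * (projm w * evalp w (adjA2B2p ^\<^sub>m h)) $$ (i, j)) = contour_integral \<gamma>1 ?f"
  proof (rule contour_integral_eq, goal_cases)
    case (1 w)
    note w = on_path(1,3)[OF 1]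
    have y: "1 - inverse w \<noteq> 0" using inverse_neq_1[OF w(2)] by simp
    have "evalp w (adjA2B2p ^\<^sub>m h) = adjA2B2_at w ^\<^sub>m h"
      by (simp only: poly_eval_hom.mat_hom_pow[OF poly_mats_carrier(2)] eval_adjA2B2_poly)
    then have "(projm w * evalp w (adjA2B2p ^\<^sub>m h)) $$ (i, j)
       = ((1 - inverse w) ^ (2 * h) * \<rho>\<^sub>2 w ^ h) * proj_entry i j w"
      using carrier_matD[OF projm_carrier[OF w]] ij
      by (simp only: projm_adjA2B2_pow[OF w] projm_entry[OF w ij] index_smult_mat)
    moreover have "hscal h m' \<xi>' w * w ^ t
         * (((1 - inverse w) ^ (2 * h) * \<rho>\<^sub>2 w ^ h) * proj_entry i j w)
       = w powi \<xi>' * (\<rho>\<^sub>1 w powi (int h - int m') * \<rho>\<^sub>2 w ^ h) * w ^ t * proj_entry i j w"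
      using y by simp
    ultimately show ?case
      by (simp only: rho1_powi_power(1)[OF w, unfolded rho2_alt[OF w]] rho2_alt[OF w])
  qed
  also have "\<dots> = 0"
  proof (rule contour_integral_unique, rule contour_integral_slit_plane_eq_0)
    show "?f holomorphic_on - \<real>\<^sub>\<le>\<^sub>0"
      by (intro holomorphic_intros num_holomorphic proj_entry_holomorphic ij) (auto simp: num1_nonzero)
  qed (use gamma1 slit in \<open>auto intro: pos_contour_around_closed\<close>)
  finally show ?thesis by (simp only: moment_mat_mult_poly[OF deg t ij] mult_zero_right)
qed

lemma Phi_pow_integrand:
  assumes z: "z \<noteq> 1"
  shows "(\<Phi> z ^\<^sub>m p) = (1 / (1 - inverse z)\<^sup>2) ^ p \<cdot>\<^sub>m evalp z (A2B2p ^\<^sub>m p)"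
  by (simp only: poly_eval_hom.mat_hom_pow[OF poly_mats_carrier(1)] eval_A2B2_poly aztec_Phi_eq[OF \<alpha>\<beta>] smult_pow_mat[OF A2B2_carrier])

lemma pow_entry_dims:
  assumes "i < 2" "j < 2"
  shows "i < dim_row (map_mat f (A2B2p ^\<^sub>m p))" "j < dim_col (map_mat f (A2B2p ^\<^sub>m p))"
  using assms carrier_matD[OF pow_carrier_mat[OF poly_mats_carrier(1)], of \<alpha> \<beta> p] by simp_all

lemma Phi_pow_entry_poly:
  assumes z: "z \<noteq> 1" and ij: "i < 2" "j < 2"
  shows "(\<Phi> z ^\<^sub>m p) $$ (i, j) = (1 / (1 - inverse z)\<^sup>2) ^ p * poly ((A2B2p ^\<^sub>m p) $$ (i, j)) (inverse z)"
  unfolding Phi_pow_integrand[OF z] using pow_entry_dims[OF ij, of _ p] by simp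

lemma eval_Phi_pow_entry:
  assumes z: "norm z > 1" and ij: "i < 2" "j < 2"
  shows "(\<Phi> z ^\<^sub>m p) $$ (i, j) = eval_fps ((\<Phi>F ^\<^sub>m p) $$ (i, j)) (inverse z)"
proof -
  have x: "norm (inverse z) < 1" using z by (simp add: norm_inverse inverse_less_1_iff)
  have "\<Phi> z ^\<^sub>m p = eval_fps_mat (\<Phi>F ^\<^sub>m p) (inverse z)"
    unfolding eval_fps_mat_pow[OF Phi_fps_ok x] eval_Phi_fps[OF \<alpha>\<beta> z] ..
  moreover have "dim_row (\<Phi>F ^\<^sub>m p) = 2" "dim_col (\<Phi>F ^\<^sub>m p) = 2"
    using carrier_matD[OF pow_carrier_mat[OF Phi_fps_carrier]] by simp_all
  ultimately show ?thesis using ij by simp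
qed

lemma conv_pos: "fps_mat_ok F \<Longrightarrow> i < 2 \<Longrightarrow> j < 2 \<Longrightarrow> fps_conv_radius (F $$ (i, j)) > 0"
  unfolding fps_mat_ok_def by (auto intro: less_le_trans[of _ 1])

text \<open>For \<open>d \<ge> 0\<close> the integrand is a polynomial divided by a power of
  \<open>w - 1\<close>. With 1 as its only possible pole, already \<open>\<gamma>1\<close>, which
  leaves out 0, yields a Laurent coefficient at infinity.\<close>

lemma contour_integral_Phi_pow_gamma1:
  assumes ij: "i < 2" "j < 2" and d: "d \<ge> 0"
  shows "contour_integral \<gamma>1 (\<lambda>w. w powi d * (\<Phi> w ^\<^sub>m p) $$ (i, j))
     = 2 * of_real pi * \<i> * fps_nth ((\<Phi>F ^\<^sub>m p) $$ (i, j)) (nat (d + 1))"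
proof -
  define q where "q = (A2B2p ^\<^sub>m p) $$ (i, j)"
  have q: "degree q \<le> 2 * p"
    using degree_mat_le_pow[OF degree_A2B2_poly, of p] ij unfolding degree_mat_le_def q_def by (simp add: mult.commute)
  define g where "g w = w powi d * (\<Sum>s\<le>2 * p. Polynomial.coeff q s * w ^ (2 * p - s)) / (w - 1) ^ (2 * p)" for w
  have g: "g w = w powi d * (\<Phi> w ^\<^sub>m p) $$ (i, j)" if "w \<noteq> 0" "w \<noteq> 1" for w
  proof -
    have "1 - inverse w = (w - 1) / w" using that by (simp add: field_simps)
    then have "(1 / (1 - inverse w)\<^sup>2) ^ p = w ^ (2 * p) / (w - 1) ^ (2 * p)"
      by (simp add: power_divide power_mult)
    moreover have "(\<Phi> w ^\<^sub>m p) $$ (i, j) = (1 / (1 - inverse w)\<^sup>2) ^ p * poly q (inverse w)"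
      by (simp only: Phi_pow_entry_poly[OF that(2) ij] q_def)
    ultimately show ?thesis unfolding g_def poly_inverse_mult_power[OF that(1) q, symmetric] by simp
  qed
  have "contour_integral \<gamma>1 (\<lambda>w. w powi d * (\<Phi> w ^\<^sub>m p) $$ (i, j)) = contour_integral \<gamma>1 g"
    by (rule contour_integral_eq) (simp add: g on_path)
  also have "\<dots> = 2 * of_real pi * \<i> * (if d + 1 \<ge> 0 then fps_nth ((\<Phi>F ^\<^sub>m p) $$ (i, j)) (nat (d + 1)) else 0)"
  proof (rule contour_integral_laurent_coeff[where P = "{1}"])
    show "g holomorphic_on - {1}" unfolding g_def using d by (intro holomorphic_intros) auto
    show "eventually (\<lambda>z. g z = z powi d * eval_fps ((\<Phi>F ^\<^sub>m p) $$ (i, j)) (inverse z)) at_infinity"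
      unfolding eventually_at_infinity
    proof (intro exI[of _ 2] allI impI)
      fix z :: complex assume "2 \<le> norm z"
      then have z: "norm z > 1" by simp
      then have "z \<noteq> 0" "z \<noteq> 1" by auto
      then show "g z = z powi d * eval_fps ((\<Phi>F ^\<^sub>m p) $$ (i, j)) (inverse z)"
        by (simp add: g eval_Phi_pow_entry[OF z ij])
    qed
  qed (use gamma1 pos_contour_around_winding[OF gamma1, of 1] conv_pos[OF fps_mat_ok_pow[OF Phi_fps_ok] ij] in \<open>auto intro: pos_contour_around_closed\<close>)
  finally show ?thesis using d by simp
qed

text \<open>\<open>\<rho>\<^sub>1 ^ p\<close> times the projection is \<open>\<Phi> ^ p\<close>
  minus \<open>\<rho>\<^sub>2 ^ p\<close> times the complementary projection, and the latter
  integrates to 0. The bounds on \<open>t\<close> and \<open>\<xi>'\<close> make the exponent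
  \<open>\<xi>' + t\<close> nonnegative, so no pole at 0 is missed.\<close>

lemma A2B2_coefficients:
  assumes t: "2 * h \<le> t" and ij: "i < 2" "j < 2" and m': "0 < m'" "m' < 2 * h" and \<xi>': "- int (2 * h) \<le> \<xi>'"
  shows "fps_nth ((moment_mat h m' \<xi>' * fpsm (A2B2p ^\<^sub>m h)) $$ (i, j)) t
     = fps_nth ((\<Phi>F ^\<^sub>m (2 * h - m')) $$ (i, j)) (nat (int t + \<xi>' + 1))"
proof -
  define p where "p = 2 * h - m'"
  have deg: "degree_mat_le (2 * h) (A2B2p ^\<^sub>m h)"
    using degree_mat_le_pow[OF degree_A2B2_poly, of h] by (simp add: mult.commute)
  have d: "\<xi>' + int t \<ge> 0" using t \<xi>' by simp
  let ?f = "\<lambda>w. w powi \<xi>' * w ^ t * (((w - 1)\<^sup>2 / num1 w) ^ p * ((if i = j then 1 else 0) - proj_entry i j w))"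
  let ?g = "\<lambda>w. w powi (\<xi>' + int t) * (\<Phi> w ^\<^sub>m p) $$ (i, j)"
  have f0: "(?f has_contour_integral 0) \<gamma>1"
  proof (rule contour_integral_slit_plane_eq_0)
    show "?f holomorphic_on - \<real>\<^sub>\<le>\<^sub>0"
      by (intro holomorphic_intros num_holomorphic proj_entry_holomorphic ij) (auto simp: num1_nonzero)
  qed (use gamma1 slit in \<open>auto intro: pos_contour_around_closed\<close>)
  have g_int: "?g contour_integrable_on \<gamma>1"
  proof (rule contour_integrable_holomorphic_simple)
    show "?g holomorphic_on - {0, 1}"
    proof (rule holomorphic_transform)
      show "(\<lambda>w. w powi (\<xi>' + int t) * ((1 / (1 - inverse w)\<^sup>2) ^ p * poly ((A2B2p ^\<^sub>m p) $$ (i, j)) (inverse w))) holomorphic_on - {0, 1}"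
        by (intro holomorphic_intros poly_inverse_holomorphic) (use inverse_neq_1 in force)+
    qed (simp add: Phi_pow_entry_poly[OF _ ij])
    show "valid_path \<gamma>1" using gamma1 by (rule pos_contour_around_closed)
    show "path_image \<gamma>1 \<subseteq> - {0, 1}" using on_path by auto
  qed (auto intro!: open_Compl finite_imp_closed)
  have "contour_integral \<gamma>1 (\<lambda>w. hscal h m' \<xi>' w * w ^ t * (projm w * evalp w (A2B2p ^\<^sub>m h)) $$ (i, j))
     = contour_integral \<gamma>1 (\<lambda>w. ?g w - ?f w)"
  proof (rule contour_integral_eq, goal_cases)
    case (1 w)
    note w = on_path(1,3)[OF 1]
    have y: "1 - inverse w \<noteq> 0" using inverse_neq_1[OF w(2)] by simp
    have "evalp w (A2B2p ^\<^sub>m h) = A2B2_at w ^\<^sub>m h"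
      by (simp only: poly_eval_hom.mat_hom_pow[OF poly_mats_carrier(1)] eval_A2B2_poly)
    then have e: "(projm w * evalp w (A2B2p ^\<^sub>m h)) $$ (i, j)
       = ((1 - inverse w) ^ (2 * h) * \<rho>\<^sub>1 w ^ h) * projm w $$ (i, j)"
      using carrier_matD[OF projm_carrier[OF w]] ij by (simp only: projm_A2B2_pow[OF w] index_smult_mat)
    have "hscal h m' \<xi>' w * w ^ t
         * (((1 - inverse w) ^ (2 * h) * \<rho>\<^sub>1 w ^ h) * projm w $$ (i, j))
       = w powi \<xi>' * w ^ t * ((\<rho>\<^sub>1 w powi (int h - int m') * \<rho>\<^sub>1 w ^ h) * projm w $$ (i, j))"
      using y by simp
    also have "(\<rho>\<^sub>1 w powi (int h - int m') * \<rho>\<^sub>1 w ^ h) * projm w $$ (i, j) = \<rho>\<^sub>1 w ^ p * projm w $$ (i, j)"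
      using rho1_powi_power(2)[OF w] m' by (simp only: p_def less_imp_le)
    also have "\<dots> = (\<Phi> w ^\<^sub>m p) $$ (i, j) - ((w - 1)\<^sup>2 / num1 w) ^ p * ((if i = j then 1 else 0) - proj_entry i j w)"
      unfolding Phi_pow_entry[OF w ij] rho2_alt[OF w] projm_entry[OF w ij] by simp
    also have "w powi \<xi>' * w ^ t * \<dots> = ?g w - ?f w"
      using on_path(2)[OF 1] by (simp add: power_int_add right_diff_distrib)
    finally show ?case unfolding e .
  qed
  also have "\<dots> = contour_integral \<gamma>1 ?g"
    using contour_integral_diff[OF g_int has_contour_integral_integrable[OF f0]] contour_integral_unique[OF f0] by simp
  also have "\<dots> = 2 * of_real pi * \<i> * fps_nth ((\<Phi>F ^\<^sub>m p) $$ (i, j)) (nat (\<xi>' + int t + 1))"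
    by (rule contour_integral_Phi_pow_gamma1[OF ij d])
  finally show ?thesis unfolding moment_mat_mult_poly[OF deg t ij] p_def by (simp add: add.commute)
qed

end


section \<open>The kernel\<close>

context aztec_contours
begin

abbreviation integrand :: "nat \<Rightarrow> nat \<Rightarrow> nat \<Rightarrow> int \<Rightarrow> int \<Rightarrow> nat \<Rightarrow> nat \<Rightarrow> complex \<Rightarrow> complex \<Rightarrow> complex" where
  "integrand h m m' \<xi> \<xi>' i j w z \<equiv> w powi \<xi>' / z powi (\<xi> + 1)
           * (\<rho>\<^sub>1 w powi (int h - int m') / (z - w)) * ((1 - inverse z) ^ (2 * h) / (1 - inverse w) ^ (2 * h))
           * (projm w * mat_powi (\<Phi> z) (int m - int h)) $$ (i, j)"

text \<open>The \<open>z\<close>-dependent matrix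
  \<open>(1 - 1/z) ^ (2 * h) * \<Phi> ^ (m - h)\<close> of the kernel, expanded in
  \<open>1/z\<close>; \<open>outer_mat\<close> is the corresponding function of
  \<open>z\<close>.\<close>

definition outer_fps :: "nat \<Rightarrow> nat \<Rightarrow> complex fps mat" where
  "outer_fps h m = fpsm (adjA2B2p ^\<^sub>m h) * \<Phi>F ^\<^sub>m m"

definition outer_mat :: "nat \<Rightarrow> nat \<Rightarrow> complex \<Rightarrow> complex mat" where
  "outer_mat h m z = adjA2B2_at z ^\<^sub>m h * \<Phi> z ^\<^sub>m m"

lemma pow_carriers [simp]:
  "adjA2B2p ^\<^sub>m h \<in> mats2" "A2B2p ^\<^sub>m h \<in> mats2"
  "\<Phi>F ^\<^sub>m h \<in> mats2" "\<Phi> z ^\<^sub>m h \<in> mats2" "adjA2B2 a b x ^\<^sub>m h \<in> mats2"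
  using \<alpha>\<beta> by (auto intro: pow_carrier_mat)

lemma outer_fps_carrier [simp]: "outer_fps h m \<in> mats2"
  and outer_mat_carrier [simp]: "outer_mat h m z \<in> mats2"
  unfolding outer_fps_def outer_mat_def by (auto intro!: mult_carrier_mat[of _ 2 2])

lemma outer_fps_ok: "fps_mat_ok (outer_fps h m)"
  unfolding outer_fps_def by (intro fps_mat_ok_mult poly_mat_ok fps_mat_ok_pow Phi_fps_ok) simp

lemma eval_Wmat:
  assumes z: "norm z > 1" and ij: "i < 2" "j < 2"
  shows "eval_fps (outer_fps h m $$ (i, j)) (inverse z) = outer_mat h m z $$ (i, j)"
proof -
  have x: "norm (inverse z) < 1" using z by (simp add: norm_inverse inverse_less_1_iff)
  have "eval_fps_mat (outer_fps h m) (inverse z) = outer_mat h m z" unfolding outer_fps_def outer_mat_def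
      eval_fps_mat_mult[OF poly_mat_ok[OF pow_carriers(1)] fps_mat_ok_pow[OF Phi_fps_ok] x]
      eval_fps_mat_pow[OF Phi_fps_ok x] eval_Phi_fps[OF \<alpha>\<beta> z] eval_poly_mat
      poly_eval_hom.mat_hom_pow[OF poly_mats_carrier(2)] eval_adjA2B2_poly ..
  then have "eval_fps_mat (outer_fps h m) (inverse z) $$ (i, j) = outer_mat h m z $$ (i, j)" by simp
  then show ?thesis using ij carrier_matD[OF outer_fps_carrier, of h m] by simp
qed

lemma outer_mat_poly:
  assumes z: "z \<noteq> 1" and ij: "i < 2" "j < 2"
  shows "outer_mat h m z $$ (i, j) = (1 / (1 - inverse z)\<^sup>2) ^ m * poly ((adjA2B2p ^\<^sub>m h * A2B2p ^\<^sub>m m) $$ (i, j)) (inverse z)"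
proof -
  let ?A = "evalp z (adjA2B2p ^\<^sub>m h)" and ?C = "evalp z (A2B2p ^\<^sub>m m)"
  have A: "?A \<in> mats2" and C: "?C \<in> mats2" by simp_all
  have "outer_mat h m z = ?A * ((1 / (1 - inverse z)\<^sup>2) ^ m \<cdot>\<^sub>m ?C)"
    unfolding outer_mat_def Phi_pow_integrand[OF z]
    by (simp only: poly_eval_hom.mat_hom_pow[OF poly_mats_carrier(2)] eval_adjA2B2_poly)
  also have "\<dots> = (1 / (1 - inverse z)\<^sup>2) ^ m \<cdot>\<^sub>m (?A * ?C)"
    by (rule mult_smult_distrib[OF A C])
  also have "?A * ?C = evalp z (adjA2B2p ^\<^sub>m h * A2B2p ^\<^sub>m m)"
    by (rule poly_eval_hom.mat_hom_mult[OF pow_carriers(1,2), symmetric])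
  finally show ?thesis
    using ij carrier_matD[OF mult_carrier_mat[OF pow_carriers(1,2)], of h m] by (simp del: index_mult_mat(1))
qed

section \<open>Evaluation of the contour integrals of the kernel\<close>

lemma gamma01_facts:
  "valid_path \<gamma>01" "pathfinish \<gamma>01 = pathstart \<gamma>01"
  "p \<in> {0, 1} \<union> path_image \<gamma>1 \<Longrightarrow> winding_number \<gamma>01 p = 1"
  "p \<in> {0, 1} \<union> path_image \<gamma>1 \<Longrightarrow> p \<notin> path_image \<gamma>01"
  using pos_contour_around_closed[OF gamma01] pos_contour_around_winding[OF gamma01_all, of p] by auto

lemma contour_integral_single:
  assumes ij: "i < 2" "j < 2" and m: "m' < m"
  shows "contour_integral \<gamma>01 (\<lambda>z. mat_powi (\<Phi> z) (int m - int m') $$ (i, j) * z powi (\<xi>' - \<xi>) / z)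
     = 2 * of_real pi * \<i> * (if \<xi>' \<ge> \<xi> then fps_nth ((\<Phi>F ^\<^sub>m (m - m')) $$ (i, j)) (nat (\<xi>' - \<xi>)) else 0)"
proof -
  define p where "p = m - m'"
  have mp: "mat_powi (\<Phi> z) (int m - int m') = \<Phi> z ^\<^sub>m p" for z
    using m by (simp add: mat_powi_def p_def nat_diff_distrib)
  let ?g = "\<lambda>z. (\<Phi> z ^\<^sub>m p) $$ (i, j) * z powi (\<xi>' - \<xi>) / z"
  have "contour_integral \<gamma>01 ?g = 2 * of_real pi * \<i> *
     (if \<xi>' - \<xi> - 1 + 1 \<ge> 0 then fps_nth ((\<Phi>F ^\<^sub>m p) $$ (i, j)) (nat (\<xi>' - \<xi> - 1 + 1)) else 0)"
  proof (rule contour_integral_laurent_coeff[where P = "{0, 1}"])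
    show "?g holomorphic_on - {0, 1}"
    proof (rule holomorphic_transform)
      show "(\<lambda>z. (1 / (1 - inverse z)\<^sup>2) ^ p * poly ((A2B2p ^\<^sub>m p) $$ (i, j)) (inverse z) * z powi (\<xi>' - \<xi>) / z) holomorphic_on - {0, 1}"
        by (intro holomorphic_intros poly_inverse_holomorphic) (use inverse_neq_1 in force)+
    qed (simp add: Phi_pow_entry_poly[OF _ ij])
    show "eventually (\<lambda>z. ?g z = z powi (\<xi>' - \<xi> - 1) * eval_fps ((\<Phi>F ^\<^sub>m p) $$ (i, j)) (inverse z)) at_infinity"
      unfolding eventually_at_infinity
    proof (intro exI[of _ 2] allI impI)
      fix z :: complex assume "2 \<le> norm z"
      then have z: "norm z > 1" by simp
      then have "z \<noteq> 0" by auto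
      then show "?g z = z powi (\<xi>' - \<xi> - 1) * eval_fps ((\<Phi>F ^\<^sub>m p) $$ (i, j)) (inverse z)"
        by (simp add: eval_Phi_pow_entry[OF z ij] power_int_diff)
    qed
  qed (use gamma01_facts conv_pos[OF fps_mat_ok_pow[OF Phi_fps_ok] ij] in auto)
  then show ?thesis by (simp add: mp p_def)
qed

text \<open>For fixed \<open>w\<close>, \<open>z powi (-\<xi> - 1) / (z - w)\<close> is
  \<open>z powi (-\<xi> - 2)\<close> times the geometric series in \<open>w/z\<close>, so the
  integral is coefficient \<open>-\<xi> - 1\<close> of a Cauchy product. The powers of
  \<open>w\<close> in it become moments when \<open>w\<close> is integrated.\<close>

lemma contour_integral_inner:
  assumes w: "w \<in> path_image \<gamma>1" and ij: "i < 2" "j < 2" and \<xi>: "\<xi> \<le> -1"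
  shows "contour_integral \<gamma>01 (\<lambda>z. integrand h m m' \<xi> \<xi>' i j w z)
     = 2 * of_real pi * \<i> * (\<Sum>s\<le>nat (- \<xi> - 1). (moment_ker h m' \<xi>' i 0 w * fps_nth (outer_fps h m $$ (0, j)) s
          + moment_ker h m' \<xi>' i (Suc 0) w * fps_nth (outer_fps h m $$ (Suc 0, j)) s) * w ^ (nat (- \<xi> - 1) - s))"
proof -
  note w1 = on_path(1,3)[OF w]
  have w0: "w \<noteq> 0" by (rule on_path(2)[OF w])
  let ?H = "\<lambda>l. moment_ker h m' \<xi>' i l w"
  let ?g = "\<lambda>z. z powi (- \<xi> - 1) / (z - w) * (?H 0 * outer_mat h m z $$ (0, j) + ?H (Suc 0) * outer_mat h m z $$ (Suc 0, j))"
  define G where "G = fps_const (?H 0) * outer_fps h m $$ (0, j) + fps_const (?H (Suc 0)) * outer_fps h m $$ (Suc 0, j)"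
  define W where "W = Abs_fps (\<lambda>k. w ^ k)"
  have conv: "fps_conv_radius (outer_fps h m $$ (l, j)) \<ge> 1" if "l < 2" for l
    using outer_fps_ok that ij by (auto simp: fps_mat_ok_def)
  have convG: "fps_conv_radius G \<ge> 1"
    unfolding G_def by (intro fps_conv_radius_add_ge fps_conv_radius_mult_ge conv) auto
  have convW: "fps_conv_radius W \<ge> ereal (1 / norm w)"
    unfolding W_def by (rule conv_radius_geo[OF w0])
  have "contour_integral \<gamma>01 (\<lambda>z. integrand h m m' \<xi> \<xi>' i j w z) = contour_integral \<gamma>01 ?g"
  proof (rule contour_integral_eq, goal_cases)
    case (1 z)
    then have z: "z \<noteq> 1" "z \<noteq> 0" using gamma01_facts(4)[of 1] gamma01_facts(4)[of 0] by auto
    have U: "outer_mat h m z = (1 - inverse z) ^ (2 * h) \<cdot>\<^sub>m mat_powi (\<Phi> z) (int m - int h)"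
      unfolding outer_mat_def by (rule adjA2B2_pow_aztec_Phi_pow[OF \<alpha>\<beta> z(1)])
    have mpc: "mat_powi (\<Phi> z) (int m - int h) \<in> mats2"
    proof (rule carrier_matI)
      show "dim_row (mat_powi (\<Phi> z) (int m - int h)) = 2"
        using carrier_matD(1)[OF outer_mat_carrier, of h m z] by (simp only: U index_smult_mat)
      show "dim_col (mat_powi (\<Phi> z) (int m - int h)) = 2"
        using carrier_matD(2)[OF outer_mat_carrier, of h m z] by (simp only: U index_smult_mat)
    qed
    have "(1 - inverse z) ^ (2 * h) * (projm w * mat_powi (\<Phi> z) (int m - int h)) $$ (i, j) = (projm w * outer_mat h m z) $$ (i, j)"
      unfolding U mult_smult_distrib[OF projm_carrier[OF w1] mpc]
      using ij carrier_matD[OF projm_carrier[OF w1]] carrier_matD[OF mpc] by simp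
    also have "\<dots> = projm w $$ (i, 0) * outer_mat h m z $$ (0, j) + projm w $$ (i, Suc 0) * outer_mat h m z $$ (Suc 0, j)"
      by (rule mat_2_mult_index[OF projm_carrier[OF w1] outer_mat_carrier ij])
    finally have eq: "(1 - inverse z) ^ (2 * h) * (projm w * mat_powi (\<Phi> z) (int m - int h)) $$ (i, j) = \<dots>" .
    have zp: "z powi (- \<xi> - 1) = 1 / z powi (\<xi> + 1)"
    proof -
      have "- \<xi> - 1 = - (\<xi> + 1)" by simp
      then show ?thesis by (simp only: power_int_minus divide_inverse mult_1)
    qed
    have "integrand h m m' \<xi> \<xi>' i j w z
       = 1 / z powi (\<xi> + 1) / (z - w) * (w powi \<xi>' / (1 - inverse w) ^ (2 * h) * \<rho>\<^sub>1 w powi (int h - int m'))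
         * ((1 - inverse z) ^ (2 * h) * (projm w * mat_powi (\<Phi> z) (int m - int h)) $$ (i, j))"
      by (simp only: divide_inverse mult_ac mult_1_left)
    also have "\<dots> = ?g z"
      unfolding eq zp using ij by (simp add: moment_ker_eq[OF w1] algebra_simps del: index_mult_mat)
    finally show ?case .
  qed
  also have "\<dots> = 2 * of_real pi * \<i> * (if - \<xi> - 2 + 1 \<ge> 0 then fps_nth (G * W) (nat (- \<xi> - 2 + 1)) else 0)"
  proof (rule contour_integral_laurent_coeff[where P = "{0, 1, w}"])
    have U: "(\<lambda>z. outer_mat h m z $$ (l, j)) holomorphic_on - {0, 1, w}" if "l < 2" for l
    proof (rule holomorphic_transform)
      show "(\<lambda>z. (1 / (1 - inverse z)\<^sup>2) ^ m * poly ((adjA2B2p ^\<^sub>m h * A2B2p ^\<^sub>m m) $$ (l, j)) (inverse z)) holomorphic_on - {0, 1, w}"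
        by (intro holomorphic_intros poly_inverse_holomorphic) (use inverse_neq_1 in force)+
    qed (use that ij in \<open>simp add: outer_mat_poly\<close>)
    show "?g holomorphic_on - {0, 1, w}" by (intro holomorphic_intros U) auto
    have "0 < min (1 :: ereal) (ereal (1 / norm w))" using w0 by simp
    also have "\<dots> \<le> fps_conv_radius (G * W)"
      by (rule fps_conv_radius_mult_ge) (use convG convW in \<open>auto intro: order.trans[rotated]\<close>)
    finally show "fps_conv_radius (G * W) > 0" .
    show "eventually (\<lambda>z. ?g z = z powi (- \<xi> - 2) * eval_fps (G * W) (inverse z)) at_infinity"
      unfolding eventually_at_infinity
    proof (intro exI[of _ "2 + norm w"] allI impI)
      fix z :: complex assume z2: "2 + norm w \<le> norm z"
      then have z: "norm z > 1" "norm z > norm w" by (simp_all add: add_pos_nonneg) (use norm_ge_zero[of w] in linarith)+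
      then have z0: "z \<noteq> 0" "z \<noteq> w" by auto
      have x1: "ereal (norm (inverse z)) < 1" using z by (simp add: norm_inverse inverse_less_1_iff one_ereal_def)
      have x2: "norm (inverse z) < 1 / norm w"
      proof -
        have "inverse (norm z) < inverse (norm w)" using z(2) w0 by (intro less_imp_inverse_less) auto
        then show ?thesis unfolding norm_inverse by (simp only: inverse_eq_divide)
      qed
      then have x3: "norm (inverse z) * norm w < 1" using w0 by (subst (asm) pos_less_divide_eq) simp_all
      have rW: "ereal (norm (inverse z)) < fps_conv_radius W"
        using x2 by (intro less_le_trans[OF _ convW]) (simp only: less_ereal.simps)
      have rG: "ereal (norm (inverse z)) < fps_conv_radius G" using x1 convG by (rule less_le_trans)
      have rl: "ereal (norm (inverse z)) < fps_conv_radius (outer_fps h m $$ (l, j))" if "l < 2" for l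
        using x1 conv[OF that] by (rule less_le_trans)
      have rcl: "ereal (norm (inverse z)) < fps_conv_radius (fps_const c * outer_fps h m $$ (l, j))" if "l < 2" for l c
        using rl[OF that] fps_conv_radius_mult_ge[of "fps_conv_radius (outer_fps h m $$ (l, j))" "fps_const c" "outer_fps h m $$ (l, j)"]
        by (auto intro: less_le_trans)
      have "eval_fps (G * W) (inverse z) = eval_fps G (inverse z) * eval_fps W (inverse z)"
        by (rule eval_fps_mult[OF rG rW])
      also have "eval_fps G (inverse z) = ?H 0 * outer_mat h m z $$ (0, j) + ?H (Suc 0) * outer_mat h m z $$ (Suc 0, j)"
        unfolding G_def using ij z by (simp add: eval_fps_add rcl eval_fps_mult rl eval_Wmat)
      also have "eval_fps W (inverse z) = 1 / (1 - w * inverse z)"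
        unfolding W_def by (rule eval_geometric_fps) (use x3 in \<open>simp only: norm_mult mult.commute\<close>)
      finally have e: "eval_fps (G * W) (inverse z) = (?H 0 * outer_mat h m z $$ (0, j) + ?H (Suc 0) * outer_mat h m z $$ (Suc 0, j)) * (1 / (1 - w * inverse z))" .
      have "z powi (- \<xi> - 1) = z powi (- \<xi> - 2) * z"
      proof -
        have "- \<xi> - 1 = - \<xi> - 2 + 1" by simp
        then show ?thesis using z0 by (simp only: power_int_add_1 simp_thms)
      qed
      moreover have "z / (z - w) = 1 / (1 - w * inverse z)" using z0 by (simp add: field_simps)
      ultimately have "z powi (- \<xi> - 1) / (z - w) = z powi (- \<xi> - 2) * (1 / (1 - w * inverse z))"
        by (metis times_divide_eq_right)
      then show "?g z = z powi (- \<xi> - 2) * eval_fps (G * W) (inverse z)"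
        unfolding e by (simp only: mult_ac)
    qed
  qed (use gamma01_facts w in auto)
  also have "(if - \<xi> - 2 + 1 \<ge> 0 then fps_nth (G * W) (nat (- \<xi> - 2 + 1)) else 0) = fps_nth (G * W) (nat (- \<xi> - 1))"
  proof -
    have "- \<xi> - 2 + 1 = - \<xi> - 1" by simp
    then show ?thesis using \<xi> by (simp only:) simp
  qed
  also have "\<dots> = (\<Sum>s\<le>nat (- \<xi> - 1). (?H 0 * fps_nth (outer_fps h m $$ (0, j)) s
          + ?H (Suc 0) * fps_nth (outer_fps h m $$ (Suc 0, j)) s) * w ^ (nat (- \<xi> - 1) - s))"
  proof -
    have "fps_nth G s = ?H 0 * fps_nth (outer_fps h m $$ (0, j)) s + ?H (Suc 0) * fps_nth (outer_fps h m $$ (Suc 0, j)) s" for s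
      by (simp add: G_def)
    then show ?thesis by (simp add: fps_mult_nth W_def atLeast0AtMost)
  qed
  finally show ?thesis .
qed

text \<open>Integrating the finite Cauchy product over \<open>w\<close> puts moments in place of the
  powers of \<open>w\<close> and reassembles one coefficient of
  \<open>moment_mat * outer_fps\<close>. In this form the kernel can be compared with path
  weights.\<close>

lemma aztec_kernel_eq:
  assumes ij: "i < 2" "j < 2" and \<xi>: "\<xi> \<le> -1"
  shows "aztec_kernel \<alpha> \<beta> (2 * h) S E \<gamma>1 \<gamma>01 m \<xi> j m' \<xi>' i
    = - (if m > m' \<and> \<xi>' \<ge> \<xi> then fps_nth ((\<Phi>F ^\<^sub>m (m - m')) $$ (i, j)) (nat (\<xi>' - \<xi>)) else 0)
      + fps_nth ((moment_mat h m' \<xi>' * outer_fps h m) $$ (i, j)) (nat (- \<xi> - 1))"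
proof -
  define e where "e = nat (- \<xi> - 1)"
  let ?c = "2 * of_real pi * \<i>"
  let ?W = "\<lambda>l s. fps_nth (outer_fps h m $$ (l, j)) s"
  let ?H = "\<lambda>l w. moment_ker h m' \<xi>' i l w"
  have c: "?c \<noteq> 0" by simp
  have int: "(\<lambda>w. ?W l s * (?H l w * w ^ (e - s))) contour_integrable_on \<gamma>1" if "l < 2" for l s
    by (intro contour_integrable_lmul moment_ker_integrable ij that)
  have mom: "contour_integral \<gamma>1 (\<lambda>w. ?W l s * (?H l w * w ^ (e - s))) = ?W l s * (?c * fps_nth (moment_fps \<gamma>1 (?H l)) (e - s))"
    if "l < 2" for l s
    using c by (simp add: contour_integral_lmul[OF moment_ker_integrable[OF ij(1) that]] moment_fps_def)
  have "contour_integral \<gamma>1 (\<lambda>w. contour_integral \<gamma>01 (\<lambda>z. integrand h m m' \<xi> \<xi>' i j w z))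
    = contour_integral \<gamma>1 (\<lambda>w. ?c * (\<Sum>s\<le>e. ?W 0 s * (?H 0 w * w ^ (e - s)) + ?W (Suc 0) s * (?H (Suc 0) w * w ^ (e - s))))"
  proof (rule contour_integral_eq, goal_cases)
    case (1 w)
    show ?case
      unfolding contour_integral_inner[OF 1 ij \<xi>] e_def[symmetric] by (simp only: distrib_right distrib_left mult_ac)
  qed
  also have "\<dots> = ?c * contour_integral \<gamma>1 (\<lambda>w. \<Sum>s\<le>e. ?W 0 s * (?H 0 w * w ^ (e - s)) + ?W (Suc 0) s * (?H (Suc 0) w * w ^ (e - s)))"
    by (intro contour_integral_lmul contour_integrable_sum contour_integrable_add int) auto
  also have "contour_integral \<gamma>1 (\<lambda>w. \<Sum>s\<le>e. ?W 0 s * (?H 0 w * w ^ (e - s)) + ?W (Suc 0) s * (?H (Suc 0) w * w ^ (e - s)))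
    = (\<Sum>s\<le>e. contour_integral \<gamma>1 (\<lambda>w. ?W 0 s * (?H 0 w * w ^ (e - s)) + ?W (Suc 0) s * (?H (Suc 0) w * w ^ (e - s))))"
    by (intro contour_integral_sum contour_integrable_add int) auto
  also have "\<dots> = (\<Sum>s\<le>e. ?W 0 s * (?c * fps_nth (moment_fps \<gamma>1 (?H 0)) (e - s)) + ?W (Suc 0) s * (?c * fps_nth (moment_fps \<gamma>1 (?H (Suc 0))) (e - s)))"
    using mom[of 0] mom[of "Suc 0"] by (intro sum.cong refl) (subst contour_integral_add[OF int int], auto)
  also have "\<dots> = ?c * (\<Sum>s\<le>e. ?W 0 s * fps_nth (moment_fps \<gamma>1 (?H 0)) (e - s) + ?W (Suc 0) s * fps_nth (moment_fps \<gamma>1 (?H (Suc 0))) (e - s))"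
    by (simp add: sum_distrib_left algebra_simps)
  also have "(\<Sum>s\<le>e. ?W 0 s * fps_nth (moment_fps \<gamma>1 (?H 0)) (e - s) + ?W (Suc 0) s * fps_nth (moment_fps \<gamma>1 (?H (Suc 0))) (e - s))
     = fps_nth ((moment_mat h m' \<xi>' * outer_fps h m) $$ (i, j)) e"
  proof -
    have "(moment_mat h m' \<xi>' * outer_fps h m) $$ (i, j) = moment_fps \<gamma>1 (?H 0) * outer_fps h m $$ (0, j) + moment_fps \<gamma>1 (?H (Suc 0)) * outer_fps h m $$ (Suc 0, j)"
      using ij mat_2_mult_index[OF moment_mat_carrier outer_fps_carrier ij] by (simp add: moment_mat_def)
    then show ?thesis
      by (simp add: mult.commute[of "moment_fps _ _"] fps_mult_nth atLeast0AtMost sum.distrib)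
  qed
  finally have dbl: "contour_integral \<gamma>1 (\<lambda>w. contour_integral \<gamma>01 (\<lambda>z. integrand h m m' \<xi> \<xi>' i j w z))
    = ?c * (?c * fps_nth ((moment_mat h m' \<xi>' * outer_fps h m) $$ (i, j)) e)" .
  have N: "2 * h div 2 = h" by simp
  have sng: "- (if m > m' then 1 else 0) / ?c * contour_integral \<gamma>01 (\<lambda>z. mat_powi (\<Phi> z) (int m - int m') $$ (i, j) * z powi (\<xi>' - \<xi>) / z)
    = - (if m > m' \<and> \<xi>' \<ge> \<xi> then fps_nth ((\<Phi>F ^\<^sub>m (m - m')) $$ (i, j)) (nat (\<xi>' - \<xi>)) else 0)"
    using contour_integral_single[OF ij, of m' m \<xi>' \<xi>] c by (cases "m > m'") simp_all
  have "1 / ?c\<^sup>2 * (?c * (?c * x)) = x" for x :: complex using c by (simp add: power2_eq_square)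
  then show ?thesis unfolding aztec_kernel_def N sng dbl e_def by simp
qed

end


section \<open>The correlation functions\<close>

lemma sum_pairs: "(\<Sum>k = 0..<2 * (n :: nat). f k) = (\<Sum>x = 0..<n. f (2 * x) + f (2 * x + 1) :: 'a :: comm_monoid_add)"
  by (induction n) (auto simp: algebra_simps)

text \<open>Counting start blocks downwards, \<open>t = n - 1 - k div 2\<close>, turns the sum over
  starting points into a convolution at index \<open>D\<close>. Only \<open>t < n\<close> belongs to
  starting points; \<open>trunc\<close> says that the rest of the convolution vanishes.\<close>

lemma sum_start_toeplitz:
  assumes F: "F \<in> mats2" and G: "G \<in> mats2" and i: "i < 2"
    and v: "v div 2 \<le> int n - 1"
    and trunc: "\<And>q t. q < 2 \<Longrightarrow> n \<le> t \<Longrightarrow> int t \<le> int n - 1 - v div 2 \<Longrightarrow> fps_nth (F $$ (i, q)) t = 0"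
  shows "(\<Sum>k = 0..<2 * n. fps_nth (F $$ (i, k mod 2)) (n - 1 - k div 2) * toeplitz G (int k) v)
     = fps_nth ((F * G) $$ (i, nat (v mod 2))) (nat (int n - 1 - v div 2))"
proof -
  define D where "D = nat (int n - 1 - v div 2)"
  define s where "s = nat (v mod 2)"
  have D: "int D = int n - 1 - v div 2" using v by (simp add: D_def)
  have s: "s < 2" by (simp add: s_def nat_less_iff)
  let ?t = "\<lambda>t. fps_nth (F $$ (i, 0)) t * fps_nth (G $$ (0, s)) (D - t) + fps_nth (F $$ (i, Suc 0)) t * fps_nth (G $$ (Suc 0, s)) (D - t)"
  have even: "toeplitz G (int (2 * x)) v = (if n - 1 - x \<le> D then fps_nth (G $$ (0, s)) (D - (n - 1 - x)) else 0)"
    and odd: "toeplitz G (int (2 * x + 1)) v = (if n - 1 - x \<le> D then fps_nth (G $$ (Suc 0, s)) (D - (n - 1 - x)) else 0)"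
    if "x < n" for x
  proof -
    have 1: "n - 1 - x \<le> D \<longleftrightarrow> v div 2 \<le> int x" using D that by linarith
    have 2: "nat (int x - v div 2) = D - (n - 1 - x)" if "v div 2 \<le> int x" using D \<open>x < n\<close> that by linarith
    have 3: "int (2 * x) div 2 = int x" "nat (int (2 * x) mod 2) = 0" "int (2 * x + 1) div 2 = int x" "nat (int (2 * x + 1) mod 2) = Suc 0"
      by (simp_all add: nat_mod_distrib)
    show "toeplitz G (int (2 * x)) v = (if n - 1 - x \<le> D then fps_nth (G $$ (0, s)) (D - (n - 1 - x)) else 0)"
      unfolding toeplitz_def 3 1 s_def using 2 by (cases "v div 2 \<le> int x") auto
    show "toeplitz G (int (2 * x + 1)) v = (if n - 1 - x \<le> D then fps_nth (G $$ (Suc 0, s)) (D - (n - 1 - x)) else 0)"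
      unfolding toeplitz_def 3 1 s_def using 2 by (cases "v div 2 \<le> int x") auto
  qed
  have "(\<Sum>k = 0..<2 * n. fps_nth (F $$ (i, k mod 2)) (n - 1 - k div 2) * toeplitz G (int k) v)
    = (\<Sum>x = 0..<n. if n - 1 - x \<le> D then ?t (n - 1 - x) else 0)" unfolding sum_pairs
  proof (rule sum.cong[OF refl])
    fix x assume "x \<in> {0..<n}"
    then have x: "x < n" by simp
    have m: "(2 * x) mod 2 = 0" "(2 * x + 1) mod 2 = Suc 0" "(2 * x) div 2 = x" "(2 * x + 1) div 2 = x" by simp_all
    show "fps_nth (F $$ (i, (2 * x) mod 2)) (n - 1 - (2 * x) div 2) * toeplitz G (int (2 * x)) v
       + fps_nth (F $$ (i, (2 * x + 1) mod 2)) (n - 1 - (2 * x + 1) div 2) * toeplitz G (int (2 * x + 1)) v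
       = (if n - 1 - x \<le> D then ?t (n - 1 - x) else 0)" unfolding m even[OF x] odd[OF x] by simp
  qed
  also have "\<dots> = (\<Sum>t = 0..<n. if t \<le> D then ?t t else 0)"
    by (rule sum.reindex_bij_witness[where i = "\<lambda>t. n - 1 - t" and j = "\<lambda>x. n - 1 - x"]) auto
  also have "\<dots> = (\<Sum>t = 0..D. ?t t)"
  proof (rule sum.mono_neutral_cong)
    fix t assume "t \<in> {0..D} - {0..<n}"
    then have "n \<le> t" "int t \<le> int n - 1 - v div 2" using D by auto
    then show "?t t = 0" using trunc[of 0 t] trunc[of "Suc 0" t] by simp
  qed auto
  also have "\<dots> = fps_nth ((F * G) $$ (i, s)) D"
    using mat_2_mult_index[OF F G i s] by (simp add: fps_mult_nth sum.distrib)
  finally show ?thesis by (simp add: s_def D_def)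
qed

theorem theorem5p2:
  fixes \<alpha> \<beta> :: real
    and N n l :: nat
    and S :: "complex \<Rightarrow> complex"
    and E :: "complex \<Rightarrow> complex mat"
    and \<gamma>1 \<gamma>01 :: "real \<Rightarrow> complex"
    and m r :: "nat \<Rightarrow> nat"
    and \<xi> :: "nat \<Rightarrow> int"
  assumes "\<alpha> > 0" and "\<beta> > 0" and "\<alpha> * \<beta> = 1"
    and "even N" and "N > 0" and "n \<ge> N"
    and "aztec_sqrt_branch \<alpha> \<beta> S"
    and "\<And>z. z \<notin> \<real>\<^sub>\<le>\<^sub>0 \<Longrightarrow> z \<noteq> 1 \<Longrightarrow>
           similar_mat_wit (aztec_Phi \<alpha> \<beta> z)
             (mat_of_rows_list 2 [[aztec_rho1 \<alpha> \<beta> S z, 0], [0, aztec_rho2 \<alpha> \<beta> S z]])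
             (E z) (mat_inv (E z))"
    and "pos_contour_around \<gamma>1 {1}" and "path_image \<gamma>1 \<inter> \<real>\<^sub>\<le>\<^sub>0 = {}"
    and "pos_contour_around \<gamma>01 ({0} \<union> path_image \<gamma>1)"
    and "\<And>k. k < l \<Longrightarrow> 0 < m k \<and> m k < N"
    and "\<And>k. k < l \<Longrightarrow> - int N \<le> \<xi> k \<and> \<xi> k \<le> -1"
    and "\<And>k. k < l \<Longrightarrow> r k \<in> {0, 1}"
    and "inj_on (\<lambda>k. (4 * m k, 2 * \<xi> k + int (r k))) {..<l}"
  shows "complex_of_real (measure (aztec_measure \<alpha> \<beta> N n)
           {C \<in> aztec_configs N n. \<forall>k<l. (4 * m k, 2 * int n + 2 * \<xi> k + int (r k)) \<in> C})
       = Determinant.det (mat l l (\<lambda>(k, k').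
           aztec_kernel \<alpha> \<beta> N S E \<gamma>1 \<gamma>01 (m k) (\<xi> k) (r k) (m k') (\<xi> k') (r k')))"
proof -
  interpret aztec_contours \<alpha> \<beta> S E \<gamma>1 \<gamma>01 by unfold_locales (fact assms)+
  obtain h where N: "N = 2 * h" using \<open>even N\<close> by (elim evenE)
  define u where "u k = 2 * int n + 2 * \<xi> k + int (r k)" for k
  define T where "T = (\<lambda>m u v. complex_of_real (step \<alpha> \<beta> m u v))"
  let ?X = "slab N n" and ?b = "end_height N" and ?P = "path_sum (slab N n) T"
  let ?\<Phi> = "Phi_fps \<alpha> \<beta>"
  have X: "?X = {2 * (- int N)..<2 * int n}" by (simp add: slab_def)
  have m: "0 < m k" "m k < N" and \<xi>: "- int N \<le> \<xi> k" "\<xi> k \<le> -1" and r: "r k < 2" if "k < l" for k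
    using assms(12-14)[OF that] by auto
  have u_div: "u k div 2 = int n + \<xi> k" and u_mod: "nat (u k mod 2) = r k" if "k < l" for k
  proof -
    have "u k = 2 * (int n + \<xi> k) + int (r k)" by (simp add: u_def)
    moreover have "(2 * y + int (r k)) div 2 = y" "nat ((2 * y + int (r k)) mod 2) = r k" for y
      using r[OF that] by (auto simp: less_2_cases_iff)
    ultimately show "u k div 2 = int n + \<xi> k" "nat (u k mod 2) = r k" by (simp_all only:)
  qed
  have uX: "u k \<in> ?X" if "k < l" for k
    using u_div[OF that] \<xi>[OF that] \<open>n \<ge> N\<close> r[OF that] by (auto simp: slab_def u_def)
  have aX: "int j \<in> ?X" if "j < 2 * n" for j using that by (auto simp: slab_def)
  have bX: "?b j \<in> ?X" if "j < 2 * n" for j using that by (auto simp: slab_def end_height_def)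
  have P: "?P (4 * p) (4 * d) x y = toeplitz (?\<Phi> ^\<^sub>m d) x y" if "x \<in> ?X" "y \<in> ?X" for p d x y
    unfolding T_def using that path_sum_toeplitz[of x "- int N" "int n" y \<alpha> \<beta> "4 * p" "4 * d"]
    by (simp add: X step_fps_prod_4[OF \<open>\<alpha> * \<beta> = 1\<close>])
  have P0: "?P 0 (4 * d) x y = toeplitz (?\<Phi> ^\<^sub>m d) x y" if "x \<in> ?X" "y \<in> ?X" for d x y
    using P[OF that, of 0 d] by simp
  have sub4: "4 * p - 4 * p' = 4 * (p - p')" for p p' :: nat by simp
  define H where "H k = moment_mat h (m k) (\<xi> k) * map_mat fps_of_poly (adjA2B2_poly \<alpha> \<beta> ^\<^sub>m h)" for k
  have Hc: "H k \<in> mats2" for k unfolding H_def by (intro mult_carrier_mat[of _ 2 2]) simp_all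
  \<comment> \<open>The solution of the linear system: row \<open>r k\<close> of the coefficients of
    \<open>H k\<close>, assigned to the starting points from the top block down.\<close>
  define Q where "Q k j = fps_nth (H k $$ (r k, j mod 2)) (n - 1 - j div 2)" for k j
  define K where "K i k = - (if 4 * m i < 4 * m k then ?P (4 * m i) (4 * m k - 4 * m i) (u i) (u k) else 0)
      + (\<Sum>j = 0..<2 * n. Q i j * ?P 0 (4 * m k) (int j) (u k))" for i k
  have Q: "(\<Sum>j = 0..<2 * n. Q i j * ?P 0 (4 * N) (int j) (?b c)) = ?P (4 * m i) (4 * N - 4 * m i) (u i) (?b c)"
    if i: "i < l" and c: "c < 2 * n" for i c
  proof -
    define e where "e = nat (int n - 1 - ?b c div 2)"
    have bdiv: "?b c div 2 = int (c div 2) - int N" "?b c mod 2 = int (c mod 2)"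
      unfolding end_height_def zdiv_int zmod_int of_nat_numeral by presburger+
    have cn: "c div 2 < n" using c by simp
    then have e: "int e = int n - 1 + int N - int (c div 2)" by (simp add: e_def bdiv)
    \<comment> \<open>End blocks lie \<open>N = 2 * h\<close> below start blocks, so every index
      that occurs is in the range of \<open>A2B2_coefficients\<close>.\<close>
    then have eN: "2 * h \<le> e" using cn N by linarith
    have "(\<Sum>j = 0..<2 * n. Q i j * ?P 0 (4 * N) (int j) (?b c)) = (\<Sum>j = 0..<2 * n. Q i j * toeplitz (?\<Phi> ^\<^sub>m N) (int j) (?b c))"
      using aX bX[OF c] by (intro sum.cong) (auto simp: P0)
    also have "\<dots> = fps_nth ((H i * ?\<Phi> ^\<^sub>m N) $$ (r i, nat (?b c mod 2))) e"
      unfolding Q_def e_def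
    proof (rule sum_start_toeplitz[OF Hc pow_carriers(3) r[OF i]])
      show "?b c div 2 \<le> int n - 1" using cn bdiv(1) by linarith
      \<comment> \<open>Here \<open>n \<ge> N\<close> is used: the coefficients of
        \<open>H i\<close> vanish from index \<open>N\<close> on, while \<open>n\<close> start
        blocks are available.\<close>
      fix q t assume "q < (2 :: nat)" "n \<le> t"
      then show "fps_nth (H i $$ (r i, q)) t = 0"
        unfolding H_def using \<open>n \<ge> N\<close> N by (intro adjA2B2_truncates r i) auto
    qed
    also have "H i * ?\<Phi> ^\<^sub>m N = moment_mat h (m i) (\<xi> i) * map_mat fps_of_poly (A2B2_poly \<alpha> \<beta> ^\<^sub>m h)"
      unfolding H_def N adjA2B2_pow_Phi_pow_fps[OF \<open>\<alpha> * \<beta> = 1\<close>, symmetric]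
      by (rule assoc_mult_mat[of _ 2 2 _ 2 _ 2]) simp_all
    also have "fps_nth (\<dots> $$ (r i, nat (?b c mod 2))) e = fps_nth ((?\<Phi> ^\<^sub>m (N - m i)) $$ (r i, nat (?b c mod 2))) (nat (int e + \<xi> i + 1))"
      unfolding N by (rule A2B2_coefficients[OF eN r[OF i]]) (use m[OF i] \<xi>(1)[OF i] N in \<open>auto simp: nat_less_iff\<close>)
    also have "\<dots> = toeplitz (?\<Phi> ^\<^sub>m (N - m i)) (u i) (?b c)"
    proof -
      have "u i div 2 - ?b c div 2 = int e + \<xi> i + 1" using e bdiv(1) u_div[OF i] by simp
      moreover have "?b c div 2 \<le> u i div 2" using calculation eN \<xi>(1)[OF i] N by linarith
      ultimately show ?thesis by (simp add: toeplitz_def u_mod[OF i])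
    qed
    also have "\<dots> = ?P (4 * m i) (4 * N - 4 * m i) (u i) (?b c)"
      unfolding sub4 by (rule P[symmetric, OF uX[OF i] bX[OF c]])
    finally show ?thesis .
  qed
  \<comment> \<open>The first point of \<open>aztec_kernel\<close> gives the column index of its
    matrices, whereas \<open>K\<close> has as row the point where the path weights start; hence the
    exchanged indices, undone by transposing the determinant.\<close>
  have kernel: "aztec_kernel \<alpha> \<beta> N S E \<gamma>1 \<gamma>01 (m k) (\<xi> k) (r k) (m k') (\<xi> k') (r k') = K k' k"
    if k: "k < l" and k': "k' < l" for k k'
  proof -
    have W: "moment_mat h (m k') (\<xi> k') * outer_fps h (m k) = H k' * ?\<Phi> ^\<^sub>m m k"
      unfolding H_def outer_fps_def by (rule assoc_mult_mat[symmetric, of _ 2 2 _ 2 _ 2]) simp_all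
    have "(\<Sum>j = 0..<2 * n. Q k' j * ?P 0 (4 * m k) (int j) (u k)) = (\<Sum>j = 0..<2 * n. Q k' j * toeplitz (?\<Phi> ^\<^sub>m m k) (int j) (u k))"
      using aX uX[OF k] by (intro sum.cong) (auto simp: P0)
    \<comment> \<open>\<open>u k\<close> lies in block \<open>n + \<xi> k\<close>, which is
      nonnegative, so all convolution indices are below \<open>n\<close> and the truncation
      condition is vacuous.\<close>
    also have "\<dots> = fps_nth ((H k' * ?\<Phi> ^\<^sub>m m k) $$ (r k', nat (u k mod 2))) (nat (int n - 1 - u k div 2))"
      unfolding Q_def
      by (rule sum_start_toeplitz[OF Hc pow_carriers(3) r[OF k']]) (use u_div[OF k] \<xi>[OF k] \<open>n \<ge> N\<close> in auto)
    also have "\<dots> = fps_nth ((H k' * ?\<Phi> ^\<^sub>m m k) $$ (r k', r k)) (nat (- \<xi> k - 1))"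
    proof -
      have "int n - 1 - u k div 2 = - \<xi> k - 1" using u_div[OF k] by simp
      then show ?thesis by (simp only: u_mod[OF k])
    qed
    finally have 1: "(\<Sum>j = 0..<2 * n. Q k' j * ?P 0 (4 * m k) (int j) (u k)) = fps_nth ((H k' * ?\<Phi> ^\<^sub>m m k) $$ (r k', r k)) (nat (- \<xi> k - 1))" .
    have 2: "(if 4 * m k' < 4 * m k then ?P (4 * m k') (4 * m k - 4 * m k') (u k') (u k) else 0)
       = (if m k > m k' \<and> \<xi> k' \<ge> \<xi> k then fps_nth ((?\<Phi> ^\<^sub>m (m k - m k')) $$ (r k', r k)) (nat (\<xi> k' - \<xi> k)) else 0)"
      unfolding sub4 P[OF uX[OF k'] uX[OF k]] toeplitz_def u_div[OF k] u_div[OF k'] u_mod[OF k] u_mod[OF k']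
      by simp
    have "K k' k = - (if m k > m k' \<and> \<xi> k' \<ge> \<xi> k then fps_nth ((?\<Phi> ^\<^sub>m (m k - m k')) $$ (r k', r k)) (nat (\<xi> k' - \<xi> k)) else 0)
      + fps_nth ((H k' * ?\<Phi> ^\<^sub>m m k) $$ (r k', r k)) (nat (- \<xi> k - 1))"
      unfolding K_def 1 2 ..
    then show ?thesis unfolding N aztec_kernel_eq[OF r[OF k'] r[OF k] \<xi>(2)[OF k]] W by (rule sym)
  qed
  have inj: "inj_on (\<lambda>k. (4 * m k, u k)) {..<l}" using assms(15) by (auto simp: inj_on_def u_def)
  have N4: "0 < 4 * N" using \<open>N > 0\<close> by simp
  have em: "(\<Sum>Y\<in>slab_families N n. family_weight (2 * n) T int ?b (4 * N) Y * of_bool (\<forall>k<l. u k \<in> Y (4 * m k)))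
    = fdet (2 * n) (\<lambda>j i. ?P 0 (4 * N) (int j) (?b i)) * fdet l K"
    by (rule eynard_mehta[where m = "\<lambda>k. 4 * m k" and u = u and Q = Q])
      (use aX N4 m uX inj Q in \<open>auto simp: K_def\<close>)
  let ?w = "tiling_weight \<alpha> \<beta> N n"
  define Z where "Z = (\<Sum>Y\<in>slab_families N n. ?w Y)"
  have w: "of_real (?w Y) = family_weight (2 * n) T int ?b (4 * N) Y" for Y
    unfolding T_def by (rule of_real_family_weight)
  have Z: "complex_of_real Z = fdet (2 * n) (\<lambda>j i. ?P 0 (4 * N) (int j) (?b i))"
  proof -
    have "Suc (4 * N - 1) = 4 * N" using N4 by simp
    from sum_family_weight[where X = ?X and k = "2 * n" and a = int and M = "4 * N - 1" and T = T and b = ?b, unfolded this]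
    show ?thesis unfolding Z_def of_real_sum w using aX by simp
  qed
  have ob: "complex_of_real (of_bool A) = of_bool A" for A by simp
  have Z0: "Z > 0" unfolding Z_def by (rule measure_aztec(2)[OF assms(1-3) \<open>N > 0\<close>])
  have pts: "(\<forall>k<l. (4 * m k, 2 * int n + 2 * \<xi> k + int (r k)) \<in> config_of N Y) \<longleftrightarrow> (\<forall>k<l. u k \<in> Y (4 * m k))" for Y
    using m by (fastforce simp: config_of_def u_def)
  have "complex_of_real (measure (aztec_measure \<alpha> \<beta> N n)
           {C \<in> aztec_configs N n. \<forall>k<l. (4 * m k, 2 * int n + 2 * \<xi> k + int (r k)) \<in> C})
    = complex_of_real ((\<Sum>Y\<in>slab_families N n. ?w Y * of_bool (\<forall>k<l. u k \<in> Y (4 * m k))) / Z)"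
    unfolding measure_aztec(1)[OF assms(1-3) \<open>N > 0\<close>] pts Z_def ..
  \<comment> \<open>The normalisation \<open>Z\<close> is the determinant of the path weights from
    the starting to the end points; it is positive and cancels the first factor in
    \<open>em\<close>.\<close>
  also have "\<dots> = fdet l K"
    unfolding of_real_divide of_real_sum of_real_mult ob w em Z[symmetric] using Z0 by simp
  also have "\<dots> = fdet l (\<lambda>k k'. K k' k)" by (rule fdet_transpose[symmetric])
  also have "\<dots> = fdet l (\<lambda>k k'. aztec_kernel \<alpha> \<beta> N S E \<gamma>1 \<gamma>01 (m k) (\<xi> k) (r k) (m k') (\<xi> k') (r k'))"
    by (rule fdet_cong) (simp add: kernel)
  finally show ?thesis by (simp only: fdet_def)
qed

end
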